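(* Let $q\in\mathbb{C}$ with $0<|q|<1$. For generic $x,z,u\in\mathbb{C}^*$ the following eleven chains of equalities hold: $$D_{3}(z^{-4},z,q^3z^9;q)=D_{3}(z^{-4},z^3,q^3z^9;q)=\frac{z^5(q;q)_{\infty}(q^3;q^3)_{\infty}^4}{\Theta(z;q)\Theta(z^3;q^3)\Theta(q^2z^3;q^3)\Theta(q^3z^9;q^9)},$$ $$D_{3}(z^{-4},z,q^6z^9;q)=D_{3}(z^{-4},z^3,q^6z^9;q)=\frac{z^3(q;q)_{\infty}(q^3;q^3)_{\infty}^4}{\Theta(z;q)\Theta(z^3;q^3)\Theta(qz^3;q^3)\Theta(q^6z^9;q^9)},$$ $$D_{3}(u^{-5},u^2,q^3u^9;q)=D_{3}(u^{-5},u^3,q^3u^9;q)=\frac{u^7(q;q)_{\infty}(q^3;q^3)_{\infty}^4}{\Theta(u;q)\Theta(u^6;q^3)\Theta(q^2u^3;q^3)\Theta(q^3u^9;q^9)},$$ $$D_{3}(u^{-5},u^2,q^6u^9;q)=D_{3}(u^{-5},u^3,q^6u^9;q)=\frac{u^5(q;q)_{\infty}(q^3;q^3)_{\infty}^4}{\Theta(u;q)\Theta(u^6;q^3)\Theta(qu^3;q^3)\Theta(q^6u^9;q^9)},$$ $$D_{3}(qz^{-4},z,z^9;q^2)=D_{3}(qz^{-4},qz^3,z^9;q^2)=-\frac{q^{-1}z^4(q^2;q^2)_{\infty}^2\Theta(q^3;q^{18})\Theta(-z;q)}{(q;q)_{\infty}\Theta(qz^3;q^2)\Theta(z^9;q^{18})},$$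 $$D_{3}(x,q,q^3x^{-3};q^2)=D_{3}(x,q^{-1}x^{-1},q^3x^{-3};q^2)=-\frac{x^{-1}(q^6;q^6)_{\infty}^3\Theta(x;q^2)\Theta(q^4x^2;q^6)}{(q^3;q^3)_{\infty}\Theta(x;q)\Theta(q^2x;q^6)\Theta(q^3x^{-3};q^{18})},$$ $$D_{3}(qz^{-2},z,z^3;q^2)=D_{3}(qz^{-2},qz,z^3;q^2)=-\frac{q^{-1}z(q^3;q^3)_{\infty}(q^6;q^6)_{\infty}^2\Theta(qz;q^2)\Theta(z^2;q^6)}{\Theta(z;q)\Theta(q^3z;q^6)\Theta(q^3z^{3};q^{6})\Theta(z^{3};q^{18})},$$ $$D_{3}(x,q,q^9;q^2)=D_{3}(x,qx^{-1},q^9;q^2)=-\frac{qx^{-1}\Theta(-q;q^4)(q^3;q^3)_{\infty}(q^6;q^6)_{\infty}^2\Theta(x^2;q)}{\Theta(q^9;q^{18})\Theta(x;q)\Theta(qx^{2};q^{2})\Theta(q^3x^{3};q^{6})},$$ $$D_{3}(qz^{-3},z,q^9z^6;q^2)=D_{3}(qz^{-3},qz^2,q^9z^6;q^2)=-\frac{z\,\Theta(-q;q^4)(q^3;q^3)_{\infty}(q^6;q^6)_{\infty}^2\Theta(z^2;q^3)}{\Theta(qz^2;q^2)\Theta(z;q^{3})\Theta(z^{3};q^{6})\Theta(q^9z^6;q^{18})},$$ $$D_{3}(qu^{-5},u^3,u^9;q^2)=D_{3}(qu^{-5},qu^2,u^9;q^2)=-\frac{q^{-1}u^4(q;q)_{\infty}(q^2;q^2)_{\infty}(q^6;q^6)_{\infty}^3\Theta(u^2;q)\Theta(u^3;q^6)}{(q^3;q^3)_{\infty}\Theta(u;q)\Theta(qu^2;q^{2})\Theta(q^3u^{6};q^{6})\Theta(u^3;q^{2})\Theta(u^9;q^{18})},$$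 $$D_{3}(qz^{-4},z,q^9z^9;q^2)=D_{3}(qz^{-4},qz^3,q^9z^9;q^2)=-\frac{z(q;q)_{\infty}(q^2;q^2)_{\infty}(q^6;q^6)_{\infty}^3\Theta(z^2;q)\Theta(q^3z^3;q^6)}{(q^3;q^3)_{\infty}\Theta(z;q)\Theta(qz^2;q^{2})\Theta(z^{3};q^{6})\Theta(qz^3;q^{2})\Theta(q^9z^9;q^{18})}.$$
   Context: $\mathbb{C}^*=\mathbb{C}\setminus\{0\}$. For $Q\in\mathbb{C}$ with $0<|Q|<1$ and $x\in\mathbb{C}$, $(x;Q)_\infty=\prod_{i\ge 0}(1-Q^i x)$. For $x\in\mathbb{C}^*$, $$\Theta(x;Q)=(x;Q)_\infty(Q/x;Q)_\infty(Q;Q)_\infty=\sum_{n=-\infty}^{\infty}(-1)^nQ^{\binom n2}x^n .$$ The Appell function is $$m(x,z;Q)=\frac{1}{\Theta(z;Q)}\sum_{r=-\infty}^{\infty}\frac{(-1)^rQ^{\binom r2}z^r}{1-Q^{r-1}xz},$$ defined when neither $z$ nor $xz$ is an integral power of $Q$. For any base $Q$, $$D_3(x,z,z';Q)=m(x,z;Q)-m(Q^{3}x^3,z';Q^{9})+Q^{-1}x\,m(x^3,z';Q^{9})-Q^{-3}x^2\,m(Q^{-3}x^3,z';Q^{9}).$$ "Generic" means that, in each identity, the parameters are such that all Appell functions occurring are defined and no denominator vanishes. *)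

theory Defs
  imports "HOL-Analysis.Analysis"
begin

text \<open>Throughout, the base \<open>Q\<close> is meant to satisfy \<open>0 < \<bar>Q\<bar> < 1\<close>. The infinite product and
  the bilateral series below then converge absolutely (the latter whenever
  \<open>appell_defined x z Q\<close> holds and \<open>z \<noteq> 0\<close>).\<close>

definition qpoch_inf :: "complex \<Rightarrow> complex \<Rightarrow> complex" where
  "qpoch_inf x Q = (\<Prod>i. 1 - Q ^ i * x)"

definition Theta :: "complex \<Rightarrow> complex \<Rightarrow> complex" where
  "Theta x Q = qpoch_inf x Q * qpoch_inf (Q / x) Q * qpoch_inf Q Q"

text \<open>In the exponent, \<open>r * (r - 1) div 2\<close> is the binomial coefficient \<open>r\<close> over \<open>2\<close> for an
  arbitrary integer \<open>r\<close>; the division is exact.\<close>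

definition appell_m :: "complex \<Rightarrow> complex \<Rightarrow> complex \<Rightarrow> complex" where
  "appell_m x z Q = 1 / Theta z Q *
     (\<Sum>\<^sub>\<infinity>r::int. (-1) powi r * Q powi (r * (r - 1) div 2) * z powi r
                 / (1 - Q powi (r - 1) * x * z))"

definition appell_defined :: "complex \<Rightarrow> complex \<Rightarrow> complex \<Rightarrow> bool" where
  "appell_defined x z Q \<longleftrightarrow> (\<forall>n::int. z \<noteq> Q powi n) \<and> (\<forall>n::int. x * z \<noteq> Q powi n)"

definition D3 :: "complex \<Rightarrow> complex \<Rightarrow> complex \<Rightarrow> complex \<Rightarrow> complex" where
  "D3 x z z' Q =
     appell_m x z Q
     - appell_m (Q ^ 3 * x ^ 3) z' (Q ^ 9)
     + Q powi (-1) * x * appell_m (x ^ 3) z' (Q ^ 9)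
     - Q powi (-3) * x ^ 2 * appell_m (Q powi (-3) * x ^ 3) z' (Q ^ 9)"

definition D3_defined :: "complex \<Rightarrow> complex \<Rightarrow> complex \<Rightarrow> complex \<Rightarrow> bool" where
  "D3_defined x z z' Q \<longleftrightarrow>
     appell_defined x z Q \<and>
     appell_defined (Q ^ 3 * x ^ 3) z' (Q ^ 9) \<and>
     appell_defined (x ^ 3) z' (Q ^ 9) \<and>
     appell_defined (Q powi (-3) * x ^ 3) z' (Q ^ 9)"

end

theory Submission
  imports Defs "HOL-Complex_Analysis.Complex_Analysis"
begin

text \<open>All eleven evaluations come from one expansion of \<open>D3\<close> into theta quotients, which in turn
comes from Liouville's theorem.

As a function of \<open>x\<close>, the Appell function \<open>m(x, z; q)\<close> has simple poles and satisfies
\<open>m(q x, z; q) = 1 - x m(x, z; q)\<close>. The three functions that \<open>D3\<close> subtracts are arranged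
so that their combination satisfies the same inhomogeneous equation. The \<open>1\<close> therefore cancels and
\<open>D3(q x) = - x D3(x)\<close>, the behaviour of a quotient of theta functions. A holomorphic function
on the punctured plane with \<open>h(q x) = c h(x)\<close> is a monomial (\<open>multiplicatively_periodic\<close>), hence
zero when \<open>c\<close> is no power of \<open>q\<close>; so such a quotient is determined by its residues
(\<open>removable_periodic_eq_0\<close>). Comparing residues gives \<open>D3_formula\<close>: \<open>D3\<close> is a sum of three theta
quotients. The residues agree because of the splitting of a theta series according to the
exponent modulo \<open>3\<close>, applied to the theta product by means of \<open>jacobi_triple_product\<close>.

The same principle yields \<open>m(x, z; q) = m(x, 1 / (x z); q)\<close> (\<open>appell_m_reflect\<close>). In each chain the two values
of the second argument of \<open>D3\<close> are exchanged by \<open>z \<mapsto> 1 / (x z)\<close>, up to a factor that is \<open>1\<close> or the base,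
which is the first equality.

For the second equality, in each chain the expansion is taken at one of the two values of \<open>z\<close>. In ten of the
chains \<open>z' / z ^ 3\<close> is a power of the cube of the base, and then one of the three terms contains
the value \<open>Theta 1 = 0\<close> (\<open>D3_eval_0\<close>, \<open>D3_eval_3\<close>, \<open>D3_eval_6\<close>); in the remaining chain the middle term vanishes because
\<open>x ^ 3 z z'\<close> is a suitable power of \<open>q\<close>. Two terms are left. In the first two chains one of these
vanishes as well. Otherwise their sum is a product, by the quintuple product identity
(\<open>quintuple_product\<close>) or by one of two similar identities (\<open>theta_two_term_degree2\<close>, \<open>theta_two_term_degree5\<close>). These three
identities are proved alike: a theta function of degree \<open>n\<close> with \<open>n\<close> known zeros is a
multiple of a product of \<open>n\<close> shifted theta functions (\<open>theta_like_factorization\<close>), and the factor is found by one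
evaluation.\<close>

section \<open>Infinite products\<close>

lemma summable_qpoch:
  fixes q x :: complex
  assumes "norm q < 1"
  shows "summable (\<lambda>i. norm (q ^ i * x))"
  unfolding norm_mult norm_power
  by (intro summable_mult2 summable_geometric) (use assms in auto)

lemma convergent_prod_qpoch:
  fixes q x :: complex
  assumes "norm q < 1"
  shows "convergent_prod (\<lambda>i. 1 - q ^ i * x)"
proof (rule abs_convergent_prod_imp_convergent_prod)
  show "abs_convergent_prod (\<lambda>i. 1 - q ^ i * x)"
    using summable_qpoch[OF assms, of x]
    by (intro summable_imp_abs_convergent_prod) simp
qed

lemma qpoch_inf_LIMSEQ:
  assumes "norm q < 1"
  shows "(\<lambda>n. \<Prod>i<n. 1 - q ^ i * x) \<longlonglongrightarrow> qpoch_inf x q"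
  using convergent_prod_LIMSEQ[OF convergent_prod_qpoch[OF assms, of x]]
  unfolding qpoch_inf_def by (simp add: LIMSEQ_lessThan_iff_atMost)

lemma qpoch_inf_eq_0_iff:
  assumes "norm q < 1"
  shows "qpoch_inf x q = 0 \<longleftrightarrow> (\<exists>i. q ^ i * x = 1)"
proof -
  have "(\<lambda>i. 1 - q ^ i * x) has_prod qpoch_inf x q"
    unfolding qpoch_inf_def using convergent_prod_qpoch[OF assms] by (rule convergent_prod_has_prod)
  from has_prod_eq_0_iff[OF this] show ?thesis by auto
qed

lemma qpoch_inf_base_nonzero:
  assumes "norm q < 1"
  shows "qpoch_inf q q \<noteq> 0"
proof -
  have "q ^ i * q \<noteq> 1" for i
  proof -
    have "norm (q ^ i * q) < 1"
      using assms by (metis norm_power power_Suc2 power_Suc_less_one norm_ge_zero norm_power power_less_one_iff zero_less_Suc)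
    thus ?thesis by auto
  qed
  thus ?thesis using qpoch_inf_eq_0_iff[OF assms] by auto
qed

text \<open>Sorting the factors by the residue class of their index modulo \<open>n\<close>.\<close>

lemma qpoch_inf_split:
  assumes "norm q < 1" "0 < n"
  shows "qpoch_inf x q = (\<Prod>j<n. qpoch_inf (q ^ j * x) (q ^ n))"
proof -
  have qn: "norm (q ^ n) < 1" using assms by (simp add: norm_power power_less_one_iff)
  have "(\<lambda>m. \<Prod>j<n. \<Prod>i<m. 1 - (q ^ n) ^ i * (q ^ j * x)) \<longlonglongrightarrow> (\<Prod>j<n. qpoch_inf (q ^ j * x) (q ^ n))"
    by (intro tendsto_prod qpoch_inf_LIMSEQ qn)
  moreover have "(\<Prod>j<n. \<Prod>i<m. 1 - (q ^ n) ^ i * (q ^ j * x)) = (\<Prod>k<n*m. 1 - q ^ k * x)" for m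
  proof -
    have "(\<Prod>k<m*n. 1 - q ^ k * x) = (\<Prod>i<m. \<Prod>k\<in>{i*n..<i*n+n}. 1 - q ^ k * x)"
      by (rule prod.nat_group[symmetric])
    also have "\<dots> = (\<Prod>i<m. \<Prod>j<n. 1 - q ^ (i*n+j) * x)"
    proof (rule prod.cong, rule refl)
      fix i
      show "(\<Prod>k\<in>{i*n..<i*n+n}. 1 - q ^ k * x) = (\<Prod>j<n. 1 - q ^ (i*n+j) * x)"
        by (rule prod.reindex_bij_witness[of _ "\<lambda>j. i * n + j" "\<lambda>k. k - i * n"]) auto
    qed
    also have "\<dots> = (\<Prod>j<n. \<Prod>i<m. 1 - q ^ (i*n+j) * x)"
      by (rule prod.swap)
    finally show ?thesis
      by (simp add: power_add power_mult[symmetric] mult_ac)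
  qed
  ultimately have 1: "(\<lambda>m. \<Prod>k<n*m. 1 - q ^ k * x) \<longlonglongrightarrow> (\<Prod>j<n. qpoch_inf (q ^ j * x) (q ^ n))"
    by simp
  have "strict_mono (\<lambda>m. n * m)" using assms(2) by (auto simp: strict_mono_def)
  from LIMSEQ_subseq_LIMSEQ[OF qpoch_inf_LIMSEQ[OF assms(1), of x] this]
  have "(\<lambda>m. \<Prod>k<n*m. 1 - q ^ k * x) \<longlonglongrightarrow> qpoch_inf x q"
    by (simp add: o_def)
  from LIMSEQ_unique[OF this 1] show ?thesis .
qed

lemma qpoch_inf_square:
  assumes "norm q < 1"
  shows "qpoch_inf (x ^ 2) (q ^ 2) = qpoch_inf x q * qpoch_inf (- x) q"
proof (rule LIMSEQ_unique)
  have q2: "norm (q ^ 2) < 1" using assms by (simp add: norm_power power_less_one_iff)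
  show "(\<lambda>m. \<Prod>i<m. 1 - (q ^ 2) ^ i * x ^ 2) \<longlonglongrightarrow> qpoch_inf (x ^ 2) (q ^ 2)"
    by (rule qpoch_inf_LIMSEQ[OF q2])
  have "(\<lambda>m. (\<Prod>i<m. 1 - q ^ i * x) * (\<Prod>i<m. 1 - q ^ i * (-x))) \<longlonglongrightarrow> qpoch_inf x q * qpoch_inf (- x) q"
    by (intro tendsto_mult qpoch_inf_LIMSEQ assms)
  thus "(\<lambda>m. \<Prod>i<m. 1 - (q ^ 2) ^ i * x ^ 2) \<longlonglongrightarrow> qpoch_inf x q * qpoch_inf (- x) q"
    by (simp add: prod.distrib[symmetric] algebra_simps power2_eq_square power_mult_distrib)
qed

lemma qpoch_inf_step:
  assumes "norm q < 1"
  shows "qpoch_inf x q = (1 - x) * qpoch_inf (q * x) q"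
proof (rule LIMSEQ_unique)
  show "(\<lambda>m. \<Prod>i<Suc m. 1 - q ^ i * x) \<longlonglongrightarrow> qpoch_inf x q"
    using qpoch_inf_LIMSEQ[OF assms] LIMSEQ_Suc by blast
  have "(\<lambda>m. (1 - x) * (\<Prod>i<m. 1 - q ^ i * (q * x))) \<longlonglongrightarrow> (1 - x) * qpoch_inf (q * x) q"
    by (intro tendsto_mult tendsto_const qpoch_inf_LIMSEQ assms)
  thus "(\<lambda>m. \<Prod>i<Suc m. 1 - q ^ i * x) \<longlonglongrightarrow> (1 - x) * qpoch_inf (q * x) q"
    by (subst prod.lessThan_Suc_shift) (simp add: mult_ac)
qed

lemma holomorphic_on_qpoch_inf:
  assumes "norm q < 1"
  shows "(\<lambda>x. qpoch_inf x q) holomorphic_on A"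
proof -
  have "(\<lambda>x. qpoch_inf x q) holomorphic_on ball 0 R" if "R > 0" for R
  proof (rule holomorphic_uniform_limit)
    have "uniformly_convergent_on (cball 0 R) (\<lambda>N x. \<Prod>n<N. 1 - q ^ n * x)"
    proof (rule uniformly_convergent_on_prod')
      show "uniformly_convergent_on (cball 0 R) (\<lambda>N x. \<Sum>n<N. norm (1 - q ^ n * x - 1))"
      proof (rule Weierstrass_m_test')
        show "summable (\<lambda>n. norm q ^ n * R)" using assms by (intro summable_mult2 summable_geometric) auto
      qed (auto simp: norm_mult norm_power intro!: mult_left_mono)
    qed (auto intro!: continuous_intros)
    hence "uniform_limit (cball 0 R) (\<lambda>N x. \<Prod>n<N. 1 - q ^ n * x) (\<lambda>x. lim (\<lambda>N. \<Prod>n<N. 1 - q ^ n * x)) sequentially"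
      by (simp add: uniformly_convergent_uniform_limit_iff)
    also have "(\<lambda>x. lim (\<lambda>N. \<Prod>n<N. 1 - q ^ n * x)) = (\<lambda>x. qpoch_inf x q)"
      using qpoch_inf_LIMSEQ[OF assms] by (auto intro!: ext limI)
    finally show "uniform_limit (cball 0 R) (\<lambda>N x. \<Prod>n<N. 1 - q ^ n * x) (\<lambda>x. qpoch_inf x q) sequentially" .
  qed (auto intro!: always_eventually continuous_intros holomorphic_intros)
  hence "(\<lambda>x. qpoch_inf x q) holomorphic_on ball 0 (norm x + 1)" for x :: complex
    by (simp add: add_nonneg_pos)
  hence "(\<lambda>x. qpoch_inf x q) analytic_on {x}" for x
    by (intro analytic_at[THEN iffD2] exI[of _ "ball 0 (norm x + 1)"]) auto
  thus ?thesis
    by (meson analytic_imp_holomorphic analytic_on_analytic_at)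
qed

text \<open>Needed for the limit that fixes the constant in the Jacobi triple product. The bound comes
from \<open>\<bar>\<Prod>(1 + a) - 1\<bar> \<le> \<Prod>(1 + \<bar>a\<bar>) - 1 \<le> exp (\<Sum>\<bar>a\<bar>) - 1\<close>.\<close>

lemma qpoch_inf_tendsto_1:
  assumes "\<And>n. norm (Q n) < (1::real)" "Q \<longlonglongrightarrow> 0"
  shows "(\<lambda>n. qpoch_inf (Q n) (Q n)) \<longlonglongrightarrow> 1"
proof -
  have bd: "norm (qpoch_inf q q - 1) \<le> exp (norm q / (1 - norm q)) - 1" if q: "norm q < 1" for q :: complex
  proof (rule tendsto_upperbound)
    show "(\<lambda>n. norm ((\<Prod>i<n. 1 - q ^ i * q) - 1)) \<longlonglongrightarrow> norm (qpoch_inf q q - 1)"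
      by (intro tendsto_intros qpoch_inf_LIMSEQ q)
    have "norm ((\<Prod>i<n. 1 - q ^ i * q) - 1) \<le> exp (norm q / (1 - norm q)) - 1" for n
    proof -
      have "norm ((\<Prod>i<n. 1 + (- (q ^ i * q))) - 1) \<le> (\<Prod>i<n. 1 + norm (- (q ^ i * q))) - 1"
        by (rule norm_prod_minus1_le_prod_minus1)
      also have "(\<Prod>i<n. 1 + norm (- (q ^ i * q))) \<le> (\<Prod>i<n. exp (norm (- (q ^ i * q))))"
        by (intro prod_mono) (auto simp: add_nonneg_nonneg exp_ge_add_one_self)
      also have "\<dots> = exp (\<Sum>i<n. norm (- (q ^ i * q)))" by (simp add: exp_sum)
      also have "(\<Sum>i<n. norm (- (q ^ i * q))) \<le> (\<Sum>i. norm (- (q ^ i * q)))"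
        using summable_qpoch[OF q, of q] by (intro sum_le_suminf) (auto simp: norm_mult)
      also have "\<dots> = norm q / (1 - norm q)"
        using q suminf_geometric[of "norm q"] suminf_mult2[of "\<lambda>i. norm q ^ i" "norm q"] summable_geometric[of "norm q"]
        by (simp add: norm_mult norm_power)
      finally show ?thesis by simp
    qed
    thus "\<forall>\<^sub>F n in sequentially. norm ((\<Prod>i<n. 1 - q ^ i * q) - 1) \<le> exp (norm q / (1 - norm q)) - 1" by simp
  qed auto
  have "(\<lambda>n. exp (norm (Q n) / (1 - norm (Q n))) - 1) \<longlonglongrightarrow> exp (norm (0::complex) / (1 - norm (0::complex))) - 1"
    by (intro tendsto_intros assms) auto
  hence "(\<lambda>n. exp (norm (Q n) / (1 - norm (Q n))) - 1) \<longlonglongrightarrow> 0" by simp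
  hence "(\<lambda>n. qpoch_inf (Q n) (Q n) - 1) \<longlonglongrightarrow> 0"
    by (rule Lim_null_comparison[rotated]) (use bd assms in auto)
  thus ?thesis by (simp add: LIM_zero_iff)
qed

section \<open>The theta product\<close>

text \<open>Splits off the factor responsible for the zero at \<open>1\<close>.\<close>

lemma Theta_alt:
  assumes "q \<noteq> 0" "norm q < 1" "x \<noteq> 0"
  shows "Theta x q = (1 - x) * (qpoch_inf (q * x) q * qpoch_inf (q / x) q * qpoch_inf q q)"
  unfolding Theta_def by (subst qpoch_inf_step[OF assms(2)]) simp

lemma Theta_step:
  assumes "q \<noteq> 0" "norm q < 1" "x \<noteq> 0"
  shows "Theta (q * x) q = - Theta x q / x"
proof -
  have "Theta (q * x) q = qpoch_inf (q * x) q * ((1 - 1 / x) * qpoch_inf (q / x) q) * qpoch_inf q q"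
    unfolding Theta_def using qpoch_inf_step[OF assms(2), of "1 / x"] assms by simp
  thus ?thesis
    using assms by (simp add: Theta_alt field_simps)
qed

lemma Theta_flip:
  assumes "q \<noteq> 0" "x \<noteq> 0"
  shows "Theta (q / x) q = Theta x q"
  using assms by (simp add: Theta_def)

lemma Theta_inverse:
  assumes "q \<noteq> 0" "norm q < 1" "x \<noteq> 0"
  shows "Theta (1 / x) q = - Theta x q / x"
proof -
  have "Theta (q / x) q = - Theta (1 / x) q * x"
    using Theta_step[of q "1 / x"] assms by simp
  thus ?thesis using Theta_flip[of q x] assms by (simp add: field_simps)
qed

lemma binom2_Suc: "(n + 1) * ((n + 1) - 1) div 2 = n * (n - 1) div 2 + (n::int)"
proof -
  have "(n + 1) * ((n + 1) - 1) = n * (n - 1) + n * 2" by (simp add: algebra_simps)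
  thus ?thesis by simp
qed

lemma Theta_powi:
  assumes "q \<noteq> 0" "norm q < 1" "x \<noteq> 0"
  shows "Theta (q powi n * x) q = (-1) powi n * q powi (- (n * (n - 1) div 2)) * x powi (- n) * Theta x q"
proof -
  have step: "Theta (q powi (n + 1) * x) q = - Theta (q powi n * x) q / (q powi n * x)" for n
    using Theta_step[of q "q powi n * x"] assms by (simp add: power_int_add mult_ac)
  define R where "R n = (-1) powi n * q powi (- (n * (n - 1) div 2)) * x powi (- n) * Theta x q" for n
  have R: "R (n + 1) = - R n / (q powi n * x)" for n
    unfolding R_def binom2_Suc using assms
    by (simp add: power_int_add power_int_diff power_int_minus field_simps)
  show ?thesis unfolding R_def[symmetric]
  proof (induction n rule: int_induct[where k = 0])
    case base thus ?case by (simp add: R_def)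
  next
    case (step1 i) thus ?case by (simp only: step R)
  next
    case (step2 i)
    thus ?case using step[of "i - 1"] R[of "i - 1"] assms by (simp add: field_simps)
  qed
qed

lemma powi_eq_1_iff:
  fixes q :: complex
  assumes "q \<noteq> 0" "norm q < 1"
  shows "q powi n = 1 \<longleftrightarrow> n = 0"
proof
  assume "q powi n = 1"
  hence "norm q powi n = 1" by (metis norm_power_int norm_one)
  moreover have "norm q powi n < 1" if "n > 0"
    using that assms by (simp add: power_int_def power_less_one_iff)
  moreover have "norm q powi (-n) < 1" if "n < 0"
    using that assms by (simp add: power_int_def power_less_one_iff)
  ultimately show "n = 0"
    by (cases "n = 0"; cases "n > 0") (auto simp: power_int_minus)
qed simp

lemma Theta_eq_0_iff:
  assumes "q \<noteq> 0" "norm q < 1" "x \<noteq> 0"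
  shows "Theta x q = 0 \<longleftrightarrow> (\<exists>n::int. x = q powi n)"
proof
  assume "Theta x q = 0"
  then consider i where "q ^ i * x = 1" | i where "q ^ i * (q / x) = 1"
    unfolding Theta_def using qpoch_inf_base_nonzero[OF assms(2)] qpoch_inf_eq_0_iff[OF assms(2)] by auto
  thus "\<exists>n::int. x = q powi n"
  proof cases
    case 1
    hence "x = q powi (- int i)" using assms by (simp add: power_int_minus field_simps)
    thus ?thesis by blast
  next
    case 2
    hence "x = q powi (int i + 1)" using assms by (simp add: power_int_add field_simps)
    thus ?thesis by blast
  qed
next
  assume "\<exists>n::int. x = q powi n"
  then obtain n where n: "x = q powi n * 1" by auto
  have "Theta 1 q = 0" using assms by (subst Theta_alt) auto
  thus "Theta x q = 0" unfolding n using assms by (subst Theta_powi) auto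
qed

lemma holomorphic_on_Theta:
  assumes "norm q < 1"
  shows "(\<lambda>x. Theta x q) holomorphic_on -{0}"
  unfolding Theta_def
  by (intro holomorphic_intros holomorphic_on_compose[OF _ holomorphic_on_qpoch_inf[OF assms], unfolded o_def] 
        holomorphic_on_qpoch_inf[OF assms]) auto

lemma neg_one_neq_powi:
  fixes q :: complex
  assumes "q \<noteq> 0" "norm q < 1"
  shows "q powi n \<noteq> -1"
proof
  assume n: "q powi n = -1"
  hence "q powi (2 * n) = 1" using assms by (simp add: power_int_mult power2_eq_square mult.commute[of 2])
  hence "n = 0" using powi_eq_1_iff[OF assms] by simp
  with n show False by simp
qed

text \<open>Zeros of a holomorphic function on a connected domain are isolated, and \<open>-1\<close> is not a zero.
This makes functional equations that fail only at poles available near every point.\<close>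

lemma eventually_Theta_nonzero:
  assumes "q \<noteq> 0" "norm q < 1" "a \<noteq> 0"
  shows "\<forall>\<^sub>F x in at a. Theta x q \<noteq> 0"
proof -
  have "-1 \<noteq> q powi n" for n using neg_one_neq_powi[OF assms(1,2), of n] by auto
  hence "Theta (-1) q \<noteq> 0" using Theta_eq_0_iff[OF assms(1,2), of "-1"] by auto
  moreover have "connected (-{0::complex})" by (rule connected_punctured_universe) simp
  ultimately have "\<forall>\<^sub>F x in at a. Theta x q \<noteq> 0 \<and> x \<in> -{0}"
    using assms by (intro non_zero_neighbour_alt[OF holomorphic_on_Theta[OF assms(2)], of _ "-1"]) auto
  thus ?thesis by eventually_elim auto
qed

lemma analytic_Theta [analytic_intros]:
  assumes "norm q < 1" "f analytic_on A" "\<And>x. x \<in> A \<Longrightarrow> f x \<noteq> 0"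
  shows "(\<lambda>x. Theta (f x) q) analytic_on A"
proof -
  have "(\<lambda>x. Theta x q) analytic_on -{0}"
    using holomorphic_on_Theta[OF assms(1)] by (subst analytic_on_open) auto
  hence "(\<lambda>x. Theta x q) analytic_on f ` A"
    by (rule analytic_on_subset) (use assms in auto)
  from analytic_on_compose[OF assms(2) this] show ?thesis by (simp add: o_def)
qed

text \<open>The zero at \<open>1\<close>, and with it every zero, is simple; the derivative enters all residues below.\<close>

lemma Theta_deriv_1:
  assumes "q \<noteq> 0" "norm q < 1"
  shows "((\<lambda>x. Theta x q) has_field_derivative - (qpoch_inf q q ^ 3)) (at 1)"
proof -
  define E where "E x = qpoch_inf (q * x) q * qpoch_inf (q / x) q * qpoch_inf q q" for x
  have "E holomorphic_on -{0}"
    unfolding E_def 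
    by (intro holomorphic_intros holomorphic_on_compose[OF _ holomorphic_on_qpoch_inf[OF assms(2)], unfolded o_def] 
        holomorphic_on_qpoch_inf[OF assms(2)]) auto
  hence "(E has_field_derivative deriv E 1) (at 1)"
    by (rule holomorphic_derivI) auto
  hence "((\<lambda>x. (1 - x) * E x) has_field_derivative - E 1) (at 1)"
    by (auto intro!: derivative_eq_intros)
  moreover have "\<forall>\<^sub>F x in nhds 1. (1 - x) * E x = Theta x q"
  proof -
    have "\<forall>\<^sub>F x in nhds (1::complex). x \<in> -{0}" by (rule eventually_nhds_in_open) auto
    thus ?thesis by eventually_elim (auto simp: Theta_alt[OF assms] E_def)
  qed
  ultimately have "((\<lambda>x. Theta x q) has_field_derivative - E 1) (at 1)"
    by (subst (asm) DERIV_cong_ev[OF refl _ refl]) auto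
  thus ?thesis by (simp add: E_def power3_eq_cube)
qed

section \<open>Simple poles\<close>

text \<open>A pole of order at most one with residue \<open>\<rho>\<close>; the case \<open>\<rho> = 0\<close> is a removable singularity.
Phrasing it through an analytic continuation of \<open>(x - a) * f x\<close> makes residues additive and
multiplicative without regard to whether a pole is really present, so coinciding poles need no
separate treatment.\<close>

definition simple_pole :: "(complex \<Rightarrow> complex) \<Rightarrow> complex \<Rightarrow> complex \<Rightarrow> bool" where
  "simple_pole f a \<rho> \<longleftrightarrow>
     (\<exists>g. g analytic_on {a} \<and> g a = \<rho> \<and> (\<forall>\<^sub>F x in at a. (x - a) * f x = g x))"

lemma simple_pole_analytic:
  assumes "f analytic_on {a}"
  shows "simple_pole f a 0"
  unfolding simple_pole_def
  by (intro exI[of _ "\<lambda>x. (x - a) * f x"] conjI analytic_intros assms) auto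

lemma simple_pole_add:
  assumes "simple_pole f a \<rho>" "simple_pole g a \<sigma>"
  shows "simple_pole (\<lambda>x. f x + g x) a (\<rho> + \<sigma>)"
proof -
  from assms obtain F G where "F analytic_on {a}" "F a = \<rho>" "\<forall>\<^sub>F x in at a. (x - a) * f x = F x"
    "G analytic_on {a}" "G a = \<sigma>" "\<forall>\<^sub>F x in at a. (x - a) * g x = G x"
    unfolding simple_pole_def by blast
  moreover from this(3,6) have "\<forall>\<^sub>F x in at a. (x - a) * (f x + g x) = F x + G x"
    by eventually_elim (simp add: distrib_left)
  ultimately show ?thesis unfolding simple_pole_def
    by (intro exI[of _ "\<lambda>x. F x + G x"] conjI analytic_intros) auto
qed

lemma simple_pole_mult:
  assumes "h analytic_on {a}" "simple_pole f a \<rho>"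
  shows "simple_pole (\<lambda>x. h x * f x) a (h a * \<rho>)"
proof -
  from assms obtain F where "F analytic_on {a}" "F a = \<rho>" "\<forall>\<^sub>F x in at a. (x - a) * f x = F x"
    unfolding simple_pole_def by blast
  moreover from this(3) have "\<forall>\<^sub>F x in at a. (x - a) * (h x * f x) = h x * F x"
    by eventually_elim (simp add: mult.left_commute)
  ultimately show ?thesis unfolding simple_pole_def using assms(1)
    by (intro exI[of _ "\<lambda>x. h x * F x"] conjI analytic_intros) auto
qed

lemma simple_pole_cong:
  assumes "simple_pole f a \<rho>" "\<forall>\<^sub>F x in at a. f x = g x" "\<rho> = \<sigma>"
  shows "simple_pole g a \<sigma>"
proof -
  from assms obtain F where "F analytic_on {a}" "F a = \<rho>" "\<forall>\<^sub>F x in at a. (x - a) * f x = F x"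
    unfolding simple_pole_def by blast
  moreover from this(3) assms(2) have "\<forall>\<^sub>F x in at a. (x - a) * g x = F x"
    by eventually_elim simp
  ultimately show ?thesis unfolding simple_pole_def using assms(3) by blast
qed

text \<open>Difference quotient at \<open>a\<close>, extended over \<open>a\<close> by the derivative.\<close>

lemma analytic_factor:
  assumes "h analytic_on {a}"
  obtains k where "k analytic_on {a}" "k a = deriv h a" "\<And>x. h x = h a + (x - a) * k x"
proof -
  obtain A where A: "open A" "a \<in> A" "h holomorphic_on A" using assms analytic_at by blast
  define k where "k = (\<lambda>z. if z = a then deriv h a else (h z - h a) / (z - a))"
  have "k holomorphic_on A" unfolding k_def by (rule pole_lemma_open) (use A in auto)
  hence "k analytic_on {a}" using A analytic_at by blast
  moreover have "k a = deriv h a" "\<And>x. h x = h a + (x - a) * k x" by (auto simp: k_def)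
  ultimately show ?thesis using that by blast
qed

lemma simple_pole_inverse:
  assumes "h analytic_on {a}" "h a = 0" "(h has_field_derivative d) (at a)" "d \<noteq> 0"
  shows "simple_pole (\<lambda>x. 1 / h x) a (1 / d)"
proof -
  obtain k where k: "k analytic_on {a}" "k a = deriv h a" "\<And>x. h x = h a + (x - a) * k x"
    using analytic_factor[OF assms(1)] by blast
  have ka: "k a = d" using k(2) assms(3) by (simp add: DERIV_imp_deriv)
  have "(\<lambda>x. 1 / k x) analytic_on {a}" using k(1) ka assms(4) by (intro analytic_intros) auto
  moreover have "\<forall>\<^sub>F x in at a. (x - a) * (1 / h x) = 1 / k x"
    unfolding eventually_at_filter using k(3) assms(2) by (intro always_eventually) auto
  ultimately show ?thesis unfolding simple_pole_def using ka by (intro exI[of _ "\<lambda>x. 1 / k x"]) auto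
qed

lemma simple_pole_0_removable:
  assumes "simple_pole f a 0"
  obtains k where "k analytic_on {a}" "\<forall>\<^sub>F x in at a. f x = k x"
proof -
  obtain F where F: "F analytic_on {a}" "F a = 0" "\<forall>\<^sub>F x in at a. (x - a) * f x = F x"
    using assms unfolding simple_pole_def by blast
  obtain k where k: "k analytic_on {a}" "\<And>x. F x = F a + (x - a) * k x"
    using analytic_factor[OF F(1)] by metis
  have "\<forall>\<^sub>F x in at a. x \<noteq> a" by (simp add: eventually_at_filter)
  with F(3) have "\<forall>\<^sub>F x in at a. f x = k x"
  proof eventually_elim
    case (elim x)
    have "(x - a) * f x = (x - a) * k x" using elim k(2)[of x] F(2) by simp
    thus ?case using elim by simp
  qed
  with k(1) that show ?thesis by blast
qed

section \<open>Multiplicatively periodic functions\<close>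

text \<open>Every orbit under multiplication by \<open>q\<close> meets the annulus \<open>\<bar>q\<bar> < \<bar>w\<bar> \<le> 1\<close>.\<close>

lemma exists_scaling:
  fixes q c :: complex
  assumes "q \<noteq> 0" "norm q < 1" "c \<noteq> 0"
  obtains k :: int where "norm q < norm (q powi k * c)" "norm (q powi k * c) \<le> 1"
proof -
  \<comment> \<open>the real number with \<open>\<bar>c\<bar> = \<bar>q\<bar> powr t\<close>\<close>
  define t where "t = ln (norm c) / ln (norm q)"
  define k where "k = - \<lfloor>t\<rfloor>"
  have lq: "ln (norm q) < 0" using assms by simp
  have eq: "norm (q powi k * c) = exp ((of_int k + t) * ln (norm q))"
  proof -
    have "norm (q powi k * c) = norm q powr of_int k * norm c"
      using assms by (simp add: norm_mult norm_power_int powr_real_of_int')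
    also have "norm c = exp (t * ln (norm q))" using assms lq by (simp add: t_def)
    also have "norm q powr of_int k = exp (of_int k * ln (norm q))" using assms by (simp add: powr_def)
    finally show ?thesis by (simp add: exp_add[symmetric] algebra_simps)
  qed
  have r: "0 \<le> of_int k + t" "of_int k + t < 1" unfolding k_def by linarith+
  have "norm (q powi k * c) \<le> 1" unfolding eq using r lq by (simp add: mult_nonneg_nonpos)
  moreover have "norm q < norm (q powi k * c)"
  proof -
    have "1 * ln (norm q) < (of_int k + t) * ln (norm q)" using r(2) lq by (intro mult_strict_right_mono_neg)
    hence "exp (ln (norm q)) < norm (q powi k * c)" unfolding eq by simp
    thus ?thesis using assms by simp
  qed
  ultimately show ?thesis using that by blast
qed

text \<open>With \<open>\<bar>q\<bar> < \<bar>c\<bar> \<le> 1\<close> the values on one annulus control \<open>h\<close> everywhere: \<open>h\<close> stays bounded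
near \<open>0\<close> and grows at most linearly at infinity. So it extends to a polynomial of degree at
most one, and \<open>c \<noteq> q\<close> excludes the linear term.\<close>

lemma multiplicatively_periodic_aux:
  fixes q c :: complex
  assumes q: "q \<noteq> 0" "norm q < 1" and c: "norm q < norm c" "norm c \<le> 1"
    and h: "h holomorphic_on -{0}" and per: "\<And>x. x \<noteq> 0 \<Longrightarrow> h (q * x) = c * h x"
  obtains b where "\<And>x. x \<noteq> 0 \<Longrightarrow> h x = b" "b = 0 \<or> c = 1"
proof -
  \<comment> \<open>a closed fundamental annulus\<close>
  define K where "K = cball (0::complex) 1 - ball 0 (norm q)"
  have "compact K" unfolding K_def by (intro compact_diff) auto
  moreover have "continuous_on K h"
    by (rule holomorphic_on_imp_continuous_on, rule holomorphic_on_subset[OF h]) (use q in \<open>auto simp: K_def\<close>)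
  ultimately have "compact (h ` K)" by (rule compact_continuous_image[rotated])
  then obtain M where M: "\<And>x. x \<in> K \<Longrightarrow> norm (h x) \<le> M" 
    using compact_imp_bounded[of "h ` K"] by (auto simp: bounded_iff)
  have "q \<in> K" using q by (auto simp: K_def)
  hence M0: "M \<ge> 0" using M[of q] norm_ge_zero order_trans by blast
  have c0: "c \<noteq> 0" using c q by auto
  have pern: "h (q ^ n * x) = c ^ n * h x" if "x \<noteq> 0" for n x
    by (induction n) (use that per q in \<open>auto simp: mult.assoc\<close>)
  have small: "norm (h x) \<le> M" if x: "x \<noteq> 0" "norm x \<le> 1" for x
  proof -
    obtain k :: int where k: "norm q < norm (q powi k * x)" "norm (q powi k * x) \<le> 1"
      using exists_scaling[OF q x(1)] by blast
    have "k \<le> 0"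
    proof (rule ccontr)
      assume "\<not> k \<le> 0"
      hence "norm (q powi k) = norm q ^ nat k" "1 \<le> nat k" by (auto simp: power_int_def norm_power)
      hence "norm (q powi k) \<le> norm q" using power_decreasing[of 1 "nat k" "norm q"] q by simp
      hence "norm (q powi k * x) \<le> norm q * 1" unfolding norm_mult by (intro mult_mono) (use x in auto)
      with k show False by simp
    qed
    define n where "n = nat (- k)"
    define y where "y = q powi k * x"
    have "y \<in> K" "y \<noteq> 0" using k x q by (auto simp: K_def y_def)
    have "x = q ^ n * y" using \<open>k \<le> 0\<close> q by (simp add: y_def n_def power_int_def field_simps)
    hence "norm (h x) = norm c ^ n * norm (h y)" using pern[OF \<open>y \<noteq> 0\<close>, of n] by (simp add: norm_mult norm_power)
    also have "\<dots> \<le> 1 * M" using M[OF \<open>y \<in> K\<close>] c by (intro mult_mono) (auto intro: power_le_one)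
    finally show ?thesis by simp
  qed
  have large: "norm (h x) \<le> M / norm q * norm x ^ 1" if x: "1 \<le> norm x" for x
  proof -
    have x0: "x \<noteq> 0" using x by auto
    obtain k :: int where k: "norm q < norm (q powi k * x)" "norm (q powi k * x) \<le> 1"
      using exists_scaling[OF q x0] by blast
    have "k \<ge> 0"
    proof (rule ccontr)
      assume "\<not> k \<ge> 0"
      hence "norm (q powi k) = inverse (norm q ^ nat (-k))" "nat (-k) > 0" 
        by (auto simp: power_int_def norm_power norm_inverse power_inverse)
      moreover have "norm q ^ nat (-k) < 1" using q \<open>nat (-k) > 0\<close> by (simp add: power_less_one_iff)
      ultimately have "norm (q powi k) > 1" using q by (simp add: one_less_inverse_iff)
      hence "1 * 1 < norm (q powi k) * norm x" using x by (intro mult_less_le_imp_less) auto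
      with k show False by (simp add: norm_mult)
    qed
    define n where "n = nat k"
    define y where "y = q ^ n * x"
    have y: "y = q powi k * x" using \<open>k \<ge> 0\<close> by (simp add: y_def n_def power_int_def)
    have "y \<in> K" using k by (auto simp: K_def y)
    have "norm c ^ n * norm (h x) = norm (h y)" using pern[OF x0, of n] by (simp add: y_def norm_mult norm_power)
    also have "\<dots> \<le> M" using M[OF \<open>y \<in> K\<close>] .
    finally have 1: "norm c ^ n * norm (h x) \<le> M" .
    have "norm q ^ n * norm (h x) \<le> norm c ^ n * norm (h x)" using c by (intro mult_right_mono power_mono) auto
    with 1 have 2: "norm q ^ n * norm (h x) \<le> M" by simp
    have 3: "norm q \<le> norm q ^ n * norm x" using k by (simp add: y[symmetric]) (simp add: y_def norm_mult norm_power)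
    have "norm q * norm (h x) \<le> (norm q ^ n * norm x) * norm (h x)" using 3 by (intro mult_right_mono) auto
    also have "\<dots> \<le> M * norm x" using mult_right_mono[OF 2, of "norm x"] by (simp add: mult_ac)
    finally show ?thesis using q by (simp add: field_simps)
  qed
  have "\<exists>g. g holomorphic_on UNIV \<and> (\<forall>z\<in>UNIV - {0}. g z = h z)"
  proof (rule holomorphic_on_extend_bounded[THEN iffD2])
    show "h holomorphic_on UNIV - {0}" using h by (simp add: Compl_eq_Diff_UNIV)
    show "\<exists>B. \<forall>\<^sub>F z in at 0. cmod (h z) \<le> B"
      by (intro exI[of _ M]) (auto simp: eventually_at intro!: exI[of _ 1] small)
  qed auto
  then obtain g where g: "g holomorphic_on UNIV" "\<And>z. z \<noteq> 0 \<Longrightarrow> g z = h z" by auto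
  have "norm (g z) \<le> M / norm q * norm z ^ 1" if "1 \<le> norm z" for z
    using large[OF that] g(2)[of z] that by fastforce
  hence L: "g x = (\<Sum>k\<le>1. (deriv ^^ k) g 0 / fact k * x ^ k)" for x
    by (rule Liouville_polynomial[OF g(1)])
  define a b where "a = g 0" and "b = deriv g 0"
  have lin: "h x = a + b * x" if "x \<noteq> 0" for x
    using L[of x] g(2)[OF that] by (simp add: a_def b_def)
  have e: "a + b * (q * x) = c * (a + b * x)" if "x \<noteq> 0" for x
    using per[OF that] lin[of x] lin[of "q * x"] that q by simp
  have e1: "a + b * q = c * (a + b)" and e2: "a - b * q = c * (a - b)"
    using e[of 1] e[of "-1"] by simp_all
  have "2 * a = 2 * (c * a)" using e1 e2 by algebra
  moreover have "2 * (b * q) = 2 * (c * b)" using e1 e2 by algebra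
  ultimately have ab: "a = c * a" "b * q = c * b" by simp_all
  have "b = 0" using ab(2) c by auto
  with ab lin show ?thesis using that[of a] by auto
qed

text \<open>Multiplying by a power of \<open>x\<close> changes the multiplier by a power of \<open>q\<close>, which brings it into
the range of the previous lemma.\<close>

lemma multiplicatively_periodic:
  fixes q c :: complex
  assumes q: "q \<noteq> 0" "norm q < 1"
    and h: "h holomorphic_on -{0}" and per: "\<And>x. x \<noteq> 0 \<Longrightarrow> h (q * x) = c * h x"
  obtains b and k :: int where "\<And>x. x \<noteq> 0 \<Longrightarrow> h x = b * x powi k" "b = 0 \<or> c = q powi k"
proof (cases "c = 0")
  case True
  have "h x = 0" if "x \<noteq> 0" for x using per[of "x / q"] True q that by simp
  thus ?thesis using that[of 0 0] by simp
next
  case False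
  obtain k where k: "norm q < norm (q powi k * c)" "norm (q powi k * c) \<le> 1"
    using exists_scaling[OF q False] by blast
  obtain b where b: "\<And>x. x \<noteq> 0 \<Longrightarrow> x powi k * h x = b" "b = 0 \<or> q powi k * c = 1"
  proof (rule multiplicatively_periodic_aux[OF q k, of "\<lambda>x. x powi k * h x"])
    show "(\<lambda>x. x powi k * h x) holomorphic_on -{0}" by (intro holomorphic_intros h) auto
  qed (use per in \<open>auto simp: power_int_mult_distrib mult_ac\<close>)
  show ?thesis
  proof (rule that[of b "-k"])
    show "h x = b * x powi - k" if "x \<noteq> 0" for x
      using b(1)[OF that] that by (simp add: power_int_minus field_simps)
    show "b = 0 \<or> c = q powi - k" using b(2) q by (auto simp: power_int_minus field_simps)
  qed
qed

lemma eventually_at_nonzero: "a \<noteq> 0 \<Longrightarrow> \<forall>\<^sub>F x in at (a::complex). x \<noteq> 0"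
proof -
  assume "a \<noteq> 0"
  hence "\<forall>\<^sub>F x in nhds a. x \<in> -{0}" by (intro eventually_nhds_in_open) auto
  thus ?thesis by (auto simp: eventually_at_filter elim: eventually_mono)
qed

lemma filterlim_mult_at:
  fixes q a :: complex
  assumes "q \<noteq> 0"
  shows "filterlim (\<lambda>x. q * x) (at (q * a)) (at a)"
  by (rule filterlim_atI) (use assms in \<open>auto intro!: tendsto_intros simp: eventually_at_filter\<close>)

lemma analytic_at_scale:
  assumes "k analytic_on {q * a}"
  shows "(\<lambda>x::complex. k (q * x)) analytic_on {a}"
proof -
  have "(\<lambda>x. q * x) analytic_on {a}" by (intro analytic_intros)
  from analytic_on_compose[OF this, of k] assms show ?thesis by (simp add: o_def)
qed

text \<open>Removability of a singularity travels along an orbit under multiplication by \<open>q\<close>, in both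
directions, through the functional equation. Therefore one point of each orbit has to be
examined. The continuation inherits the functional equation by passing to limits.\<close>

lemma removable_extension:
  fixes q c :: complex
  assumes q: "q \<noteq> 0" "norm q < 1" and c: "c \<noteq> 0"
    and pole: "\<And>a. a \<noteq> 0 \<Longrightarrow> \<exists>n::int. simple_pole H (q powi n * a) 0"
    and per: "\<And>a. a \<noteq> 0 \<Longrightarrow> \<forall>\<^sub>F x in at a. H (q * x) = c * x powi m * H x"
  obtains h where "h holomorphic_on -{0}" "\<And>x. x \<noteq> 0 \<Longrightarrow> h (q * x) = c * x powi m * h x"
    "\<And>a. a \<noteq> 0 \<Longrightarrow> \<forall>\<^sub>F x in at a. h x = H x"
proof -
  define rem where "rem a \<longleftrightarrow> (\<exists>k. k analytic_on {a} \<and> (\<forall>\<^sub>F x in at a. H x = k x))" for a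
  have up: "rem (q * a)" if "rem a" "a \<noteq> 0" for a
  proof -
    from that obtain k where k: "k analytic_on {a}" "\<forall>\<^sub>F x in at a. H x = k x" unfolding rem_def by blast
    have lim: "filterlim (\<lambda>x. x / q) (at a) (at (q * a))"
      using filterlim_mult_at[of "1 / q" "q * a"] q by simp
    have "(\<lambda>x. c * (x / q) powi m * k (x / q)) analytic_on {q * a}"
      using analytic_at_scale[of k "1 / q" "q * a"] k(1) q that by (intro analytic_intros) simp_all
    moreover have "\<forall>\<^sub>F x in at (q * a). H x = c * (x / q) powi m * k (x / q)"
      using eventually_compose_filterlim[OF eventually_conj[OF k(2) per[OF that(2)]] lim]
      by eventually_elim (use q in auto)
    ultimately show ?thesis unfolding rem_def by blast
  qed
  have down: "rem a" if "rem (q * a)" "a \<noteq> 0" for a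
  proof -
    from that obtain k where k: "k analytic_on {q * a}" "\<forall>\<^sub>F x in at (q * a). H x = k x" unfolding rem_def by blast
    have "(\<lambda>x. k (q * x) / (c * x powi m)) analytic_on {a}"
      using analytic_at_scale[OF k(1)] c that by (intro analytic_intros) simp_all
    moreover have "\<forall>\<^sub>F x in at a. H x = k (q * x) / (c * x powi m)"
      using eventually_compose_filterlim[OF k(2) filterlim_mult_at[OF q(1)]] per[OF that(2)] eventually_at_nonzero[OF that(2)]
      by eventually_elim (use c in \<open>auto simp: field_simps\<close>)
    ultimately show ?thesis unfolding rem_def by blast
  qed
  have ud: "rem (q * a) \<longleftrightarrow> rem a" if "a \<noteq> 0" for a using up[OF _ that] down[OF _ that] by blast
  have shift: "rem a \<longleftrightarrow> rem (q powi n * a)" if "a \<noteq> 0" for a and n :: int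
  proof (induction n rule: int_induct[where k = 0])
    case (step1 i)
    have "rem (q powi i * a) \<longleftrightarrow> rem (q * (q powi i * a))" using ud[of "q powi i * a"] that q by simp
    with step1 show ?case using q by (simp add: power_int_add mult_ac)
  next
    case (step2 i)
    have "rem (q powi (i - 1) * a) \<longleftrightarrow> rem (q * (q powi (i - 1) * a))"
      using ud[of "q powi (i - 1) * a"] that q by simp
    with step2 show ?case using q by (simp add: power_int_diff mult_ac)
  qed auto
  have rem: "rem a" if "a \<noteq> 0" for a
    using pole[OF that] shift[OF that] simple_pole_0_removable unfolding rem_def by metis
  \<comment> \<open>the continuation by limits\<close>
  define h where "h = remove_sings H"
  have h: "h analytic_on {a} \<and> (\<forall>\<^sub>F x in at a. h x = H x)" if "a \<noteq> 0" for a
  proof -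
    from rem[OF that] obtain k where k: "k analytic_on {a}" "\<forall>\<^sub>F x in at a. H x = k x" unfolding rem_def by blast
    have iso: "isolated_singularity_at H a"
      using isolated_singularity_at_cong[OF k(2) refl] isolated_singularity_at_analytic[OF k(1)] by simp
    have "H \<midarrow>a\<rightarrow> k a"
      using tendsto_cong[OF k(2)] analytic_at_imp_isCont[OF k(1)] by (simp add: isCont_def)
    thus ?thesis unfolding h_def using remove_sings_analytic_at[OF iso] eventually_remove_sings_eq_at[OF iso] by auto
  qed
  have hh: "h holomorphic_on -{0}"
    using h analytic_on_analytic_at[of h "-{0}"] by (auto intro: analytic_imp_holomorphic)
  have cont: "h \<midarrow>a\<rightarrow> h a" if "a \<noteq> 0" for a
    using h[OF that] analytic_at_imp_isCont isCont_def by blast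
  have "h (q * a) = c * a powi m * h a" if "a \<noteq> 0" for a
  proof -
    have "((\<lambda>x. h (q * x)) \<longlongrightarrow> h (q * a)) (at a)"
      using filterlim_compose[OF cont[of "q * a"] filterlim_mult_at[OF q(1)]] that q by simp
    moreover have lim: "((\<lambda>x. c * x powi m * h x) \<longlongrightarrow> c * a powi m * h a) (at a)"
      by (intro tendsto_intros cont that)
    moreover have "\<forall>\<^sub>F x in at a. h (q * x) = c * x powi m * h x"
    proof -
      have "\<forall>\<^sub>F x in at (q * a). h x = H x" using h[of "q * a"] that q by simp
      from eventually_compose_filterlim[OF this filterlim_mult_at[OF q(1)]]
      show ?thesis using h[OF that, THEN conjunct2] per[OF that]
        by eventually_elim simp
    qed
    ultimately have "((\<lambda>x. c * x powi m * h x) \<longlongrightarrow> h (q * a)) (at a)" by (simp add: tendsto_cong)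
    with lim show ?thesis by (rule LIM_unique[rotated])
  qed
  with hh h that show ?thesis by blast
qed

text \<open>The form in which Liouville's theorem is used for identities: \<open>H\<close> is the difference of the two
sides, its poles cancel, and its multiplier is no power of \<open>q\<close>.\<close>

lemma removable_periodic_eq_0:
  fixes q c :: complex
  assumes q: "q \<noteq> 0" "norm q < 1" and c: "c \<noteq> 0" "\<And>n::int. c \<noteq> q powi n"
    and pole: "\<And>a. a \<noteq> 0 \<Longrightarrow> \<exists>n::int. simple_pole H (q powi n * a) 0"
    and per: "\<And>a. a \<noteq> 0 \<Longrightarrow> \<forall>\<^sub>F x in at a. H (q * x) = c * H x"
    and a: "a \<noteq> 0" "isCont H a"
  shows "H a = 0"
proof -
  have per': "\<forall>\<^sub>F x in at a. H (q * x) = c * x powi 0 * H x" if "a \<noteq> 0" for a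
    using per[OF that] by simp
  obtain h where h: "h holomorphic_on -{0}" "\<And>x. x \<noteq> 0 \<Longrightarrow> h (q * x) = c * x powi 0 * h x"
    "\<And>a. a \<noteq> 0 \<Longrightarrow> \<forall>\<^sub>F x in at a. h x = H x"
    using removable_extension[OF q c(1) pole per'] by blast
  then obtain b and k :: int
    where "\<And>x. x \<noteq> 0 \<Longrightarrow> h x = b * x powi k" "b = 0 \<or> c = q powi k"
    using multiplicatively_periodic[OF q h(1), of c] h(2) by auto
  with c(2) have h0: "h x = 0" if "x \<noteq> 0" for x using that by auto
  have "isCont h a" using h(1) a(1) continuous_on_eq_continuous_at[of "-{0}" h] holomorphic_on_imp_continuous_on by auto
  hence "h \<midarrow>a\<rightarrow> h a" by (simp add: isCont_def)
  hence "H \<midarrow>a\<rightarrow> h a" using tendsto_cong[OF h(3)[OF a(1)]] by simp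
  moreover have "H \<midarrow>a\<rightarrow> H a" using a(2) by (simp add: isCont_def)
  ultimately have "H a = h a" by (rule LIM_unique[rotated])
  thus ?thesis using h0[OF a(1)] by simp
qed

section \<open>Division of theta functions by a zero\<close>

text \<open>Theta functions of degree \<open>n\<close>. The multiplier \<open>A\<close> is recorded because, after division by \<open>n\<close>
theta factors, it decides whether the remaining quotient is constant.\<close>

definition theta_like :: "int \<Rightarrow> complex \<Rightarrow> complex \<Rightarrow> (complex \<Rightarrow> complex) \<Rightarrow> bool" where
  "theta_like n A q f \<longleftrightarrow> f holomorphic_on -{0} \<and> A \<noteq> 0 \<and>
     (\<forall>x. x \<noteq> 0 \<longrightarrow> f (q * x) = A * x powi (- n) * f x)"

text \<open>The functional equation carries the zero at \<open>a\<close> to all of \<open>a q\<^sup>n\<close>, where the zeros of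
\<open>Theta (x / a) q\<close> are simple. So the quotient has removable singularities.\<close>

lemma theta_like_divide:
  assumes q: "q \<noteq> 0" "norm q < 1" and f: "theta_like n A q f" and a: "a \<noteq> 0" "f a = 0"
  obtains g where "theta_like (n - 1) (- A / a) q g" "\<And>x. x \<noteq> 0 \<Longrightarrow> f x = Theta (x / a) q * g x"
proof -
  have hol: "f holomorphic_on -{0}" and A: "A \<noteq> 0" 
    and qp: "\<And>x. x \<noteq> 0 \<Longrightarrow> f (q * x) = A * x powi (- n) * f x"
    using f by (auto simp: theta_like_def)
  have fan: "f analytic_on {b}" if "b \<noteq> 0" for b
    using hol that analytic_on_open[of "-{0}"] by (auto intro: analytic_on_subset)
  define H where "H x = f x * (1 / Theta (x / a) q)" for x
  have pole: "\<exists>k::int. simple_pole H (q powi k * b) 0" if b: "b \<noteq> 0" for b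
  proof (cases "Theta (b / a) q = 0")
    case False
    have "H analytic_on {b}" unfolding H_def using b a q False by (intro analytic_intros fan) auto
    hence "simple_pole H (q powi 0 * b) 0" by (simp add: simple_pole_analytic)
    thus ?thesis by blast
  next
    case True
    then obtain k where k: "b / a = q powi k" using Theta_eq_0_iff[of q "b / a"] q a b by auto
    have "simple_pole (\<lambda>x. 1 / Theta (x / a) q) a (1 / (- (qpoch_inf q q ^ 3) / a))"
    proof (rule simple_pole_inverse)
      show "(\<lambda>x. Theta (x / a) q) analytic_on {a}" using a q by (intro analytic_intros) auto
      show "Theta (a / a) q = 0" using a q Theta_eq_0_iff[of q 1] by (auto intro: exI[of _ 0])
      show "((\<lambda>x. Theta (x / a) q) has_field_derivative - (qpoch_inf q q ^ 3) / a) (at a)"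
      proof -
        have "((\<lambda>x. Theta x q) has_field_derivative - (qpoch_inf q q ^ 3)) (at (a / a))"
          using Theta_deriv_1[OF q] a by simp
        moreover have "((\<lambda>x. x / a) has_field_derivative 1 / a) (at a)"
          using a by (auto intro!: derivative_eq_intros)
        ultimately show ?thesis using DERIV_chain2[where f = "\<lambda>x. Theta x q" and g = "\<lambda>x. x / a"] by fastforce
      qed
      show "- (qpoch_inf q q ^ 3) / a \<noteq> 0" using qpoch_inf_base_nonzero[OF q(2)] a by simp
    qed
    from simple_pole_mult[OF fan[OF a(1)] this] have "simple_pole H a 0" by (simp add: H_def[abs_def] a)
    moreover have "a = q powi (-k) * b" using k a b q by (simp add: power_int_minus field_simps)
    ultimately show ?thesis by metis
  qed
  have per: "\<forall>\<^sub>F x in at b. H (q * x) = (- A / a) * x powi (- (n - 1)) * H x" if b: "b \<noteq> 0" for b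
  proof -
    show ?thesis
      using eventually_at_nonzero[OF b]
    proof eventually_elim
      case (elim x)
      have T: "Theta (q * x / a) q = - Theta (x / a) q / (x / a)"
        using Theta_step[OF q, of "x / a"] elim a by simp
      have e: "x powi (- (n - 1)) = x * x powi (- n)" using elim by (simp add: power_int_diff power_int_minus field_simps)
      show ?case unfolding H_def T qp[OF elim] e using elim a by (simp add: field_simps)
    qed
  qed
  obtain g where g: "g holomorphic_on -{0}" 
      "\<And>x. x \<noteq> 0 \<Longrightarrow> g (q * x) = (- A / a) * x powi (- (n - 1)) * g x"
      "\<And>b. b \<noteq> 0 \<Longrightarrow> \<forall>\<^sub>F x in at b. g x = H x"
    using removable_extension[OF q _ pole per] A a by auto
  have "f b = Theta (b / a) q * g b" if b: "b \<noteq> 0" for b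
  proof -
    have "isCont f b" "isCont (\<lambda>x. Theta (x / a) q * g x) b"
      using g(1) b analytic_on_open[of "-{0}" g] q a
      by (auto intro!: analytic_at_imp_isCont analytic_intros fan intro: analytic_on_subset)
    moreover have "\<forall>\<^sub>F x in at b. f x = Theta (x / a) q * g x"
    proof -
      have "filterlim (\<lambda>x. x / a) (at (b / a)) (at b)"
        using filterlim_mult_at[of "1 / a" b] a by simp
      from eventually_compose_filterlim[OF eventually_Theta_nonzero[OF q, of "b / a"] this]
      have th: "\<forall>\<^sub>F x in at b. Theta (x / a) q \<noteq> 0" using a b by simp
      show ?thesis using th g(3)[OF b] by eventually_elim (simp add: H_def)
    qed
    ultimately have "f \<midarrow>b\<rightarrow> f b" "f \<midarrow>b\<rightarrow> Theta (b / a) q * g b"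
      by (simp_all add: isCont_def tendsto_cong)
    thus ?thesis by (rule LIM_unique)
  qed
  with g A a show ?thesis by (intro that[of g]) (auto simp: theta_like_def)
qed

section \<open>The Jacobi triple product\<close>

lemma binom2_pos: "r \<noteq> 0 \<Longrightarrow> r \<noteq> 1 \<Longrightarrow> (r::int) * (r - 1) div 2 \<ge> 1"
proof -
  assume "r \<noteq> 0" "r \<noteq> 1"
  hence "r * (r - 1) \<ge> 2"
  proof (cases "r \<ge> 2")
    case True
    hence "r * (r - 1) \<ge> 2 * 1" by (intro mult_mono) auto
    thus ?thesis by simp
  next
    case False
    hence "(-r) * (1 - r) \<ge> 1 * 2" using \<open>r \<noteq> 0\<close> \<open>r \<noteq> 1\<close> by (intro mult_mono) auto
    thus ?thesis by (simp add: algebra_simps)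
  qed
  thus ?thesis by simp
qed

lemma binom2_nat: "int n * (int n - 1) div 2 = int (n * (n - 1) div 2)"
  by (cases n) (auto simp: zdiv_int algebra_simps)

lemma summable_theta_nat:
  fixes s y :: real
  assumes "0 < s" "s < 1" "0 < y"
  shows "summable (\<lambda>n. s ^ (n * (n - 1) div 2) * y ^ n)"
proof -
  have "(\<lambda>n. s ^ n * y) \<longlonglongrightarrow> 0 * y" using assms by (intro tendsto_intros LIMSEQ_realpow_zero) auto
  hence "\<forall>\<^sub>F n in sequentially. s ^ n * y < 1 / 2" by (intro order_tendstoD) auto
  then obtain N where N: "\<And>n. n \<ge> N \<Longrightarrow> s ^ n * y < 1 / 2" by (auto simp: eventually_sequentially)
  show ?thesis
  proof (rule summable_ratio_test[of "1/2" N])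
    fix n assume n: "N \<le> n"
    have "Suc n * (Suc n - 1) = n * (n - 1) + n * 2" by (cases n) (auto simp: algebra_simps)
    hence e: "Suc n * (Suc n - 1) div 2 = n * (n - 1) div 2 + n" by simp
    have "s ^ (Suc n * (Suc n - 1) div 2) * y ^ Suc n = (s ^ n * y) * (s ^ (n * (n - 1) div 2) * y ^ n)"
      unfolding e by (simp add: power_add mult_ac)
    also have "\<dots> \<le> 1 / 2 * (s ^ (n * (n - 1) div 2) * y ^ n)"
      using N[OF n] assms by (intro mult_right_mono) auto
    finally show "norm (s ^ (Suc n * (Suc n - 1) div 2) * y ^ Suc n) \<le> 1 / 2 * norm (s ^ (n * (n - 1) div 2) * y ^ n)"
      using assms by simp
  qed auto
qed

text \<open>The negative half of the series has the shape of the positive half with \<open>s / y\<close> in place of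
\<open>y\<close>, because \<open>n (n + 1) / 2 = n (n - 1) / 2 + n\<close>.\<close>

lemma summable_on_theta_real:
  fixes s y :: real
  assumes "0 < s" "s < 1" "0 < y"
  shows "(\<lambda>r::int. s powi (r * (r - 1) div 2) * y powi r) summable_on A"
proof -
  let ?f = "\<lambda>r::int. s powi (r * (r - 1) div 2) * y powi r"
  have nat: "(\<lambda>n. s ^ (n * (n - 1) div 2) * y ^ n) summable_on UNIV" if "0 < y" for y
    using summable_theta_nat[OF assms(1,2) that] assms(1) that 
    by (intro norm_summable_imp_summable_on) simp
  have "?f \<circ> int = (\<lambda>n. s ^ (n * (n - 1) div 2) * y ^ n)"
    by (rule ext) (simp only: o_def binom2_nat power_int_of_nat)
  hence 1: "?f summable_on range int"
    using nat[OF assms(3)] by (subst summable_on_reindex) auto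
  have "?f \<circ> (\<lambda>n. - int n) = (\<lambda>n. s ^ (n * (n - 1) div 2) * (s / y) ^ n)"
  proof
    fix n
    have "- int n * (- int n - 1) = int n * (int n - 1) + int n * 2" by (simp add: algebra_simps)
    hence e: "- int n * (- int n - 1) div 2 = int (n * (n - 1) div 2 + n)" 
      using binom2_nat[of n] by simp
    show "(?f \<circ> (\<lambda>n. - int n)) n = s ^ (n * (n - 1) div 2) * (s / y) ^ n"
      unfolding o_def e power_int_of_nat using assms by (simp add: power_int_minus power_add power_divide field_simps)
  qed
  hence 2: "?f summable_on range (\<lambda>n. - int n)"
    using nat[of "s / y"] assms by (subst summable_on_reindex) (auto simp: inj_on_def)
  have "range int \<union> range (\<lambda>n. - int n) = UNIV"
  proof -
    have "x \<in> range int \<union> range (\<lambda>n. - int n)" for x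
      by (cases x rule: int_cases2) auto
    thus ?thesis by blast
  qed
  with summable_on_union[OF 1 2] have "?f summable_on UNIV" by simp
  thus ?thesis by (rule summable_on_subset_banach) auto
qed

lemma summable_on_theta_bounded:
  fixes q x :: complex and b :: "int \<Rightarrow> complex"
  assumes "q \<noteq> 0" "norm q < 1" "x \<noteq> 0" "\<And>r. r \<in> A \<Longrightarrow> norm (b r) \<le> B"
  shows "(\<lambda>r::int. b r * q powi (r * (r - 1) div 2) * x powi r) summable_on A"
proof (rule abs_summable_summable[OF Infinite_Sum.abs_summable_on_comparison_test'])
  show "(\<lambda>r::int. B * (norm q powi (r * (r - 1) div 2) * norm x powi r)) summable_on A"
    by (intro summable_on_cmult_right summable_on_theta_real) (use assms in auto)
  show "norm (b r * q powi (r * (r - 1) div 2) * x powi r) \<le> B * (norm q powi (r * (r - 1) div 2) * norm x powi r)"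
    if "r \<in> A" for r
    using assms(4)[OF that] by (simp add: norm_mult norm_power_int mult.assoc mult_right_mono)
qed

lemma analytic_at_infsum:
  fixes f :: "'a \<Rightarrow> complex \<Rightarrow> complex"
  assumes "\<epsilon> > 0" "\<And>k. k \<in> A \<Longrightarrow> f k holomorphic_on cball a \<epsilon>"
    "\<And>k y. k \<in> A \<Longrightarrow> y \<in> cball a \<epsilon> \<Longrightarrow> norm (f k y) \<le> M k" "M summable_on A"
  shows "(\<lambda>y. \<Sum>\<^sub>\<infinity>k\<in>A. f k y) analytic_on {a}"
proof -
  have "(\<lambda>y. \<Sum>\<^sub>\<infinity>k\<in>A. f k y) holomorphic_on ball a \<epsilon>"
  proof (rule holomorphic_uniform_limit)
    show "uniform_limit (cball a \<epsilon>) (\<lambda>X y. \<Sum>k\<in>X. f k y) (\<lambda>y. \<Sum>\<^sub>\<infinity>k\<in>A. f k y) (finite_subsets_at_top A)"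
      by (rule Weierstrass_m_test_general[OF assms(3,4)])
    show "\<forall>\<^sub>F X in finite_subsets_at_top A. continuous_on (cball a \<epsilon>) (\<lambda>y. \<Sum>k\<in>X. f k y) \<and>
            (\<lambda>y. \<Sum>k\<in>X. f k y) holomorphic_on ball a \<epsilon>"
    proof (rule eventually_finite_subsets_at_top_weakI, rule conjI)
      fix X assume X: "finite X" "X \<subseteq> A"
      have "(\<lambda>y. \<Sum>k\<in>X. f k y) holomorphic_on cball a \<epsilon>"
        using X assms(2) by (intro holomorphic_intros) auto
      thus "continuous_on (cball a \<epsilon>) (\<lambda>y. \<Sum>k\<in>X. f k y)" "(\<lambda>y. \<Sum>k\<in>X. f k y) holomorphic_on ball a \<epsilon>"
        by (auto intro: holomorphic_on_imp_continuous_on holomorphic_on_subset)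
    qed
  qed simp_all
  thus ?thesis using assms(1) by (intro analytic_at[THEN iffD2] exI[of _ "ball a \<epsilon>"]) auto
qed

text \<open>On the annulus \<open>\<bar>a\<bar> / 2 \<le> \<bar>x\<bar> \<le> 2 \<bar>a\<bar>\<close> the power \<open>\<bar>x\<bar>\<^sup>r\<close> is at most the sum of the values
at the two boundary circles, for either sign of \<open>r\<close>; this gives a summable majorant.\<close>

lemma analytic_theta_bounded:
  fixes q :: complex and b :: "int \<Rightarrow> complex"
  assumes q: "q \<noteq> 0" "norm q < 1" and b: "\<And>r. r \<in> A \<Longrightarrow> norm (b r) \<le> B"
  shows "(\<lambda>x. \<Sum>\<^sub>\<infinity>r\<in>A. b r * q powi (r * (r - 1) div 2) * x powi r) analytic_on -{0}"
proof (subst analytic_on_analytic_at, intro ballI)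
  fix a :: complex assume "a \<in> -{0}"
  hence a: "a \<noteq> 0" by simp
  show "(\<lambda>x. \<Sum>\<^sub>\<infinity>r\<in>A. b r * q powi (r * (r - 1) div 2) * x powi r) analytic_on {a}"
  proof (rule analytic_at_infsum[where \<epsilon> = "norm a / 2"])
    let ?l = "norm a / 2" and ?u = "2 * norm a"
    let ?M = "\<lambda>r::int. B * (norm q powi (r * (r - 1) div 2) * ?l powi r + norm q powi (r * (r - 1) div 2) * ?u powi r)"
    show "?M summable_on A"
      by (intro summable_on_cmult_right summable_on_add summable_on_theta_real) (use assms a in auto)
    have ne: "y \<noteq> 0 \<and> ?l \<le> norm y \<and> norm y \<le> ?u" if "y \<in> cball a ?l" for y
    proof -
      have "norm (a - y) \<le> norm a / 2" using that by (simp add: dist_norm)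
      moreover have "norm a \<le> norm y + norm (a - y)" "norm y \<le> norm a + norm (a - y)"
        by norm+
      ultimately have "?l \<le> norm y" "norm y \<le> ?u" using a by auto
      thus ?thesis using a by auto
    qed
    show "(\<lambda>x. b k * q powi (k * (k - 1) div 2) * x powi k) holomorphic_on cball a ?l" for k
      using ne by (intro holomorphic_intros) auto
    show "norm (b r * q powi (r * (r - 1) div 2) * y powi r) \<le> ?M r" if r: "r \<in> A" and y: "y \<in> cball a ?l" for r y
    proof -
      have B: "norm (b r) \<le> B" "B \<ge> 0" using b[OF r] norm_ge_zero order_trans by blast+
      have "norm y powi r \<le> ?l powi r + ?u powi r"
      proof (cases "r \<ge> 0")
        case True
        hence "norm y powi r \<le> ?u powi r" using ne[OF y] a by (intro power_int_mono) auto
        thus ?thesis using a by (simp add: add_increasing)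
      next
        case False
        have "inverse (norm y) \<le> inverse ?l" using ne[OF y] a by (intro le_imp_inverse_le) auto
        hence "inverse (norm y) ^ nat (- r) \<le> inverse ?l ^ nat (- r)" by (intro power_mono) auto
        hence "norm y powi r \<le> ?l powi r" using False by (simp add: power_int_def)
        thus ?thesis using a by (simp add: add_increasing2)
      qed
      hence "norm (b r) * (norm q powi (r * (r - 1) div 2) * norm y powi r)
               \<le> B * (norm q powi (r * (r - 1) div 2) * (?l powi r + ?u powi r))"
        using B by (intro mult_mono) auto
      thus ?thesis by (simp add: norm_mult norm_power_int mult.assoc distrib_left)
    qed
  qed (use a in auto)
qed

definition theta_series :: "complex \<Rightarrow> complex \<Rightarrow> complex" where
  "theta_series x q = (\<Sum>\<^sub>\<infinity>r::int. (-1) powi r * q powi (r * (r - 1) div 2) * x powi r)"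

lemma norm_neg_one_powi [simp]: "norm ((-1 :: complex) powi n) = 1"
  by (simp add: norm_power_int)

lemma summable_theta_series:
  fixes q x :: complex
  assumes "q \<noteq> 0" "norm q < 1" "x \<noteq> 0"
  shows "(\<lambda>r::int. (-1) powi r * q powi (r * (r - 1) div 2) * x powi r) summable_on A"
  by (rule summable_on_theta_bounded[OF assms, of _ _ 1]) simp

lemma theta_series_step:
  assumes "q \<noteq> 0" "x \<noteq> 0"
  shows "theta_series x q = - x * theta_series (q * x) q"
proof -
  have "theta_series x q = (\<Sum>\<^sub>\<infinity>r::int. (-1) powi (r+1) * q powi ((r+1) * ((r+1) - 1) div 2) * x powi (r+1))"
    unfolding theta_series_def
    by (rule infsum_reindex_bij_betw[symmetric]) (rule bij_betwI[of _ _ _ "\<lambda>r. r - 1"], auto)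
  also have "\<dots> = (\<Sum>\<^sub>\<infinity>r::int. - x * ((-1) powi r * q powi (r * (r - 1) div 2) * (q * x) powi r))"
    unfolding binom2_Suc using assms
    by (intro infsum_cong) (simp add: power_int_add power_int_mult_distrib mult_ac)
  also have "\<dots> = - x * theta_series (q * x) q"
    unfolding theta_series_def by (rule infsum_cmult_right')
  finally show ?thesis .
qed

lemma theta_series_flip:
  assumes "q \<noteq> 0" "x \<noteq> 0"
  shows "theta_series (q / x) q = theta_series x q"
proof -
  have "theta_series x q = (\<Sum>\<^sub>\<infinity>r::int. (-1) powi (-r) * q powi ((-r) * ((-r) - 1) div 2) * x powi (-r))"
    unfolding theta_series_def
    by (rule infsum_reindex_bij_betw[symmetric]) (rule bij_betwI[of _ _ _ "\<lambda>r. - r"], auto)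
  also have "\<dots> = theta_series (q / x) q"
    unfolding theta_series_def
  proof (rule infsum_cong)
    fix r :: int
    have "(-r) * ((-r) - 1) = r * (r - 1) + r * 2" by (simp add: algebra_simps)
    hence e: "(-r) * ((-r) - 1) div 2 = r * (r - 1) div 2 + r" by simp
    show "(-1) powi (-r) * q powi ((-r) * ((-r) - 1) div 2) * x powi (-r) =
          (-1) powi r * q powi (r * (r - 1) div 2) * (q / x) powi r"
      unfolding e using assms by (simp add: power_int_add power_int_minus power_int_divide_distrib field_simps)
  qed
  finally show ?thesis ..
qed

lemma infsum_int_mod3:
  fixes f :: "int \<Rightarrow> complex"
  assumes "f summable_on UNIV"
  shows "infsum f UNIV = (\<Sum>\<^sub>\<infinity>r. f (3 * r)) + (\<Sum>\<^sub>\<infinity>r. f (3 * r + 1)) + (\<Sum>\<^sub>\<infinity>r. f (3 * r + 2))"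
proof -
  let ?A = "\<lambda>j. range (\<lambda>r::int. 3 * r + j)"
  have S: "f summable_on B" for B using assms by (rule summable_on_subset_banach) auto
  have I: "infsum f (?A j) = (\<Sum>\<^sub>\<infinity>r. f (3 * r + j))" for j
    by (subst infsum_reindex) (auto simp: inj_on_def o_def)
  have "UNIV = ?A 0 \<union> ?A 1 \<union> ?A 2"
  proof -
    have "x \<in> ?A 0 \<union> ?A 1 \<union> ?A 2" for x
    proof -
      have "x = 3 * (x div 3) + x mod 3" by simp
      moreover have "x mod 3 = 0 \<or> x mod 3 = 1 \<or> x mod 3 = 2" by presburger
      ultimately have "x = 3 * (x div 3) + 0 \<or> x = 3 * (x div 3) + 1 \<or> x = 3 * (x div 3) + 2" by presburger
      thus ?thesis by blast
    qed
    thus ?thesis by blast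
  qed
  hence "infsum f UNIV = infsum f (?A 0 \<union> ?A 1 \<union> ?A 2)" by simp
  also have "\<dots> = infsum f (?A 0 \<union> ?A 1) + infsum f (?A 2)"
    by (rule infsum_Un_disjoint[OF S S]) (auto, presburger+)
  also have "infsum f (?A 0 \<union> ?A 1) = infsum f (?A 0) + infsum f (?A 1)"
    by (rule infsum_Un_disjoint[OF S S]) (auto, presburger+)
  finally show ?thesis unfolding I by simp
qed

text \<open>Writing the index as \<open>3 r + j\<close>, the exponent becomes
\<open>9 r (r - 1) / 2 + (3 + 3 j) r + j (j - 1) / 2\<close>, a theta series with base \<open>q ^ 9\<close> for each \<open>j\<close>.\<close>

lemma theta_series_mod3:
  assumes "q \<noteq> 0" "norm q < 1" "x \<noteq> 0"
  shows "theta_series x q = theta_series (q ^ 3 * x ^ 3) (q ^ 9)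
            - x * theta_series (q ^ 6 * x ^ 3) (q ^ 9) + q * x ^ 2 * theta_series (q ^ 9 * x ^ 3) (q ^ 9)"
proof -
  let ?f = "\<lambda>r::int. (-1) powi r * q powi (r * (r - 1) div 2) * x powi r"
  have "?f (3 * r + int j) = ((-1) ^ j * q ^ (j * (j - 1) div 2) * x ^ j) * 
          ((-1) powi r * (q ^ 9) powi (r * (r - 1) div 2) * (q ^ (3 + 3 * j) * x ^ 3) powi r)" for r j
  proof -
    have "(3 * r + int j) * ((3 * r + int j) - 1)
        = (9 * (r * (r - 1) div 2) + int (3 + 3 * j) * r + int (j * (j - 1) div 2)) * 2"
    proof -
      define t u where "t = r * (r - 1) div 2" and "u = int (j * (j - 1) div 2)"
      have "2 * t = r * (r - 1)" by (simp add: t_def)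
      moreover have "2 * u = int j * (int j - 1)"
        unfolding u_def binom2_nat[symmetric] by simp
      ultimately have "(3 * r + int j) * ((3 * r + int j) - 1) = (9 * t + int (3 + 3 * j) * r + u) * 2"
        unfolding of_nat_add of_nat_mult of_nat_numeral by algebra
      thus ?thesis by (simp only: t_def u_def)
    qed
    hence e: "(3 * r + int j) * ((3 * r + int j) - 1) div 2 =
        9 * (r * (r - 1) div 2) + int (3 + 3 * j) * r + int (j * (j - 1) div 2)" by simp
    have "(-1 :: complex) powi (3 * r) = ((-1) powi 3) powi r" by (simp only: power_int_mult)
    hence sg: "(-1 :: complex) powi (3 * r) = (-1) powi r" by simp
    have "q powi (9 * (r * (r - 1) div 2)) = (q powi 9) powi (r * (r - 1) div 2)" by (rule power_int_mult)
    moreover have "q powi (int (3 + 3 * j) * r) = (q ^ (3 + 3 * j)) powi r" by (simp only: power_int_mult power_int_of_nat)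
    moreover have "x powi (3 * r) = (x powi 3) powi r" by (rule power_int_mult)
    ultimately show ?thesis unfolding e using assms
      by (simp add: power_int_add sg sg[unfolded mult.commute[of 3]] power_int_mult_distrib mult_ac)
  qed
  from this[of _ 0] this[of _ 1] this[of _ 2] have
    "?f (3 * r) = (-1) powi r * (q ^ 9) powi (r * (r - 1) div 2) * (q ^ 3 * x ^ 3) powi r"
    "?f (3 * r + 1) = - x * ((-1) powi r * (q ^ 9) powi (r * (r - 1) div 2) * (q ^ 6 * x ^ 3) powi r)"
    "?f (3 * r + 2) = (q * x ^ 2) * ((-1) powi r * (q ^ 9) powi (r * (r - 1) div 2) * (q ^ 9 * x ^ 3) powi r)" for r
    by simp_all
  note e = this
  show ?thesis
    unfolding theta_series_def
    by (subst infsum_int_mod3[OF summable_theta_series[OF assms]]) 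
       (simp only: e infsum_cmult_right', simp)
qed

lemma holomorphic_theta_series:
  assumes "q \<noteq> 0" "norm q < 1"
  shows "(\<lambda>x. theta_series x q) holomorphic_on -{0}"
  unfolding theta_series_def
  by (rule analytic_imp_holomorphic, rule analytic_theta_bounded[OF assms, of _ _ 1]) simp

text \<open>The series is a theta function of degree one that vanishes at \<open>1\<close>, for
\<open>theta_series q q\<close> equals \<open>- theta_series 1 q\<close> by the functional equation and \<open>theta_series 1 q\<close> by the
symmetry under \<open>x \<mapsto> q / x\<close>.\<close>

lemma theta_series_proportional:
  assumes q: "q \<noteq> 0" "norm q < 1"
  obtains c where "\<And>x. x \<noteq> 0 \<Longrightarrow> theta_series x q = c * Theta x q"
proof -
  have tl: "theta_like 1 (-1) q (\<lambda>x. theta_series x q)"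
    unfolding theta_like_def using holomorphic_theta_series[OF q] theta_series_step[OF q(1)]
    by (auto simp: power_int_minus field_simps)
  have "theta_series 1 q = 0" using theta_series_step[OF q(1), of 1] theta_series_flip[OF q(1), of 1] by simp
  then obtain g where g: "theta_like (1 - 1) (- (-1) / 1) q g" 
      "\<And>x. x \<noteq> 0 \<Longrightarrow> theta_series x q = Theta (x / 1) q * g x"
    using theta_like_divide[OF q tl, of 1] by auto
  have "g (q * x) = 1 * g x" if "x \<noteq> 0" for x using g(1) that by (simp add: theta_like_def)
  then obtain b and k :: int where "\<And>x. x \<noteq> 0 \<Longrightarrow> g x = b * x powi k" "b = 0 \<or> 1 = q powi k"
    using multiplicatively_periodic[OF q, of g 1] g(1) unfolding theta_like_def by blast
  hence "\<And>x. x \<noteq> 0 \<Longrightarrow> g x = b" using powi_eq_1_iff[OF q, of k] by auto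
  with g(2) show ?thesis using that[of b] by auto
qed

definition omega :: complex where "omega = exp (2 * of_real pi * \<i> / 3)"

lemma omega_cube: "omega ^ 3 = 1"
proof -
  have "omega ^ 3 = exp (of_nat 3 * (2 * of_real pi * \<i> / 3))" unfolding omega_def by (rule exp_of_nat_mult[symmetric])
  also have "of_nat 3 * (2 * of_real pi * \<i> / 3) = 2 * of_real pi * \<i>" by simp
  finally show ?thesis by (simp only: exp_two_pi_i)
qed

lemma omega_neq_1: "omega \<noteq> 1"
proof
  assume "omega = 1"
  hence "Im (exp (2 * of_real pi * \<i> / 3)) = 0" unfolding omega_def by simp
  thus False by (simp add: Im_exp sin_120)
qed

lemma omega_sum: "1 + omega + omega ^ 2 = 0"
proof -
  have "(omega - 1) * (1 + omega + omega ^ 2) = 0"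
    using omega_cube by (simp add: algebra_simps power2_eq_square power3_eq_cube)
  thus ?thesis using omega_neq_1 by simp
qed

lemma omega_nonzero [simp]: "omega \<noteq> 0" by (simp add: omega_def)

lemma qpoch_inf_cube:
  assumes "norm q < 1"
  shows "qpoch_inf (x ^ 3) (q ^ 3) = qpoch_inf x q * qpoch_inf (omega * x) q * qpoch_inf (omega ^ 2 * x) q"
proof (rule LIMSEQ_unique)
  have q3: "norm (q ^ 3) < 1" using assms by (simp add: norm_power power_less_one_iff)
  show "(\<lambda>m. \<Prod>i<m. 1 - (q ^ 3) ^ i * x ^ 3) \<longlonglongrightarrow> qpoch_inf (x ^ 3) (q ^ 3)"
    by (rule qpoch_inf_LIMSEQ[OF q3])
  have "(\<lambda>m. (\<Prod>i<m. 1 - q ^ i * x) * (\<Prod>i<m. 1 - q ^ i * (omega * x)) * (\<Prod>i<m. 1 - q ^ i * (omega ^ 2 * x))) 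
      \<longlonglongrightarrow> qpoch_inf x q * qpoch_inf (omega * x) q * qpoch_inf (omega ^ 2 * x) q"
    by (intro tendsto_mult qpoch_inf_LIMSEQ assms)
  moreover have "(1 - t) * (1 - omega * t) * (1 - omega ^ 2 * t) = 1 - t ^ 3" for t
  proof -
    have "(1 - t) * (1 - omega * t) * (1 - omega ^ 2 * t)
        = 1 - t * (1 + omega + omega ^ 2) + omega * t ^ 2 * (1 + omega + omega ^ 2) - omega ^ 3 * t ^ 3"
      by (simp add: algebra_simps power2_eq_square power3_eq_cube)
    thus ?thesis by (simp add: omega_sum omega_cube)
  qed
  from this[of "q ^ _ * x"] have
    "(1 - q ^ i * x) * (1 - q ^ i * (omega * x)) * (1 - q ^ i * (omega ^ 2 * x)) = 1 - (q ^ 3) ^ i * x ^ 3" for i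
    by (simp add: power_mult_distrib mult_ac flip: power_mult)
  ultimately show "(\<lambda>m. \<Prod>i<m. 1 - (q ^ 3) ^ i * x ^ 3) \<longlonglongrightarrow> 
      qpoch_inf x q * qpoch_inf (omega * x) q * qpoch_inf (omega ^ 2 * x) q"
    by (simp add: prod.distrib[symmetric])
qed

text \<open>The two products, together with \<open>(q; q)\<^sub>\<infinity>\<close>, run over all cube roots of unity.\<close>

lemma Theta_omega:
  assumes "q \<noteq> 0" "norm q < 1"
  shows "Theta omega q = (1 - omega) * qpoch_inf (q ^ 3) (q ^ 3)"
proof -
  have "q / omega = omega ^ 2 * q" using omega_cube by (simp add: field_simps power2_eq_square power3_eq_cube)
  thus ?thesis using qpoch_inf_cube[OF assms(2), of q] assms
    by (simp add: Theta_alt mult_ac)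
qed

lemma qpoch_inf_split2:
  assumes "norm q < 1"
  shows "qpoch_inf x q = qpoch_inf x (q ^ 2) * qpoch_inf (q * x) (q ^ 2)"
  using qpoch_inf_split[OF assms, of 2 x] by (simp add: lessThan_nat_numeral lessThan_Suc)

lemma qpoch_inf_split3:
  assumes "norm q < 1"
  shows "qpoch_inf x q = qpoch_inf x (q ^ 3) * qpoch_inf (q * x) (q ^ 3) * qpoch_inf (q ^ 2 * x) (q ^ 3)"
  using qpoch_inf_split[OF assms, of 3 x] by (simp add: lessThan_nat_numeral lessThan_Suc)

lemma Theta_base3:
  assumes "q \<noteq> 0" "norm q < 1"
  shows "Theta q (q ^ 3) = qpoch_inf q q"
proof -
  have "q ^ 3 / q = q * q" "q ^ 2 * q = q ^ 3" using assms by (simp_all add: power3_eq_cube power2_eq_square)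
  thus ?thesis using qpoch_inf_split3[OF assms(2), of q] by (simp add: Theta_def)
qed

lemma norm_power_lt_1: "norm (q::complex) < 1 \<Longrightarrow> n > 0 \<Longrightarrow> norm (q ^ n) < 1"
  by (simp add: norm_power power_less_one_iff)

text \<open>Let \<open>c q\<close> be the factor between series and product. At a primitive cube root of unity the
splitting modulo \<open>3\<close> loses its last term and the other two theta values coincide, which turns into
\<open>c q = c (q ^ 9)\<close>. Iterating, \<open>c q = c (q ^ (9 ^ n))\<close>, and the right side tends to \<open>1\<close>
because both the series and the product tend to \<open>1 - omega\<close> there as the base tends to \<open>0\<close>.\<close>

theorem jacobi_triple_product:
  assumes q: "q \<noteq> 0" "norm q < 1" and x: "x \<noteq> 0"
  shows "theta_series x q = Theta x q"
proof -
  define c where "c q = theta_series omega q / Theta omega q" for q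
  have Tom: "Theta omega q \<noteq> 0" if q: "q \<noteq> 0" "norm q < 1" for q
    using Theta_omega[OF q] omega_neq_1 qpoch_inf_base_nonzero[of "q ^ 3"] norm_power_lt_1[OF q(2), of 3] by auto
  have c: "theta_series x q = c q * Theta x q" if q: "q \<noteq> 0" "norm q < 1" and "x \<noteq> 0" for x q
  proof -
    obtain d where d: "\<And>x. x \<noteq> 0 \<Longrightarrow> theta_series x q = d * Theta x q"
      using theta_series_proportional[OF q] by blast
    have "c q = d" unfolding c_def using d[of omega] Tom[OF q] by simp
    thus ?thesis using d that by simp
  qed
  have c9: "c q = c (q ^ 9)" if q: "q \<noteq> 0" "norm q < 1" for q
  proof -
    have q9: "q ^ 9 \<noteq> 0" "norm (q ^ 9) < 1" using q norm_power_lt_1 by auto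
    have q3: "q ^ 3 \<noteq> 0" "norm (q ^ 3) < 1" using q norm_power_lt_1 by auto
    have "theta_series (q ^ 9 * 1) (q ^ 9) = 0" 
      using theta_series_step[OF q9(1), of 1] theta_series_flip[OF q9(1), of 1] by simp
    moreover have "theta_series (q ^ 6) (q ^ 9) = theta_series (q ^ 3) (q ^ 9)"
      using theta_series_flip[OF q9(1), of "q ^ 3"] q by (simp add: power_diff[symmetric])
    ultimately have "theta_series omega q = (1 - omega) * theta_series (q ^ 3) (q ^ 9)"
      using theta_series_mod3[OF q, of omega] by (simp add: omega_cube algebra_simps)
    also have "\<dots> = (1 - omega) * (c (q ^ 9) * qpoch_inf (q ^ 3) (q ^ 3))"
      using c[OF q9, of "q ^ 3"] Theta_base3[OF q3] q by (simp add: power_mult[symmetric])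
    also have "\<dots> = c (q ^ 9) * Theta omega q" using Theta_omega[OF q] by simp
    finally show ?thesis using c[OF q, of omega] Tom[OF q] by simp
  qed
  \<comment> \<open>bases along which the factor is constant\<close>
  define Q where "Q n = q ^ (9 ^ n)" for n
  have Q: "Q n \<noteq> 0" "norm (Q n) < 1" "norm (Q n) \<le> norm q" for n
  proof -
    show "Q n \<noteq> 0" "norm (Q n) < 1" using q norm_power_lt_1 by (auto simp: Q_def)
    have "(9::nat) ^ n \<ge> 1" by simp
    thus "norm (Q n) \<le> norm q" unfolding Q_def norm_power
      using power_decreasing[of 1 "9 ^ n" "norm q"] q by simp
  qed
  have cQ: "c (Q n) = c q" for n
  proof (induction n)
    case (Suc n)
    have "Q (Suc n) = Q n ^ 9" by (simp add: Q_def power_mult[symmetric] mult.commute)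
    with Suc c9[OF Q(1,2), of n] show ?case by simp
  qed (simp add: Q_def)
  have Q0: "Q \<longlonglongrightarrow> 0"
  proof -
    have "filterlim (\<lambda>n. (9::nat) ^ n) at_top sequentially"
      by (intro filterlim_subseq) (auto simp: strict_mono_def)
    with LIMSEQ_power_zero[OF q(2)] show ?thesis unfolding Q_def by (rule filterlim_compose)
  qed
  \<comment> \<open>the summands of index \<open>0\<close> and \<open>1\<close> give \<open>1 - omega\<close>; all others carry a positive power of the base\<close>
  define S where "S = (\<Sum>\<^sub>\<infinity>r::int. norm q powi (r * (r - 1) div 2) * 1 powi r)"
  have bd: "norm (theta_series omega (Q n) - (1 - omega)) \<le> norm (Q n) / norm q * S" for n
  proof -
    let ?f = "\<lambda>r::int. (-1) powi r * Q n powi (r * (r - 1) div 2) * omega powi r"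
    have nom: "norm omega = 1" by (simp add: omega_def)
    have sm: "?f summable_on A" for A by (rule summable_theta_series[OF Q(1,2)]) simp
    have "theta_series omega (Q n) = infsum ?f {0,1} + infsum ?f (-{0,1})"
      unfolding theta_series_def using infsum_Un_disjoint[OF sm sm, of "{0,1}" "-{0,1}"] by simp
    also have "infsum ?f {0,1} = 1 - omega" by simp
    finally have "norm (theta_series omega (Q n) - (1 - omega)) = norm (infsum ?f (-{0,1}))" by simp
    also have "\<dots> \<le> (\<Sum>\<^sub>\<infinity>r\<in>-{0,1::int}. norm (Q n) / norm q * (norm q powi (r * (r - 1) div 2) * 1 powi r))"
    proof (rule norm_infsum_le)
      show "(?f has_sum infsum ?f (-{0,1})) (-{0,1})" using sm by simp
      show "((\<lambda>r. norm (Q n) / norm q * (norm q powi (r * (r - 1) div 2) * 1 powi r)) has_sum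
        (\<Sum>\<^sub>\<infinity>r\<in>-{0,1::int}. norm (Q n) / norm q * (norm q powi (r * (r - 1) div 2) * 1 powi r))) (-{0,1})"
        using q by (intro has_sum_infsum summable_on_cmult_right summable_on_theta_real) auto
      fix r :: int assume "r \<in> -{0,1}"
      hence "r * (r - 1) div 2 \<ge> 1" by (intro binom2_pos) auto
      then obtain k where k: "r * (r - 1) div 2 = int (Suc k)"
        by (intro that[of "nat (r * (r - 1) div 2 - 1)"]) simp
      have "norm (Q n) ^ k \<le> norm q ^ k" using Q by (intro power_mono) auto
      hence "norm (Q n) * norm (Q n) ^ k \<le> norm (Q n) * norm q ^ k" by (intro mult_left_mono) auto
      thus "norm (?f r) \<le> norm (Q n) / norm q * (norm q powi (r * (r - 1) div 2) * 1 powi r)"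
        using q unfolding k power_int_of_nat by (simp add: norm_mult norm_power norm_power_int nom)
    qed
    also have "\<dots> = norm (Q n) / norm q * (\<Sum>\<^sub>\<infinity>r\<in>-{0,1::int}. norm q powi (r * (r - 1) div 2) * 1 powi r)"
      by (rule infsum_cmult_right')
    also have "\<dots> \<le> norm (Q n) / norm q * S" unfolding S_def
      using q by (intro mult_left_mono infsum_mono2 summable_on_theta_real) auto
    finally show ?thesis .
  qed
  have "(\<lambda>n. norm (Q n) / norm q * S) \<longlonglongrightarrow> norm (0::complex) / norm q * S"
    by (intro tendsto_intros Q0) (use q in auto)
  hence "(\<lambda>n. norm (Q n) / norm q * S) \<longlonglongrightarrow> 0" by simp
  hence "(\<lambda>n. theta_series omega (Q n) - (1 - omega)) \<longlonglongrightarrow> 0"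
    by (rule Lim_null_comparison[rotated]) (use bd in auto)
  hence l1: "(\<lambda>n. theta_series omega (Q n)) \<longlonglongrightarrow> 1 - omega" by (simp add: LIM_zero_iff)
  have "(\<lambda>n. Q n ^ 3) \<longlonglongrightarrow> 0 ^ 3" by (intro tendsto_intros Q0)
  hence "(\<lambda>n. qpoch_inf (Q n ^ 3) (Q n ^ 3)) \<longlonglongrightarrow> 1"
    by (intro qpoch_inf_tendsto_1) (use norm_power_lt_1[OF Q(2)] in auto)
  hence "(\<lambda>n. c q * ((1 - omega) * qpoch_inf (Q n ^ 3) (Q n ^ 3))) \<longlonglongrightarrow> c q * ((1 - omega) * 1)"
    by (intro tendsto_intros)
  also have "(\<lambda>n. c q * ((1 - omega) * qpoch_inf (Q n ^ 3) (Q n ^ 3))) = (\<lambda>n. theta_series omega (Q n))"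
    using c[OF Q(1,2), of omega] Theta_omega[OF Q(1,2)] by (auto simp: cQ)
  finally have "c q * ((1 - omega) * 1) = 1 - omega" using l1 LIMSEQ_unique by blast
  hence "c q = 1" using omega_neq_1 by simp
  thus ?thesis using c[OF q x] by simp
qed

lemma Theta_mod3:
  assumes "q \<noteq> 0" "norm q < 1" "x \<noteq> 0"
  shows "Theta x q = Theta (q ^ 3 * x ^ 3) (q ^ 9) - x * Theta (q ^ 6 * x ^ 3) (q ^ 9) + q * x ^ 2 * Theta (q ^ 9 * x ^ 3) (q ^ 9)"
  using theta_series_mod3[OF assms] assms norm_power_lt_1[OF assms(2), of 9]
  by (simp add: jacobi_triple_product)

section \<open>The Lambert series of an Appell function\<close>

lemma filterlim_at_analytic:
  assumes h: "h analytic_on {a}" and d: "(h has_field_derivative d) (at a)" "d \<noteq> 0"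
  shows "filterlim h (at (h a)) (at a)"
proof (rule filterlim_atI)
  obtain k where k: "k analytic_on {a}" "k a = deriv h a" "\<And>x. h x = h a + (x - a) * k x"
    using analytic_factor[OF h] by blast
  have kd: "k a = d" using k(2) d(1) by (simp add: DERIV_imp_deriv)
  have ne: "\<forall>\<^sub>F x in at a. x \<noteq> a" by (simp add: eventually_at_filter)
  have "k \<midarrow>a\<rightarrow> d" using analytic_at_imp_isCont[OF k(1)] kd by (simp add: isCont_def)
  hence kn: "\<forall>\<^sub>F x in at a. k x \<noteq> 0" using d(2) by (rule tendsto_imp_eventually_ne)
  show "h \<midarrow>a\<rightarrow> h a" using analytic_at_imp_isCont[OF h] by (simp add: isCont_def)
  have hd: "x = a \<or> k x = 0 \<longleftrightarrow> h x = h a" for x using k(3)[of x] by auto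
  show "\<forall>\<^sub>F x in at a. h x \<noteq> h a" using ne kn by eventually_elim (use hd in blast)
qed

lemma simple_pole_compose:
  assumes f: "simple_pole f (h a) \<rho>" and h: "h analytic_on {a}" 
    and d: "(h has_field_derivative d) (at a)" "d \<noteq> 0"
  shows "simple_pole (\<lambda>x. f (h x)) a (\<rho> / d)"
proof -
  obtain F where F: "F analytic_on {h a}" "F (h a) = \<rho>" "\<forall>\<^sub>F x in at (h a). (x - h a) * f x = F x"
    using f unfolding simple_pole_def by blast
  obtain k where k: "k analytic_on {a}" "k a = deriv h a" "\<And>x. h x = h a + (x - a) * k x"
    using analytic_factor[OF h] by blast
  have kd: "k a = d" using k(2) d(1) by (simp add: DERIV_imp_deriv)
  have ne: "\<forall>\<^sub>F x in at a. x \<noteq> a" by (simp add: eventually_at_filter)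
  have "k \<midarrow>a\<rightarrow> d" using analytic_at_imp_isCont[OF k(1)] kd by (simp add: isCont_def)
  hence kn: "\<forall>\<^sub>F x in at a. k x \<noteq> 0" using d(2) by (rule tendsto_imp_eventually_ne)
  from eventually_compose_filterlim[OF F(3) filterlim_at_analytic[OF h d]] kn ne
  have "\<forall>\<^sub>F x in at a. (x - a) * f (h x) = F (h x) / k x"
  proof eventually_elim
    case (elim x)
    have "h x - h a = (x - a) * k x" using k(3)[of x] by simp
    with elim show ?case by (simp add: field_simps)
  qed
  moreover have "(\<lambda>x. F (h x)) analytic_on {a}"
    using analytic_on_compose[OF h, of F] F(1) by (simp add: o_def)
  hence "(\<lambda>x. F (h x) / k x) analytic_on {a}" using k(1) kd d(2) by (intro analytic_intros) auto
  ultimately show ?thesis unfolding simple_pole_def using F(2) kd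
    by (intro exI[of _ "\<lambda>x. F (h x) / k x"]) auto
qed

text \<open>The numerator of \<open>appell_m x z q\<close>, with \<open>w = x z\<close> as first argument: in this variable the poles
are the powers of \<open>q\<close>, whatever \<open>z\<close> is.\<close>

definition appell_sum :: "complex \<Rightarrow> complex \<Rightarrow> complex \<Rightarrow> complex" where
  "appell_sum w z q = (\<Sum>\<^sub>\<infinity>r::int. (-1) powi r * q powi (r * (r - 1) div 2) * z powi r / (1 - q powi (r - 1) * w))"

lemma appell_m_eq_sum: "appell_m x z q = appell_sum (x * z) z q / Theta z q"
  unfolding appell_m_def appell_sum_def by (simp add: mult.assoc)

text \<open>A bound for the denominators that is uniform in the index and locally uniform in \<open>w\<close>. Outside a
finite range of \<open>r\<close> the number \<open>q powi (r - 1) * v\<close> has modulus at most \<open>1/2\<close> or at least \<open>2\<close>;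
on the finite range continuity suffices.\<close>

lemma geometric_away_from_1:
  fixes q w :: complex
  assumes q: "q \<noteq> 0" "norm q < 1" and w: "w \<noteq> 0" and A: "\<And>r::int. r \<in> A \<Longrightarrow> q powi (r - 1) * w \<noteq> 1"
  obtains \<epsilon> \<delta> where "\<epsilon> > 0" "\<delta> > 0" "\<And>v r. v \<in> cball w \<epsilon> \<Longrightarrow> r \<in> A \<Longrightarrow> norm (1 - q powi (r - 1) * v) \<ge> \<delta>"
proof -
  let ?c = "norm w"
  have "(\<lambda>n. norm q ^ n) \<longlonglongrightarrow> 0" using q by (intro LIMSEQ_realpow_zero) auto
  hence "\<forall>\<^sub>F n in sequentially. norm q ^ n < min (1 / (4 * ?c)) (?c / 4)"
    using w by (intro order_tendstoD) auto
  then obtain K where K0: "norm q ^ K < min (1 / (4 * ?c)) (?c / 4)" by (auto simp: eventually_sequentially)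
  hence K: "norm q ^ K * (4 * ?c) \<le> 1" "norm q ^ K * 4 \<le> ?c" using w by (auto simp: field_simps)
  define F where "F = A \<inter> {r. \<bar>r - 1\<bar> < int K}"
  have "finite F" unfolding F_def by (rule finite_subset[of _ "{-int K..int K + 1}"]) auto
  define \<delta> where "\<delta> = Min (insert (1/2) ((\<lambda>r. norm (1 - q powi (r - 1) * w) / 2) ` F))"
  have "\<delta> > 0" unfolding \<delta>_def using \<open>finite F\<close> A by (subst Min_gr_iff) (auto simp: F_def)
  have d: "\<delta> \<le> 1/2" "\<And>r. r \<in> F \<Longrightarrow> \<delta> \<le> norm (1 - q powi (r - 1) * w) / 2"
    unfolding \<delta>_def using \<open>finite F\<close> by (auto intro!: Min_le simp del: divide_le_eq_numeral1 le_divide_eq_numeral1)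
  have "\<forall>\<^sub>F v in nhds w. norm (1 - q powi (r - 1) * v) > \<delta>" if r: "r \<in> F" for r
  proof -
    have "((\<lambda>v. norm (1 - q powi (r - 1) * v)) \<longlongrightarrow> norm (1 - q powi (r - 1) * w)) (nhds w)"
      by (intro tendsto_intros filterlim_ident)
    moreover have "\<delta> < norm (1 - q powi (r - 1) * w)"
      using d(2)[OF r] \<open>\<delta> > 0\<close> by linarith
    ultimately show ?thesis by (rule order_tendstoD)
  qed
  hence "\<forall>\<^sub>F v in nhds w. \<forall>r\<in>F. norm (1 - q powi (r - 1) * v) > \<delta>"
    using \<open>finite F\<close> by (simp add: eventually_ball_finite)
  then obtain e where e: "e > 0" "\<And>v r. dist v w < e \<Longrightarrow> r \<in> F \<Longrightarrow> norm (1 - q powi (r - 1) * v) > \<delta>"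
    unfolding eventually_nhds_metric by blast
  define \<epsilon> where "\<epsilon> = min (e / 2) (?c / 2)"
  show ?thesis
  proof (rule that[of \<epsilon> \<delta>])
    show "\<epsilon> > 0" using e w by (simp add: \<epsilon>_def)
    show "\<delta> > 0" by fact
    fix v r assume v: "v \<in> cball w \<epsilon>" and r: "r \<in> A"
    have dist: "dist v w < e" "norm (w - v) \<le> ?c / 2"
      using v e by (auto simp: \<epsilon>_def dist_norm norm_minus_commute)
    have "norm w \<le> norm v + norm (w - v)" "norm v \<le> norm w + norm (w - v)"  by norm+
    with dist have vn: "?c / 2 \<le> norm v" "norm v \<le> 2 * ?c" using norm_ge_zero[of w] by linarith+
    consider "r \<in> F" | "r - 1 \<ge> int K" | "r - 1 \<le> - int K" using r unfolding F_def by (smt (verit) IntI mem_Collect_eq)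
    thus "norm (1 - q powi (r - 1) * v) \<ge> \<delta>"
    proof cases
      case 1
      thus ?thesis using e(2)[OF dist(1)] by (simp add: less_imp_le)
    next
      case 2
      hence "norm q powi (r - 1) \<le> norm q ^ K"
        using q power_decreasing[of K "nat (r - 1)" "norm q"] by (simp add: power_int_def)
      hence "norm q powi (r - 1) * norm v \<le> norm q ^ K * (2 * ?c)" using vn by (intro mult_mono) auto
      also have "\<dots> \<le> 1 / 2" using K(1) by simp
      finally have "norm (q powi (r - 1) * v) \<le> 1 / 2" by (simp add: norm_mult norm_power_int)
      moreover have "1 \<le> norm (1 - q powi (r - 1) * v) + norm (q powi (r - 1) * v)"
        using norm_triangle_ineq[of "1 - q powi (r - 1) * v" "q powi (r - 1) * v"] by simp
      ultimately show ?thesis using d(1) by linarith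
    next
      case 3
      define n where "n = nat (1 - r)"
      have n: "r - 1 = - int n" "n \<ge> K" using 3 by (auto simp: n_def)
      have "norm q ^ n \<le> norm q ^ K" using q n by (intro power_decreasing) auto
      hence "norm q ^ n * 4 \<le> 2 * norm v" using K(2) vn by linarith
      hence "2 \<le> norm v / norm q ^ n" using q by (simp add: field_simps)
      also have "\<dots> = norm (q powi (r - 1) * v)"
        unfolding n by (simp add: norm_mult norm_power_int power_int_minus norm_inverse norm_power norm_divide field_simps)
      finally have "2 \<le> norm (q powi (r - 1) * v)" .
      moreover have "norm (q powi (r - 1) * v) \<le> norm (1 - q powi (r - 1) * v) + 1"
        using norm_triangle_ineq4[of "1" "1 - q powi (r - 1) * v"] by simp
      ultimately show ?thesis using d(1) by linarith
    qed
  qed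
qed

lemma summable_appell_terms:
  fixes q w z :: complex
  assumes q: "q \<noteq> 0" "norm q < 1" and w: "w \<noteq> 0" and z: "z \<noteq> 0"
    and A: "\<And>r::int. r \<in> A \<Longrightarrow> q powi (r - 1) * w \<noteq> 1"
  shows "(\<lambda>r::int. (-1) powi r * q powi (r * (r - 1) div 2) * z powi r / (1 - q powi (r - 1) * w)) summable_on A"
proof -
  obtain \<epsilon> \<delta> where ed: "\<epsilon> > 0" "\<delta> > 0" "\<And>v r. v \<in> cball w \<epsilon> \<Longrightarrow> r \<in> A \<Longrightarrow> norm (1 - q powi (r - 1) * v) \<ge> \<delta>"
    using geometric_away_from_1[OF q w, of A] A by blast
  have "(\<lambda>r::int. ((-1) powi r / (1 - q powi (r - 1) * w)) * q powi (r * (r - 1) div 2) * z powi r) summable_on A"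
    by (rule summable_on_theta_bounded[OF q z, of _ _ "1 / \<delta>"])
       (use ed(1,2) ed(3)[of w] in \<open>auto simp: norm_divide intro!: divide_left_mono mult_pos_pos intro: less_le_trans\<close>)
  thus ?thesis by simp
qed

lemma analytic_appell_terms:
  fixes q w z :: complex
  assumes q: "q \<noteq> 0" "norm q < 1" and w: "w \<noteq> 0" and z: "z \<noteq> 0"
    and A: "\<And>r::int. r \<in> A \<Longrightarrow> q powi (r - 1) * w \<noteq> 1"
  shows "(\<lambda>v. \<Sum>\<^sub>\<infinity>r\<in>A. (-1) powi r * q powi (r * (r - 1) div 2) * z powi r / (1 - q powi (r - 1) * v)) analytic_on {w}"
proof -
  obtain \<epsilon> \<delta> where ed: "\<epsilon> > 0" "\<delta> > 0" "\<And>v r. v \<in> cball w \<epsilon> \<Longrightarrow> r \<in> A \<Longrightarrow> norm (1 - q powi (r - 1) * v) \<ge> \<delta>"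
    using geometric_away_from_1[OF q w, of A] A by blast
  show ?thesis
  proof (rule analytic_at_infsum[OF ed(1)])
    show "(\<lambda>r::int. 1 / \<delta> * (norm q powi (r * (r - 1) div 2) * norm z powi r)) summable_on A"
      by (intro summable_on_cmult_right summable_on_theta_real) (use q z in auto)
    fix r assume r: "r \<in> A"
    show "(\<lambda>v. (-1) powi r * q powi (r * (r - 1) div 2) * z powi r / (1 - q powi (r - 1) * v)) holomorphic_on cball w \<epsilon>"
      using ed(2) ed(3)[OF _ r] by (intro holomorphic_intros) fastforce
    fix v assume v: "v \<in> cball w \<epsilon>"
    let ?t = "norm q powi (r * (r - 1) div 2) * norm z powi r"
    have "norm ((-1) powi r * q powi (r * (r - 1) div 2) * z powi r / (1 - q powi (r - 1) * v)) = ?t / norm (1 - q powi (r - 1) * v)"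
      by (simp add: norm_mult norm_divide norm_power_int)
    also have "\<dots> \<le> ?t / \<delta>"
    proof -
      have "norm (1 - q powi (r - 1) * v) > 0" using ed(2) ed(3)[OF v r] by linarith
      thus ?thesis using ed(2) ed(3)[OF v r] by (intro divide_left_mono mult_pos_pos) auto
    qed
    finally show "norm ((-1) powi r * q powi (r * (r - 1) div 2) * z powi r / (1 - q powi (r - 1) * v)) \<le> 1 / \<delta> * ?t" by simp
  qed
qed

lemma Theta_nonzero_iff_powi:
  assumes "q \<noteq> 0" "norm q < 1" "w \<noteq> 0"
  shows "Theta w q \<noteq> 0 \<longleftrightarrow> (\<forall>r::int. q powi (r - 1) * w \<noteq> 1)"
proof -
  have "(q powi (r - 1) * w = 1) \<longleftrightarrow> w = q powi (1 - r)" for r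
    using assms by (simp add: power_int_diff field_simps) 
  moreover have "(\<exists>n::int. w = q powi n) \<longleftrightarrow> (\<exists>r::int. w = q powi (1 - r))"
    by (metis diff_diff_eq2 diff_add_cancel add_diff_cancel_left')
  ultimately show ?thesis using Theta_eq_0_iff[OF assms] by simp
qed

lemma analytic_appell_sum:
  assumes "q \<noteq> 0" "norm q < 1" "w \<noteq> 0" "z \<noteq> 0" "Theta w q \<noteq> 0"
  shows "(\<lambda>v. appell_sum v z q) analytic_on {w}"
  unfolding appell_sum_def
  by (rule analytic_appell_terms) (use assms Theta_nonzero_iff_powi[OF assms(1-3)] in auto)

lemma analytic_appell_sum_compose:
  assumes "q \<noteq> 0" "norm q < 1" "h a \<noteq> 0" "z \<noteq> 0" "Theta (h a) q \<noteq> 0" "h analytic_on {a}"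
  shows "(\<lambda>v. appell_sum (h v) z q) analytic_on {a}"
  using analytic_on_compose[OF assms(6), of "\<lambda>v. appell_sum v z q"] analytic_appell_sum[OF assms(1-5)]
  by (simp add: o_def)

text \<open>At a power of \<open>q\<close> one summand is singular, and the series over all other indices is analytic.\<close>

lemma simple_pole_appell_sum:
  fixes q z :: complex and n :: int
  assumes q: "q \<noteq> 0" "norm q < 1" and z: "z \<noteq> 0"
  shows "simple_pole (\<lambda>w. appell_sum w z q) (q powi (1 - n))
           ((-1) powi n * q powi (n * (n - 1) div 2) * z powi n * (- (q powi (1 - n))))"
proof -
  let ?a = "q powi (1 - n)" and ?c = "(-1) powi n * q powi (n * (n - 1) div 2) * z powi n"
  let ?f = "\<lambda>w r::int. (-1) powi r * q powi (r * (r - 1) div 2) * z powi r / (1 - q powi (r - 1) * w)"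
  have a0: "?a \<noteq> 0" using q by simp
  have "simple_pole (\<lambda>w. 1 / (1 - q powi (n - 1) * w)) ?a (1 / (- (q powi (n - 1))))"
  proof (rule simple_pole_inverse)
    show "1 - q powi (n - 1) * ?a = 0" using q by (simp add: power_int_diff)
  qed (use q in \<open>auto intro!: analytic_intros derivative_eq_intros\<close>)
  hence "simple_pole (\<lambda>w. ?c * (1 / (1 - q powi (n - 1) * w))) ?a (?c * (1 / (- (q powi (n - 1)))))"
    by (intro simple_pole_mult[where h = "\<lambda>_. ?c"] analytic_intros)
  moreover have "simple_pole (\<lambda>w. infsum (?f w) (-{n})) ?a 0"
  proof (intro simple_pole_analytic analytic_appell_terms q z a0)
    fix r assume "r \<in> -{n}"
    hence "q powi (r - n) \<noteq> 1" using powi_eq_1_iff[OF q, of "r - n"] by auto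
    thus "q powi (r - 1) * ?a \<noteq> 1" using q by (simp add: power_int_diff)
  qed
  ultimately have "simple_pole (\<lambda>w. ?c * (1 / (1 - q powi (n - 1) * w)) + infsum (?f w) (-{n})) ?a 
       (?c * (1 / (- (q powi (n - 1)))) + 0)"
    by (rule simple_pole_add)
  thus ?thesis
  proof (rule simple_pole_cong)
    show "?c * (1 / (- (q powi (n - 1)))) + 0 = ?c * (- (q powi (1 - n)))"
      using q by (simp add: power_int_diff field_simps)
    show "\<forall>\<^sub>F w in at ?a. ?c * (1 / (1 - q powi (n - 1) * w)) + infsum (?f w) (-{n}) = appell_sum w z q"
      using eventually_at_nonzero[OF a0] eventually_Theta_nonzero[OF q a0]
    proof eventually_elim
      case (elim w)
      have S: "?f w summable_on B" for B
        by (rule summable_appell_terms[OF q elim(1) z]) (use elim Theta_nonzero_iff_powi[OF q elim(1)] in auto)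
      have "appell_sum w z q = infsum (?f w) ({n} \<union> -{n})" unfolding appell_sum_def by simp
      also have "\<dots> = infsum (?f w) {n} + infsum (?f w) (-{n})"
        by (rule infsum_Un_disjoint[OF S S]) simp
      finally show ?case by simp
    qed
  qed
qed

lemma bij_int_shift: "bij_betw (\<lambda>r::int. r + 1) UNIV UNIV"
  by (rule bij_betwI[of _ _ _ "\<lambda>r. r - 1"]) auto

text \<open>After a shift of the index the two series have the same denominators, and
\<open>1 / (1 - t) - t / (1 - t) = 1\<close> leaves the theta series. In terms of \<open>x = w / z\<close> this is
\<open>m(q x, z) = 1 - x m(x, z)\<close>.\<close>

lemma appell_sum_step_w:
  assumes q: "q \<noteq> 0" "norm q < 1" and wz: "w \<noteq> 0" "z \<noteq> 0" and w: "Theta w q \<noteq> 0"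
  shows "appell_sum (q * w) z q = Theta z q - w / z * appell_sum w z q"
proof -
  have nz: "q powi (r - 1) * w \<noteq> 1" for r using w Theta_nonzero_iff_powi[OF q wz(1)] by blast
  have nz': "1 - q powi r * w \<noteq> 0" for r using nz[of "r + 1"] by simp
  let ?t = "\<lambda>r::int. (-1) powi r * q powi (r * (r - 1) div 2) * z powi r"
  have "appell_sum w z q = (\<Sum>\<^sub>\<infinity>r::int. ?t (r + 1) / (1 - q powi ((r + 1) - 1) * w))"
    unfolding appell_sum_def by (rule infsum_reindex_bij_betw[OF bij_int_shift, symmetric])
  also have "\<dots> = (\<Sum>\<^sub>\<infinity>r::int. - z / w * (?t r * (q powi r * w) / (1 - q powi r * w)))"
    unfolding binom2_Suc using q wz
    by (intro infsum_cong) (simp add: power_int_add divide_simps)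
  also have "\<dots> = - z / w * (\<Sum>\<^sub>\<infinity>r::int. ?t r * (q powi r * w) / (1 - q powi r * w))"
    by (rule infsum_cmult_right')
  finally have 1: "w / z * appell_sum w z q = - (\<Sum>\<^sub>\<infinity>r::int. ?t r * (q powi r * w) / (1 - q powi r * w))"
    using wz by (simp add: field_simps)
  have e: "q powi (r - 1) * (q * w) = q powi r * w" for r using q by (simp add: power_int_diff)
  have S: "(\<lambda>r. ?t r / (1 - q powi r * w)) summable_on UNIV"
    using summable_appell_terms[OF q, of "q * w" z UNIV] nz' q wz unfolding e by simp
  have T: "?t summable_on UNIV" by (rule summable_theta_series[OF q wz(2)])
  have "?t r * (q powi r * w) / (1 - q powi r * w) = ?t r / (1 - q powi r * w) + - ?t r" for r
    using nz'[of r] by (simp add: field_simps)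
  hence "(\<Sum>\<^sub>\<infinity>r::int. ?t r * (q powi r * w) / (1 - q powi r * w))
      = (\<Sum>\<^sub>\<infinity>r::int. ?t r / (1 - q powi r * w)) + (\<Sum>\<^sub>\<infinity>r::int. - ?t r)"
    by (subst infsum_add[symmetric]) (use S T in \<open>auto intro: summable_on_uminus[THEN iffD2]\<close>)
  also have "\<dots> = appell_sum (q * w) z q - Theta z q"
    unfolding jacobi_triple_product[OF q wz(2), symmetric] theta_series_def appell_sum_def e
    by (simp add: infsum_uminus)
  finally show ?thesis using 1 by simp
qed

text \<open>Here \<open>q powi r = q / w * (1 - (1 - q powi (r - 1) * w))\<close> cancels the denominator.\<close>

lemma appell_sum_step_z:
  assumes q: "q \<noteq> 0" "norm q < 1" and wz: "w \<noteq> 0" "z \<noteq> 0" and w: "Theta w q \<noteq> 0"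
  shows "appell_sum w (q * z) q = q / w * (appell_sum w z q - Theta z q)"
proof -
  have nz: "q powi (r - 1) * w \<noteq> 1" for r using w Theta_nonzero_iff_powi[OF q wz(1)] by blast
  let ?t = "\<lambda>r::int. (-1) powi r * q powi (r * (r - 1) div 2) * z powi r"
  have S: "(\<lambda>r. ?t r / (1 - q powi (r - 1) * w)) summable_on UNIV"
    by (rule summable_appell_terms[OF q wz]) (use nz in auto)
  have T: "?t summable_on UNIV" by (rule summable_theta_series[OF q wz(2)])
  have "(-1) powi r * q powi (r * (r - 1) div 2) * (q * z) powi r / (1 - q powi (r - 1) * w)
      = q / w * (?t r / (1 - q powi (r - 1) * w) + - ?t r)" for r
  proof -
    have e: "q powi r = q * q powi (r - 1)" using q by (simp add: power_int_diff)
    show ?thesis using nz[of r] q wz unfolding power_int_mult_distrib e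
      by (simp add: field_simps)
  qed
  hence "appell_sum w (q * z) q = q / w * (\<Sum>\<^sub>\<infinity>r::int. ?t r / (1 - q powi (r - 1) * w) + - ?t r)"
    unfolding appell_sum_def by (simp only: infsum_cmult_right')
  also have "(\<Sum>\<^sub>\<infinity>r::int. ?t r / (1 - q powi (r - 1) * w) + - ?t r)
      = (\<Sum>\<^sub>\<infinity>r::int. ?t r / (1 - q powi (r - 1) * w)) + (\<Sum>\<^sub>\<infinity>r::int. - ?t r)"
    by (rule infsum_add) (use S T in \<open>auto intro: summable_on_uminus[THEN iffD2]\<close>)
  also have "\<dots> = appell_sum w z q - Theta z q"
    unfolding jacobi_triple_product[OF q wz(2), symmetric] theta_series_def appell_sum_def
    by (simp add: infsum_uminus)
  finally show ?thesis .
qed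

lemma appell_sum_shift_both:
  assumes "q \<noteq> 0" "z \<noteq> 0"
  shows "appell_sum (q * w) (q * z) q = - appell_sum w z q / z"
proof -
  let ?t = "\<lambda>r::int. (-1) powi r * q powi (r * (r - 1) div 2) * z powi r"
  have "appell_sum w z q = (\<Sum>\<^sub>\<infinity>r::int. ?t (r + 1) / (1 - q powi ((r + 1) - 1) * w))"
    unfolding appell_sum_def by (rule infsum_reindex_bij_betw[OF bij_int_shift, symmetric])
  also have "\<dots> = (\<Sum>\<^sub>\<infinity>r::int. - z * ((-1) powi r * q powi (r * (r - 1) div 2) * (q * z) powi r / (1 - q powi (r - 1) * (q * w))))"
    unfolding binom2_Suc using assms
    by (intro infsum_cong) (simp add: power_int_add power_int_diff power_int_mult_distrib mult_ac)
  also have "\<dots> = - z * appell_sum (q * w) (q * z) q"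
    unfolding appell_sum_def by (rule infsum_cmult_right')
  finally show ?thesis using assms by simp
qed

text \<open>The zeros of the theta factor are the poles of the series.\<close>

lemma simple_pole_Theta_appell_sum:
  assumes q: "q \<noteq> 0" "norm q < 1" and z: "z \<noteq> 0" "v \<noteq> 0" and a: "a \<noteq> 0"
  shows "simple_pole (\<lambda>y. Theta (y * v) q * appell_sum (y * v) z q) a 0"
proof (cases "Theta (a * v) q = 0")
  case False
  show ?thesis using q z a False
    by (intro simple_pole_analytic analytic_intros analytic_appell_sum_compose) auto
next
  case True
  then obtain n where n: "a * v = q powi n" using Theta_eq_0_iff[OF q] a z by auto
  obtain \<rho> where "simple_pole (\<lambda>w. appell_sum w z q) (a * v) \<rho>"
    using simple_pole_appell_sum[OF q z(1), of "1 - n"] n by auto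
  hence "simple_pole (\<lambda>y. appell_sum (y * v) z q) a (\<rho> / v)"
    by (rule simple_pole_compose) (use z in \<open>auto intro!: analytic_intros derivative_eq_intros\<close>)
  hence "simple_pole (\<lambda>y. Theta (y * v) q * appell_sum (y * v) z q) a (Theta (a * v) q * (\<rho> / v))"
    by (intro simple_pole_mult[where h = "\<lambda>y. Theta (y * v) q"] analytic_intros) (use q z a in auto)
  thus ?thesis using True by simp
qed

section \<open>Reflection of the second argument\<close>

text \<open>Both sides satisfy the same inhomogeneous equation in \<open>w\<close>, so their difference has multiplier
\<open>1 / z\<close>. On the left the poles are cancelled by the theta factor; on the right \<open>w\<close> occurs as the
argument of a Laurent series with bounded denominators. Hence the difference vanishes.\<close>

lemma appell_sum_symmetry:
  assumes q: "q \<noteq> 0" "norm q < 1" and wz: "w \<noteq> 0" "z \<noteq> 0" and Th: "Theta w q \<noteq> 0" "Theta z q \<noteq> 0"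
  shows "Theta w q * appell_sum w z q = - w * Theta z q * appell_sum (1 / z) (1 / w) q"
proof -
  define H where "H w = Theta w q * appell_sum w z q + w * Theta z q * appell_sum (1 / z) (1 / w) q" for w
  have Thz: "Theta (1 / z) q \<noteq> 0" using Theta_inverse[OF q wz(2)] Th wz by simp
  have an: "(\<lambda>w. appell_sum (1 / z) (1 / w) q) analytic_on {a}" if "a \<noteq> 0" for a
  proof -
    have nz: "q powi (r - 1) * (1 / z) \<noteq> 1" for r using Thz Theta_nonzero_iff_powi[OF q, of "1 / z"] wz by simp
    obtain \<epsilon> \<delta> where ed: "\<epsilon> > 0" "\<delta> > 0" 
      "\<And>v r. v \<in> cball (1 / z) \<epsilon> \<Longrightarrow> r \<in> UNIV \<Longrightarrow> norm (1 - q powi (r - 1) * v) \<ge> \<delta>"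
      using geometric_away_from_1[OF q, of "1 / z" UNIV] nz wz by auto
    have "(\<lambda>x. \<Sum>\<^sub>\<infinity>r. ((-1) powi r / (1 - q powi (r - 1) * (1 / z))) * q powi (r * (r - 1) div 2) * x powi r) analytic_on -{0}"
    proof (rule analytic_theta_bounded[OF q])
      fix r :: int
      show "norm ((-1) powi r / (1 - q powi (r - 1) * (1 / z))) \<le> 1 / \<delta>"
        using ed(1,2) ed(3)[of "1 / z" r] by (auto simp: norm_divide intro!: divide_left_mono mult_pos_pos intro: less_le_trans)
    qed
    hence "(\<lambda>x. appell_sum (1 / z) x q) analytic_on -{0}"
      by (simp add: appell_sum_def)
    hence "(\<lambda>x. appell_sum (1 / z) x q) analytic_on (\<lambda>w. 1 / w) ` {a}"
      by (rule analytic_on_subset) (use that in auto)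
    moreover have "(\<lambda>w. 1 / w) analytic_on {a}" using that by (intro analytic_intros) auto
    ultimately show ?thesis using analytic_on_compose[of "\<lambda>w. 1 / w" "{a}" "\<lambda>x. appell_sum (1 / z) x q"] by (simp add: o_def)
  qed
  have "H w = 0"
  proof (rule removable_periodic_eq_0[OF q, where H = H and c = "1 / z"])
    show "1 / z \<noteq> 0" using wz by simp
    show "1 / z \<noteq> q powi n" for n
    proof
      assume "1 / z = q powi n"
      hence "z = q powi (-n)" using wz q by (simp add: power_int_minus field_simps)
      thus False using Th(2) Theta_eq_0_iff[OF q wz(2)] by blast
    qed
    fix a :: complex assume a: "a \<noteq> 0"
    have "simple_pole H a (0 + 0)"
      unfolding H_def[abs_def]
    proof (rule simple_pole_add)
      show "simple_pole (\<lambda>w. Theta w q * appell_sum w z q) a 0"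
        using simple_pole_Theta_appell_sum[OF q wz(2), of 1 a] a by simp
      show "simple_pole (\<lambda>w. w * Theta z q * appell_sum (1 / z) (1 / w) q) a 0"
        by (intro simple_pole_analytic analytic_intros an a)
    qed
    hence "simple_pole H (q powi 0 * a) 0" by simp
    thus "\<exists>n. simple_pole H (q powi n * a) 0" by blast
    show "\<forall>\<^sub>F x in at a. H (q * x) = 1 / z * H x"
      using eventually_at_nonzero[OF a] eventually_Theta_nonzero[OF q a]
    proof eventually_elim
      case (elim x)
      have T1: "Theta (q * x) q = - Theta x q / x" by (rule Theta_step[OF q elim(1)])
      have L: "appell_sum (q * x) z q = Theta z q - x / z * appell_sum x z q"
        by (rule appell_sum_step_w[OF q elim(1) wz(2) elim(2)])
      define v where "v = 1 / (q * x)"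
      have v: "v \<noteq> 0" "q * v = 1 / x" using elim q by (auto simp: v_def)
      have "Theta v q = - Theta (q * x) q / (q * x)"
        unfolding v_def using q elim by (intro Theta_inverse) auto
      hence Tv: "Theta v q = Theta x q / (q * x ^ 2)" using T1 elim by (simp add: power2_eq_square)
      have "appell_sum (1 / z) (q * v) q = q / (1 / z) * (appell_sum (1 / z) v q - Theta v q)"
        using Thz wz v by (intro appell_sum_step_z[OF q]) auto
      hence G: "appell_sum (1 / z) v q = appell_sum (1 / z) (1 / x) q / (q * z) + Theta x q / (q * x ^ 2)"
        using q wz unfolding v(2) Tv by (simp add: field_simps)
      show ?case unfolding H_def T1 L v_def[symmetric] G using q elim(1) wz
        by (simp add: field_simps power2_eq_square)
    qed
  next
    show "w \<noteq> 0" by fact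
    have "H analytic_on {w}" unfolding H_def using wz Th q
      by (intro analytic_intros an analytic_appell_sum_compose) auto
    thus "isCont H w" by (rule analytic_at_imp_isCont)
  qed
  thus ?thesis by (simp add: H_def eq_neg_iff_add_eq_0)
qed

lemma appell_m_reflect:
  assumes q: "q \<noteq> 0" "norm q < 1" and xz: "x \<noteq> 0" "z \<noteq> 0" and Th: "Theta (x * z) q \<noteq> 0" "Theta z q \<noteq> 0"
  shows "appell_m x (1 / (x * z)) q = appell_m x z q"
proof -
  have T: "Theta (1 / (x * z)) q = - Theta (x * z) q / (x * z)" using Theta_inverse[OF q, of "x * z"] xz by simp
  have e: "x * (1 / (x * z)) = 1 / z" using xz by simp
  show ?thesis
    using appell_sum_symmetry[OF q _ xz(2) Th] xz Th unfolding appell_m_eq_sum e T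
    by (simp add: divide_simps) (simp add: mult_ac)
qed

text \<open>Numerator and denominator change by the same factor.\<close>

lemma appell_m_shift:
  assumes q: "q \<noteq> 0" "norm q < 1" and z: "z \<noteq> 0"
  shows "appell_m x (q * z) q = appell_m x z q"
  using appell_sum_shift_both[OF q(1) z, of "x * z"] Theta_step[OF q z] z
  by (simp add: appell_m_eq_sum mult_ac)

section \<open>Expansion of D3 into theta quotients\<close>

lemma Theta_nonzero_base9:
  assumes q: "q \<noteq> 0" "norm q < 1" and w: "w \<noteq> 0" "Theta w (q ^ 3) \<noteq> 0"
  shows "Theta (q powi (3 * k) * w) (q ^ 9) \<noteq> 0"
proof
  assume "Theta (q powi (3 * k) * w) (q ^ 9) = 0"
  then obtain n where n: "q powi (3 * k) * w = (q ^ 9) powi n"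
    using Theta_eq_0_iff[of "q ^ 9" "q powi (3 * k) * w"] norm_power_lt_1[OF q(2), of 9] q w by auto
  have "(q ^ 9) powi n = q powi (3 * (3 * n))" by (simp add: power_int_power)
  hence "w = q powi (3 * (3 * n - k))" using n q by (simp add: power_int_diff right_diff_distrib field_simps)
  also have "\<dots> = (q ^ 3) powi (3 * n - k)" by (simp add: power_int_power)
  finally show False using w Theta_eq_0_iff[of "q ^ 3" w] norm_power_lt_1[OF q(2), of 3] q by auto
qed

lemma Theta_nonzero_base3:
  assumes q: "q \<noteq> 0" "norm q < 1" and z: "z \<noteq> 0" "Theta z q \<noteq> 0"
  shows "Theta (q ^ k * z) (q ^ 3) \<noteq> 0"
proof
  assume "Theta (q ^ k * z) (q ^ 3) = 0"
  then obtain n where n: "q ^ k * z = (q ^ 3) powi n"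
    using Theta_eq_0_iff[of "q ^ 3" "q ^ k * z"] norm_power_lt_1[OF q(2), of 3] q z by auto
  have "(q ^ 3) powi n = q powi (3 * n)" by (simp add: power_int_power)
  hence "z = q powi (3 * n - int k)" using n q by (simp add: power_int_diff field_simps)
  thus False using z Theta_eq_0_iff[OF q z(1)] by blast
qed

text \<open>In the proof, \<open>y\<close> is the running first argument, \<open>M\<close> the leading Appell function, \<open>S\<close> the combination subtracted from it,
and \<open>T\<close> the sum of three terms on the right. Both \<open>M\<close> and \<open>S\<close> satisfy \<open>f (q y) = 1 - y f y\<close>.
Multiplied by \<open>Theta (y z) q\<close>, the difference of the two sides has multiplier \<open>1 / z\<close>. The theta
factor removes the poles of \<open>M\<close>. The poles of \<open>S\<close> and of the right side form the orbits of the
three points with \<open>z' y ^ 3 = 1\<close>; there the residues agree by the splitting of \<open>Theta (y z) q\<close>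
modulo \<open>3\<close>.\<close>

lemma D3_formula:
  assumes q: "q \<noteq> 0" "norm q < 1" and nz: "x \<noteq> 0" "z \<noteq> 0" "z' \<noteq> 0"
    and Th: "Theta z q \<noteq> 0" "Theta (x * z) q \<noteq> 0" "Theta z' (q ^ 9) \<noteq> 0" "Theta (x ^ 3 * z') (q ^ 3) \<noteq> 0"
  shows "D3 x z z' q = z' * qpoch_inf (q ^ 3) (q ^ 3) ^ 3 /
      (z * Theta (x * z) q * Theta z' (q ^ 9) * Theta (x ^ 3 * z') (q ^ 3)) *
      (Theta (x ^ 3 * z * z') (q ^ 3) * Theta (z ^ 3 / z') (q ^ 9) / Theta z (q ^ 3)
       - x * z / q * Theta (q * x ^ 3 * z * z') (q ^ 3) * Theta (q ^ 3 * z ^ 3 / z') (q ^ 9) / Theta (q * z) (q ^ 3)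
       + x ^ 2 * z ^ 2 / q * Theta (q ^ 2 * x ^ 3 * z * z') (q ^ 3) * Theta (q ^ 6 * z ^ 3 / z') (q ^ 9) / Theta (q ^ 2 * z) (q ^ 3))"
proof -
  have q3: "q ^ 3 \<noteq> 0" "norm (q ^ 3) < 1" and q9: "q ^ 9 \<noteq> 0" "norm (q ^ 9) < 1"
    using q norm_power_lt_1 by auto
  define J where "J = qpoch_inf (q ^ 3) (q ^ 3)"
  have J: "J \<noteq> 0" using qpoch_inf_base_nonzero[OF q3(2)] by (simp add: J_def)
  define P where "P = Theta z' (q ^ 9)"
  define \<rho>0 \<rho>1 \<rho>2 where "\<rho>0 = Theta (z ^ 3 / z') (q ^ 9) / Theta z (q ^ 3)"
    and "\<rho>1 = - (z / q * Theta (q ^ 3 * z ^ 3 / z') (q ^ 9) / Theta (q * z) (q ^ 3))"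
    and "\<rho>2 = z ^ 2 / q * Theta (q ^ 6 * z ^ 3 / z') (q ^ 9) / Theta (q ^ 2 * z) (q ^ 3)"
  define T where "T y = \<rho>0 * Theta (z * z' * y ^ 3) (q ^ 3) + \<rho>1 * y * Theta (q * z * z' * y ^ 3) (q ^ 3)
      + \<rho>2 * y ^ 2 * Theta (q ^ 2 * z * z' * y ^ 3) (q ^ 3)" for y
  define C where "C = z' * J ^ 3 / (z * P)"
  define M where "M y = appell_sum (y * z) z q / Theta z q" for y
  define L where "L k y = appell_sum (q powi (3 * k) * (z' * y ^ 3)) z' (q ^ 9)" for k y
  define S where "S y = (L 1 y - y / q * L 0 y + y ^ 2 / q ^ 3 * L (-1) y) / P" for y
  have D3: "D3 y z z' q = M y - S y" for y
    unfolding D3_def appell_m_eq_sum M_def S_def L_def P_def using q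
    by (simp add: power_int_minus divide_inverse algebra_simps)
  define H where "H y = Theta (y * z) q * M y + (- Theta (y * z) q * S y + - C * T y * (1 / Theta (z' * y ^ 3) (q ^ 3)))" for y
  have Pnz: "P \<noteq> 0" using Th by (simp add: P_def)
  have anL: "L k analytic_on {a}" if "a \<noteq> 0" "Theta (q powi (3 * k) * (z' * a ^ 3)) (q ^ 9) \<noteq> 0" for a k
    unfolding L_def[abs_def] using that nz q q9
    by (intro analytic_appell_sum_compose analytic_intros) auto
  have anTh: "(\<lambda>y. Theta (y * z) q) analytic_on {a}" if "a \<noteq> 0" for a
    by (intro analytic_intros) (use that nz q in auto)
  have anT: "T analytic_on {a}" if "a \<noteq> 0" for a
    unfolding T_def[abs_def] by (intro analytic_intros) (use that nz q q3 in auto)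
  have anE: "(\<lambda>y. Theta (z' * y ^ 3) (q ^ 3)) analytic_on {a}" if "a \<noteq> 0" for a
    by (intro analytic_intros) (use that nz q3 in auto)
  have poleM: "simple_pole (\<lambda>y. Theta (y * z) q * M y) a 0" if "a \<noteq> 0" for a
  proof -
    have "simple_pole (\<lambda>y. 1 / Theta z q * (Theta (y * z) q * appell_sum (y * z) z q)) a (1 / Theta z q * 0)"
      by (intro simple_pole_mult[where h = "\<lambda>_. 1 / Theta z q"] simple_pole_Theta_appell_sum analytic_intros)
         (use that nz q in auto)
    thus ?thesis unfolding M_def by (rule simple_pole_cong) simp_all
  qed
  have anH: "H analytic_on {a}" if "a \<noteq> 0" "Theta (a * z) q \<noteq> 0" "Theta (z' * a ^ 3) (q ^ 3) \<noteq> 0" for a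
  proof -
    have "L k analytic_on {a}" for k
      using that nz by (intro anL Theta_nonzero_base9[OF q]) auto
    moreover have "M analytic_on {a}" unfolding M_def[abs_def] using that nz q Th
      by (intro analytic_intros analytic_appell_sum_compose) auto
    ultimately show ?thesis unfolding H_def[abs_def] S_def
      using that by (intro analytic_intros anTh anT anE) (use q Pnz in auto)
  qed
  have "H x = 0"
  proof (rule removable_periodic_eq_0[OF q, where H = H and c = "1 / z"])
    show "1 / z \<noteq> 0" using nz by simp
    show "1 / z \<noteq> q powi n" for n
    proof
      assume "1 / z = q powi n"
      hence "z = q powi (-n)" using nz q by (simp add: power_int_minus field_simps)
      thus False using Th(1) Theta_eq_0_iff[OF q nz(2)] by blast
    qed
    show "isCont H x" by (rule analytic_at_imp_isCont, rule anH) (use Th nz in \<open>simp_all add: mult.commute\<close>)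
    show "x \<noteq> 0" by fact
    fix a :: complex assume a: "a \<noteq> 0"
    show "\<forall>\<^sub>F y in at a. H (q * y) = 1 / z * H y"
    proof -
      have az: "a * z \<noteq> 0" "z' * a ^ 3 \<noteq> 0" using a nz by auto
      have "filterlim (\<lambda>y. z * y) (at (z * a)) (at a)" using nz by (intro filterlim_mult_at)
      from eventually_compose_filterlim[OF eventually_Theta_nonzero[OF q, of "z * a"] this]
      have e1: "\<forall>\<^sub>F y in at a. Theta (y * z) q \<noteq> 0" using az by (simp add: mult.commute)
      have "filterlim (\<lambda>y. z' * y ^ 3) (at (z' * a ^ 3)) (at a)"
        by (rule filterlim_at_analytic[where d = "z' * (3 * a ^ 2)"])
           (use a nz in \<open>auto intro!: analytic_intros derivative_eq_intros\<close>)
      from eventually_compose_filterlim[OF eventually_Theta_nonzero[OF q3 az(2)] this]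
      have e2: "\<forall>\<^sub>F y in at a. Theta (z' * y ^ 3) (q ^ 3) \<noteq> 0" .
      show ?thesis using eventually_at_nonzero[OF a] e1 e2
      proof eventually_elim
        case (elim y)
        define w where "w = z' * y ^ 3"
        have w0: "w \<noteq> 0" using elim nz by (simp add: w_def)
        have L1: "L k (q * y) = L (k + 1) y" for k
          unfolding L_def using q by (simp add: power_int_add power_mult_distrib mult_ac distrib_left)
        have L2: "L 2 y = P - w / (q ^ 3 * z') * L (-1) y"
        proof -
          have e: "q powi (3 * 2) * w = q ^ 9 * (q powi (3 * (-1)) * w)" using q
            by (simp add: power_int_minus field_simps)
          have "appell_sum (q ^ 9 * (q powi (3 * (-1)) * w)) z' (q ^ 9) = P - (q powi (3 * (-1)) * w) / z' * appell_sum (q powi (3 * (-1)) * w) z' (q ^ 9)"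
            unfolding P_def by (rule appell_sum_step_w[OF q9]) (use Theta_nonzero_base9[OF q w0, of "-1"] elim nz w0 q in \<open>auto simp: w_def\<close>)
          thus ?thesis unfolding L_def w_def[symmetric] e using q by (simp add: power_int_minus field_simps)
        qed
        have Sq: "S (q * y) = 1 - y * S y"
          unfolding S_def L1 using q elim nz Pnz
          by (simp add: L2 w_def field_simps power2_eq_square power3_eq_cube)
        have "appell_sum (q * (y * z)) z q = Theta z q - (y * z) / z * appell_sum (y * z) z q"
          by (rule appell_sum_step_w[OF q]) (use elim nz in auto)
        hence Mq: "M (q * y) = 1 - y * M y" unfolding M_def using nz Th by (simp add: field_simps)
        have T1: "Theta (q * y * z) q = - Theta (y * z) q / (y * z)"
          using Theta_step[OF q, of "y * z"] elim nz by (simp add: mult_ac)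
        have step3: "Theta (c * (q * y) ^ 3) (q ^ 3) = - Theta (c * y ^ 3) (q ^ 3) / (c * y ^ 3)" if "c \<noteq> 0" for c
        proof -
          have e: "c * (q * y) ^ 3 = q ^ 3 * (c * y ^ 3)" by (simp add: power_mult_distrib)
          show ?thesis unfolding e by (rule Theta_step[OF q3]) (use elim that in simp)
        qed
        have Tq: "T (q * y) = - T y / (z * z' * y ^ 3)"
          unfolding T_def using q nz elim(1) by (simp add: step3) (simp add: field_simps power2_eq_square)
        have Eq: "Theta (z' * (q * y) ^ 3) (q ^ 3) = - Theta (z' * y ^ 3) (q ^ 3) / (z' * y ^ 3)"
          using step3[OF nz(3)] .
        show ?case unfolding H_def T1 Mq Sq Tq Eq using elim nz by (simp add: field_simps)
      qed
    qed
    show "\<exists>n. simple_pole H (q powi n * a) 0"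
    proof (cases "Theta (z' * a ^ 3) (q ^ 3) = 0")
      case False
      have "simple_pole H a (0 + 0)" unfolding H_def[abs_def] S_def
      proof (rule simple_pole_add[OF poleM[OF a]], rule simple_pole_analytic)
        have "L k analytic_on {a}" for k
          using a nz False by (intro anL Theta_nonzero_base9[OF q]) auto
        thus "(\<lambda>y. - Theta (y * z) q * ((L 1 y - y / q * L 0 y + y\<^sup>2 / q ^ 3 * L (- 1) y) / P) +
             - C * T y * (1 / Theta (z' * y ^ 3) (q ^ 3))) analytic_on {a}"
          using False a by (intro analytic_intros anTh anT anE) (use q Pnz in auto)
      qed
      hence "simple_pole H (q powi 0 * a) 0" by simp
      thus ?thesis by blast
    next
      case True
      then obtain n where n: "z' * a ^ 3 = (q ^ 3) powi n" using Theta_eq_0_iff[OF q3, of "z' * a ^ 3"] a nz by auto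
      \<comment> \<open>the point of the orbit with \<open>z' b ^ 3 = 1\<close>, where only \<open>L 0\<close> is singular\<close>
      define b where "b = q powi (-n) * a"
      have b: "b \<noteq> 0" "z' * b ^ 3 = 1"
      proof -
        show "b \<noteq> 0" using a q by (simp add: b_def)
        have "(q powi (-n)) ^ 3 = (q powi (-n)) powi (int 3)" by (simp only: power_int_of_nat)
        also have "\<dots> = q powi (-n * int 3)" by (rule power_int_mult[symmetric])
        also have "\<dots> = (q ^ 3) powi (-n)" by (simp add: power_int_power mult.commute)
        finally have "(q powi (-n)) ^ 3 = (q ^ 3) powi (-n)" .
        hence "z' * b ^ 3 = (q ^ 3) powi (-n) * (q ^ 3) powi n"
          using n by (simp add: b_def power_mult_distrib mult_ac)
        thus "z' * b ^ 3 = 1" using q by (simp add: power_int_minus)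
      qed
      have deriv: "((\<lambda>y. z' * y ^ 3) has_field_derivative 3 / b) (at b)"
      proof -
        have "((\<lambda>y. z' * y ^ 3) has_field_derivative z' * (3 * b ^ 2)) (at b)"
          by (auto intro!: derivative_eq_intros)
        moreover have "z' * (3 * b ^ 2) = 3 / b" using b by (simp add: field_simps power2_eq_square power3_eq_cube)
        ultimately show ?thesis by simp
      qed
      have an: "(\<lambda>y. z' * y ^ 3) analytic_on {b}" by (intro analytic_intros)
      have "simple_pole (\<lambda>w. appell_sum w z' (q ^ 9)) 1 z'"
        using simple_pole_appell_sum[OF q9 nz(3), of 1] by simp
      hence "simple_pole (\<lambda>y. appell_sum (z' * y ^ 3) z' (q ^ 9)) b (z' / (3 / b))"
        using b deriv by (intro simple_pole_compose[where h = "\<lambda>y. z' * y ^ 3"] an) auto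
      hence pL0: "simple_pole (L 0) b (z' * b / 3)" unfolding L_def[abs_def] by simp
      have Lreg: "L k analytic_on {b}" if "k = 1 \<or> k = -1" for k
      proof (rule anL[OF b(1)])
        show "Theta (q powi (3 * k) * (z' * b ^ 3)) (q ^ 9) \<noteq> 0"
        proof
          assume "Theta (q powi (3 * k) * (z' * b ^ 3)) (q ^ 9) = 0"
          then obtain m where "q powi (3 * k) = (q ^ 9) powi m" 
            using Theta_eq_0_iff[OF q9, of "q powi (3 * k)"] b q by auto
          hence "q powi (3 * k) = q powi (9 * m)" by (simp add: power_int_power)
          hence "q powi (3 * k - 9 * m) = 1" using q by (simp add: power_int_diff)
          hence "3 * k - 9 * m = 0" using powi_eq_1_iff[OF q] by simp
          with that show False by presburger
        qed
      qed
      have pole1: "simple_pole (\<lambda>y. - Theta (y * z) q * S y) b (Theta (b * z) q * b ^ 2 * z' / (3 * q * P))"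
      proof -
        have "simple_pole (\<lambda>y. - Theta (y * z) q * (L 1 y + y ^ 2 / q ^ 3 * L (-1) y) / P
                + Theta (y * z) q * (y / q) / P * L 0 y) b (0 + Theta (b * z) q * (b / q) / P * (z' * b / 3))"
          using b by (intro simple_pole_add simple_pole_analytic simple_pole_mult[where h = "\<lambda>y. Theta (y * z) q * (y / q) / P"] 
             analytic_intros anTh Lreg pL0) (use q Pnz in auto)
        thus ?thesis
          by (rule simple_pole_cong) (use Pnz q in \<open>auto simp: S_def field_simps power2_eq_square\<close>)
      qed
      have pole2: "simple_pole (\<lambda>y. - C * T y * (1 / Theta (z' * y ^ 3) (q ^ 3))) b (C * T b * b / (3 * J ^ 3))"
      proof -
        have "((\<lambda>x. Theta x (q ^ 3)) has_field_derivative - (J ^ 3)) (at (z' * b ^ 3))"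
          using Theta_deriv_1[OF q3] b by (simp add: J_def)
        from DERIV_chain2[where g = "\<lambda>y. z' * y ^ 3", OF this deriv]
        have d: "((\<lambda>y. Theta (z' * y ^ 3) (q ^ 3)) has_field_derivative - (J ^ 3) * (3 / b)) (at b)" .
        have "Theta 1 (q ^ 3) = 0" using Theta_eq_0_iff[OF q3, of 1] by (auto intro: exI[of _ 0])
        hence "simple_pole (\<lambda>y. 1 / Theta (z' * y ^ 3) (q ^ 3)) b (1 / (- (J ^ 3) * (3 / b)))"
          using d b J by (intro simple_pole_inverse anE) auto
        hence "simple_pole (\<lambda>y. - C * T y * (1 / Theta (z' * y ^ 3) (q ^ 3))) b (- C * T b * (1 / (- (J ^ 3) * (3 / b))))"
          using b by (intro simple_pole_mult[where h = "\<lambda>y. - C * T y"] analytic_intros anT) auto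
        thus ?thesis by (rule simple_pole_cong) (use b J in auto)
      qed
      define t where "t = b * z"
      have t0: "t \<noteq> 0" using b nz by (simp add: t_def)
      \<comment> \<open>the splitting modulo \<open>3\<close>, read backwards at \<open>t = b z\<close>\<close>
      have Tb: "T b = - (t / q) * Theta t q"
      proof -
        have zi: "1 / z' = b ^ 3" using b(2) nz by (simp add: field_simps)
        have "c * z ^ 3 / z' = c * t ^ 3" for c
        proof -
          have "c * z ^ 3 / z' = c * z ^ 3 * (1 / z')" by simp
          thus ?thesis unfolding zi by (simp add: t_def power_mult_distrib mult_ac)
        qed
        from this[of 1] this[of "q ^ 3"] this[of "q ^ 6"]
        have zz: "z ^ 3 / z' = t ^ 3" "q ^ 3 * z ^ 3 / z' = q ^ 3 * t ^ 3" "q ^ 6 * z ^ 3 / z' = q ^ 6 * t ^ 3" by simp_all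
        have e: "z * z' * b ^ 3 = z" "q * z * z' * b ^ 3 = q * z" "q ^ 2 * z * z' * b ^ 3 = q ^ 2 * z"
          using b(2) by (simp_all add: mult.assoc)
        have n: "Theta z (q ^ 3) \<noteq> 0" "Theta (q * z) (q ^ 3) \<noteq> 0" "Theta (q ^ 2 * z) (q ^ 3) \<noteq> 0"
          using Theta_nonzero_base3[OF q nz(2) Th(1), of 0] Theta_nonzero_base3[OF q nz(2) Th(1), of 1]
                Theta_nonzero_base3[OF q nz(2) Th(1), of 2] by simp_all
        have "T b = Theta (t ^ 3) (q ^ 9) - t / q * Theta (q ^ 3 * t ^ 3) (q ^ 9) + t ^ 2 / q * Theta (q ^ 6 * t ^ 3) (q ^ 9)"
          unfolding T_def e \<rho>0_def \<rho>1_def \<rho>2_def zz using n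
          by (simp add: t_def power2_eq_square mult_ac)
        also have "\<dots> = - (t / q) * Theta t q"
        proof -
          have "t ^ 3 * Theta (q ^ 9 * t ^ 3) (q ^ 9) = - Theta (t ^ 3) (q ^ 9)"
            using Theta_step[OF q9, of "t ^ 3"] t0 by simp
          hence "Theta (t ^ 3) (q ^ 9) * q - t * Theta (q ^ 3 * t ^ 3) (q ^ 9) + t ^ 2 * Theta (q ^ 6 * t ^ 3) (q ^ 9)
              = - t * Theta t q"
            using Theta_mod3[OF q t0] by algebra
          thus ?thesis using q by (simp add: divide_simps)
        qed
        finally show ?thesis .
      qed
      have "simple_pole H b (0 + (Theta (b * z) q * b ^ 2 * z' / (3 * q * P) + C * T b * b / (3 * J ^ 3)))"
        unfolding H_def[abs_def] by (intro simple_pole_add poleM pole1 pole2 b(1))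
      moreover have "Theta (b * z) q * b ^ 2 * z' / (3 * q * P) + C * T b * b / (3 * J ^ 3) = 0"
        unfolding Tb C_def t_def using J nz q Pnz by (simp add: field_simps power2_eq_square)
      ultimately have "simple_pole H b 0" by simp
      thus ?thesis unfolding b_def by blast
    qed
  qed
  hence "Theta (x * z) q * D3 x z z' q = C * T x / Theta (z' * x ^ 3) (q ^ 3)"
    unfolding H_def D3 by (simp add: algebra_simps)
  hence "D3 x z z' q = C / (Theta (x * z) q * Theta (x ^ 3 * z') (q ^ 3)) * T x"
    using Th(2) Th(4)[unfolded mult.commute[of "x ^ 3"]]
    by (simp add: mult.commute[of "x ^ 3"] divide_simps) (simp add: mult_ac)
  thus ?thesis unfolding C_def T_def P_def J_def \<rho>0_def \<rho>1_def \<rho>2_def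
    by (simp add: mult_ac) 
qed

section \<open>Theta functions with prescribed zeros\<close>

lemma theta_like_factor:
  assumes q: "q \<noteq> 0" "norm q < 1" and "theta_like n A q f"
    and "\<And>a. a \<in> set as \<Longrightarrow> a \<noteq> 0 \<and> f a = 0" and "sorted_wrt (\<lambda>a b. Theta (b / a) q \<noteq> 0) as"
  shows "\<exists>g. theta_like (n - int (length as)) (A * (\<Prod>a\<leftarrow>as. - (1 / a))) q g \<and>
             (\<forall>x. x \<noteq> 0 \<longrightarrow> f x = (\<Prod>a\<leftarrow>as. Theta (x / a) q) * g x)"
  using assms(3-)
proof (induction as arbitrary: f n A)
  case (Cons a as)
  obtain g where g: "theta_like (n - 1) (- A / a) q g" "\<And>x. x \<noteq> 0 \<Longrightarrow> f x = Theta (x / a) q * g x"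
    using theta_like_divide[OF q Cons.prems(1), of a] Cons.prems(2) by auto
  have "b \<noteq> 0 \<and> g b = 0" if "b \<in> set as" for b
    using Cons.prems(2)[of b] Cons.prems(3) g(2)[of b] that by auto
  from Cons.IH[OF g(1) this] Cons.prems(3) obtain h where h:
    "theta_like (n - 1 - int (length as)) (- A / a * (\<Prod>a\<leftarrow>as. - (1 / a))) q h"
    "\<And>x. x \<noteq> 0 \<Longrightarrow> g x = (\<Prod>a\<leftarrow>as. Theta (x / a) q) * h x" by auto
  have e: "- A / a * (\<Prod>a\<leftarrow>as. - (1 / a)) = A * (\<Prod>a\<leftarrow>a # as. - (1 / a))" by simp
  show ?case using h(1)[unfolded e] h(2) g(2)
    by (intro exI[of _ h]) (auto simp: mult.assoc algebra_simps)
qed auto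

text \<open>The multiplier left over after dividing by all zeros is \<open>1\<close>, so what remains is a
constant.\<close>

lemma theta_like_factorization:
  assumes q: "q \<noteq> 0" "norm q < 1" and f: "theta_like (int (length as)) A q f"
    and "\<And>a. a \<in> set as \<Longrightarrow> a \<noteq> 0 \<and> f a = 0" and "sorted_wrt (\<lambda>a b. Theta (b / a) q \<noteq> 0) as"
    and A: "A * (\<Prod>a\<leftarrow>as. - (1 / a)) = 1"
  obtains c where "\<And>x. x \<noteq> 0 \<Longrightarrow> f x = c * (\<Prod>a\<leftarrow>as. Theta (x / a) q)"
proof -
  obtain g where g: "theta_like 0 1 q g" "\<And>x. x \<noteq> 0 \<Longrightarrow> f x = (\<Prod>a\<leftarrow>as. Theta (x / a) q) * g x"
    using theta_like_factor[OF q f assms(4,5)] A by auto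
  have "g (q * x) = 1 * g x" if "x \<noteq> 0" for x using g(1) that by (simp add: theta_like_def)
  then obtain b and k :: int where "\<And>x. x \<noteq> 0 \<Longrightarrow> g x = b * x powi k" "b = 0 \<or> 1 = q powi k"
    using multiplicatively_periodic[OF q, of g 1] g(1) unfolding theta_like_def by blast
  hence "\<And>x. x \<noteq> 0 \<Longrightarrow> g x = b" using powi_eq_1_iff[OF q, of k] by auto
  with g(2) show ?thesis using that[of b] by auto
qed

lemma theta_like_I:
  assumes "f holomorphic_on -{0}" "A \<noteq> 0" "\<And>x. x \<noteq> 0 \<Longrightarrow> f (q * x) = A / x ^ n * f x"
  shows "theta_like (int n) A q f"
  unfolding theta_like_def using assms by (auto simp: power_int_minus field_simps)

lemma holomorphic_Theta_compose:
  assumes "norm q < 1" "f holomorphic_on A" "\<And>x. x \<in> A \<Longrightarrow> f x \<noteq> 0"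
  shows "(\<lambda>x. Theta (f x) q) holomorphic_on A"
proof -
  have "f ` A \<subseteq> -{0}" using assms(3) by auto
  from holomorphic_on_compose_gen[OF assms(2) holomorphic_on_Theta[OF assms(1)] this]
  show ?thesis by (simp add: o_def)
qed

lemma power_diff_ne:
  fixes q :: complex
  assumes q: "q \<noteq> 0" "norm q < 1" and "\<not> int k dvd m"
  shows "q powi m \<noteq> (q ^ k) powi n"
proof
  assume "q powi m = (q ^ k) powi n"
  hence "q powi (m - int k * n) = 1" using q by (simp add: power_int_power power_int_diff)
  hence "m = int k * n" using powi_eq_1_iff[OF q] by simp
  with assms(3) show False by simp
qed

lemma Theta_powi_nonzero:
  assumes q: "q \<noteq> 0" "norm q < 1" and "k > 0" "\<not> int k dvd m"
  shows "Theta (q powi m) (q ^ k) \<noteq> 0"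
  using Theta_eq_0_iff[of "q ^ k" "q powi m"] norm_power_lt_1[OF q(2) assms(3)] power_diff_ne[OF q assms(4)] q by auto

lemma Theta_neg_powi_nonzero:
  assumes q: "q \<noteq> 0" "norm q < 1" and "k > 0"
  shows "Theta (- (q powi m)) (q ^ k) \<noteq> 0"
proof
  assume "Theta (- (q powi m)) (q ^ k) = 0"
  then obtain n where "- (q powi m) = (q ^ k) powi n"
    using Theta_eq_0_iff[of "q ^ k" "- (q powi m)"] norm_power_lt_1[OF q(2) assms(3)] q by auto
  hence "q powi (int k * n - m) = -1" using q by (simp add: power_int_power power_int_diff field_simps)
  thus False using neg_one_neq_powi[OF q] by blast
qed

section \<open>Changes of base and special values\<close>

lemma Theta_mult_neg:
  assumes q: "q \<noteq> 0" "norm q < 1" and x: "x \<noteq> 0"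
  shows "Theta x q * Theta (- x) q * qpoch_inf (q ^ 2) (q ^ 2) = Theta (x ^ 2) (q ^ 2) * qpoch_inf q q ^ 2"
proof -
  have "q ^ 2 / x ^ 2 = (q / x) ^ 2" by (simp add: power_divide)
  moreover have "q / - x = - (q / x)" by simp
  ultimately show ?thesis
    unfolding Theta_def using qpoch_inf_square[OF q(2), of x] qpoch_inf_square[OF q(2), of "q / x"]
    by (simp add: power2_eq_square mult_ac)
qed

lemma Theta_split2:
  assumes q: "q \<noteq> 0" "norm q < 1" and x: "x \<noteq> 0"
  shows "Theta x q * qpoch_inf (q ^ 2) (q ^ 2) ^ 2 = Theta x (q ^ 2) * Theta (q * x) (q ^ 2) * qpoch_inf q q"
proof -
  have "q * (q / x) = q ^ 2 / x" "q ^ 2 / (q * x) = q / x" using q x by (simp_all add: power2_eq_square)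
  thus ?thesis
    unfolding Theta_def using qpoch_inf_split2[OF q(2), of x] qpoch_inf_split2[OF q(2), of "q / x"]
    by (simp add: power2_eq_square mult_ac)
qed

lemma Theta_split3:
  assumes q: "q \<noteq> 0" "norm q < 1" and x: "x \<noteq> 0"
  shows "Theta x q * qpoch_inf (q ^ 3) (q ^ 3) ^ 3
       = Theta x (q ^ 3) * Theta (q * x) (q ^ 3) * Theta (q ^ 2 * x) (q ^ 3) * qpoch_inf q q"
proof -
  have e: "q * (q / x) = q ^ 2 / x" "q ^ 2 * (q / x) = q ^ 3 / x" "q ^ 3 / (q * x) = q ^ 2 / x" "q ^ 3 / (q ^ 2 * x) = q / x"
    using q x by (simp_all add: power2_eq_square power3_eq_cube)
  show ?thesis
    unfolding Theta_def qpoch_inf_split3[OF q(2), of x] qpoch_inf_split3[OF q(2), of "q / x"] e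
      power3_eq_cube[of "qpoch_inf (q ^ 3) (q ^ 3)"]
    by (simp only: mult_ac)
qed

lemma qpoch_half:
  assumes q: "norm q < 1"
  shows "qpoch_inf q (q ^ 2) * qpoch_inf (q ^ 2) (q ^ 2) = qpoch_inf q q"
  using qpoch_inf_split2[OF q, of q] by (simp add: power2_eq_square)

lemma qpoch_neg:
  assumes q: "norm q < 1"
  shows "qpoch_inf q q * qpoch_inf (- q) q = qpoch_inf (q ^ 2) (q ^ 2)"
  using qpoch_inf_square[OF q, of q] by simp

lemma Theta_base2:
  assumes q: "q \<noteq> 0" "norm q < 1"
  shows "Theta q (q ^ 2) * qpoch_inf (q ^ 2) (q ^ 2) = qpoch_inf q q ^ 2"
proof -
  have "q ^ 2 / q = q" using q by (simp add: power2_eq_square)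
  thus ?thesis unfolding Theta_def qpoch_half[OF q(2), symmetric] by (simp add: power2_eq_square)
qed

lemma Theta_neg_1:
  assumes q: "q \<noteq> 0" "norm q < 1"
  shows "Theta (-1) q * qpoch_inf q q = 2 * qpoch_inf (q ^ 2) (q ^ 2) ^ 2"
  unfolding qpoch_neg[OF q(2), symmetric] using q by (simp add: Theta_alt power2_eq_square)

lemma Theta_neg_base3:
  assumes q: "q \<noteq> 0" "norm q < 1"
  shows "Theta (- q) (q ^ 3) * qpoch_inf (q ^ 6) (q ^ 6) * qpoch_inf q q = qpoch_inf (q ^ 2) (q ^ 2) * qpoch_inf (q ^ 3) (q ^ 3) ^ 2"
proof -
  have "q ^ 3 / - q = - (q ^ 2)" using q by (simp add: power2_eq_square power3_eq_cube)
  hence T: "Theta (- q) (q ^ 3) = qpoch_inf (- q) (q ^ 3) * qpoch_inf (- (q ^ 2)) (q ^ 3) * qpoch_inf (q ^ 3) (q ^ 3)"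
    by (simp add: Theta_def)
  have "q * (- q) = - (q ^ 2)" "q ^ 2 * (- q) = - (q ^ 3)" by (simp_all add: power2_eq_square power3_eq_cube)
  hence S: "qpoch_inf (- q) q = qpoch_inf (- q) (q ^ 3) * qpoch_inf (- (q ^ 2)) (q ^ 3) * qpoch_inf (- (q ^ 3)) (q ^ 3)"
    using qpoch_inf_split3[OF q(2), of "- q"] by simp
  have J6: "qpoch_inf (q ^ 6) (q ^ 6) = qpoch_inf (q ^ 3) (q ^ 3) * qpoch_inf (- (q ^ 3)) (q ^ 3)"
    using qpoch_neg[of "q ^ 3"] norm_power_lt_1[OF q(2), of 3] by (simp flip: power_mult)
  show ?thesis unfolding T J6 qpoch_neg[OF q(2), symmetric] S by (simp add: power2_eq_square)
qed

lemma Theta_base6: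
  assumes q: "q \<noteq> 0" "norm q < 1"
  shows "Theta q (q ^ 6) * qpoch_inf (q ^ 2) (q ^ 2) * qpoch_inf (q ^ 3) (q ^ 3) = qpoch_inf q q * qpoch_inf (q ^ 6) (q ^ 6) ^ 2"
proof -
  have "q ^ 6 / q = q ^ 5" using q by (simp add: field_simps flip: power_Suc)
  hence T: "Theta q (q ^ 6) = qpoch_inf q (q ^ 6) * qpoch_inf (q ^ 5) (q ^ 6) * qpoch_inf (q ^ 6) (q ^ 6)"
    by (simp add: Theta_def)
  have p: "(q ^ 2) ^ 3 = q ^ 6" "(q ^ 3) ^ 2 = q ^ 6" "(q ^ 2) ^ 2 * q = q ^ 5" "q ^ 2 * q = q ^ 3"
    by (simp_all flip: power_mult power_Suc2)
  have S: "qpoch_inf q (q ^ 2) = qpoch_inf q (q ^ 6) * qpoch_inf (q ^ 3) (q ^ 6) * qpoch_inf (q ^ 5) (q ^ 6)"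
    using qpoch_inf_split3[of "q ^ 2" q] norm_power_lt_1[OF q(2), of 2] by (simp only: p)
  have J3: "qpoch_inf (q ^ 3) (q ^ 6) * qpoch_inf (q ^ 6) (q ^ 6) = qpoch_inf (q ^ 3) (q ^ 3)"
    using qpoch_half[of "q ^ 3"] norm_power_lt_1[OF q(2), of 3] by (simp only: p)
  show ?thesis unfolding T qpoch_half[OF q(2), symmetric] S J3[symmetric] by (simp add: power2_eq_square)
qed

lemma Theta_neg_base4:
  assumes q: "q \<noteq> 0" "norm q < 1"
  shows "Theta (- q) (q ^ 4) * qpoch_inf q q = qpoch_inf (q ^ 2) (q ^ 2) ^ 2"
proof -
  have q2: "norm (q ^ 2) < 1" using norm_power_lt_1[OF q(2), of 2] by simp
  have p: "(q ^ 2) ^ 2 = q ^ 4" "q ^ 2 * - q = - (q ^ 3)" "q ^ 4 / - q = - (q ^ 3)"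
    using q by (simp_all add: power2_eq_square power3_eq_cube power4_eq_xxxx)
  have split: "qpoch_inf (- q) (q ^ 2) = qpoch_inf (- q) (q ^ 4) * qpoch_inf (- (q ^ 3)) (q ^ 4)"
    using qpoch_inf_split2[OF q2, of "- q"] unfolding p .
  have T: "Theta (- q) (q ^ 4) = qpoch_inf (- q) (q ^ 2) * qpoch_inf (q ^ 4) (q ^ 4)"
    unfolding Theta_def p split ..
  have S: "qpoch_inf (q ^ 2) (q ^ 4) = qpoch_inf q (q ^ 2) * qpoch_inf (- q) (q ^ 2)"
    using qpoch_inf_square[OF q2, of q] by (simp add: p)
  have J2: "qpoch_inf (q ^ 2) (q ^ 4) * qpoch_inf (q ^ 4) (q ^ 4) = qpoch_inf (q ^ 2) (q ^ 2)"
    using qpoch_half[OF q2] by (simp add: p)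
  have "Theta (- q) (q ^ 4) * qpoch_inf q q = (qpoch_inf (q ^ 2) (q ^ 4) * qpoch_inf (q ^ 4) (q ^ 4)) * qpoch_inf (q ^ 2) (q ^ 2)"
    unfolding T S qpoch_half[OF q(2), symmetric] by simp
  thus ?thesis unfolding J2 by (simp add: power2_eq_square)
qed

section \<open>Sums of two theta products\<close>

text \<open>The sum on the left is a theta function of degree \<open>3\<close> that vanishes at \<open>-1\<close> and at the two
points \<open>a\<close> with \<open>a ^ 2 = 1 / q\<close>. The corresponding theta factors, together with \<open>Theta x q\<close>,
make up \<open>Theta (x ^ 2) q\<close>. The constant is read off at a primitive cube root of unity, where both
theta functions in the sum are equal.\<close>

theorem quintuple_product:
  assumes q: "q \<noteq> 0" "norm q < 1" and x: "x \<noteq> 0"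
  shows "(Theta (q * x ^ 3) (q ^ 3) + x * Theta (q ^ 2 * x ^ 3) (q ^ 3)) * Theta x q = qpoch_inf q q * Theta (x ^ 2) q"
proof -
  have q3: "q ^ 3 \<noteq> 0" "norm (q ^ 3) < 1" and q2: "q ^ 2 \<noteq> 0" "norm (q ^ 2) < 1" using q norm_power_lt_1 by auto
  define f where "f x = Theta (q * x ^ 3) (q ^ 3) + x * Theta (q ^ 2 * x ^ 3) (q ^ 3)" for x
  \<comment> \<open>either square root of \<open>q\<close> will do\<close>
  define s where "s = csqrt q"
  have s2: "s ^ 2 = q" by (simp add: s_def)
  have s0: "s \<noteq> 0" using s2 q by auto
  have tl: "theta_like (int 3) (- 1 / q) q f"
  proof (rule theta_like_I)
    show "f holomorphic_on -{0}" unfolding f_def[abs_def]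
      by (intro holomorphic_intros holomorphic_Theta_compose) (use q q3 in auto)
    show "- 1 / q \<noteq> 0" using q by simp
    fix x :: complex assume x: "x \<noteq> 0"
    have "Theta (c * (q * x) ^ 3) (q ^ 3) = - Theta (c * x ^ 3) (q ^ 3) / (c * x ^ 3)" if "c \<noteq> 0" for c
    proof -
      have e: "c * (q * x) ^ 3 = q ^ 3 * (c * x ^ 3)" by (simp add: power_mult_distrib)
      show ?thesis unfolding e by (rule Theta_step[OF q3]) (use x that in simp)
    qed
    note e = this[OF q(1)] this[OF q2(1)]
    show "f (q * x) = - 1 / q / x ^ 3 * f x"
      unfolding f_def e using q x by (simp add: field_simps power2_eq_square)
  qed
  have zero: "f a = 0" if "a ^ 2 = 1 / q" for a
  proof -
    have a0: "a \<noteq> 0" using that q by auto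
    have a3: "q * a ^ 3 = a" "q ^ 2 * a ^ 3 = q * a" using that q by (simp_all add: power2_eq_square power3_eq_cube field_simps)
    have "q ^ 3 / (q * a) = q ^ 3 * a" using that q a0 by (simp add: field_simps power2_eq_square power3_eq_cube)
    hence "Theta (q * a) (q ^ 3) = Theta (q ^ 3 * a) (q ^ 3)"
      using Theta_flip[OF q3(1), of "q * a"] q a0 by simp
    also have "\<dots> = - Theta a (q ^ 3) / a" by (rule Theta_step[OF q3 a0])
    finally show ?thesis unfolding f_def a3 using a0 by simp
  qed
  have "q ^ 3 / (- q) = - (q ^ 2)" using q by (simp add: power2_eq_square power3_eq_cube)
  hence zero1: "f (-1) = 0" unfolding f_def using Theta_flip[OF q3(1), of "- q"] q by simp
  have ns: "Theta t q \<noteq> 0" if "t ^ 2 = 1 / q" for t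
  proof
    assume 0: "Theta t q = 0"
    have "t \<noteq> 0" using that q by auto
    with 0 obtain n where "t = q powi n" using Theta_eq_0_iff[OF q] by blast
    hence "q powi (n * 2) = 1 / q" using that by (simp add: power_int_mult)
    hence "q powi (n * 2 + 1) = 1" using q by (simp add: power_int_add)
    hence "n * 2 + 1 = 0" using powi_eq_1_iff[OF q] by blast
    thus False by presburger
  qed
  have n1: "Theta (-1) q \<noteq> 0" using Theta_neg_powi_nonzero[OF q, of 1 0] by simp
  define as where "as = [-1, 1 / s, - 1 / s]"
  have is2: "(1 / s) ^ 2 = 1 / q" "(- 1 / s) ^ 2 = 1 / q" using s2 by (simp_all add: power_divide)
  obtain c where c: "\<And>x. x \<noteq> 0 \<Longrightarrow> f x = c * (\<Prod>a\<leftarrow>as. Theta (x / a) q)"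
  proof (rule theta_like_factorization[OF q, where as = as and f = f])
    show "theta_like (int (length as)) (- 1 / q) q f" using tl by (simp add: as_def)
    show "a \<noteq> 0 \<and> f a = 0" if "a \<in> set as" for a
      using that zero[OF is2(1)] zero[OF is2(2)] zero1 s0 by (auto simp: as_def)
    show "sorted_wrt (\<lambda>a b. Theta (b / a) q \<noteq> 0) as"
      using ns[OF is2(1)] ns[OF is2(2)] n1 s0 by (simp add: as_def)
    show "- 1 / q * (\<Prod>a\<leftarrow>as. - (1 / a)) = 1" using s2 s0 q by (simp add: as_def power2_eq_square)
  qed auto
  let ?J1 = "qpoch_inf q q" and ?J2 = "qpoch_inf (q ^ 2) (q ^ 2)"
  have J: "?J1 \<noteq> 0" "?J2 \<noteq> 0" using qpoch_inf_base_nonzero q q2 by auto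
  define d where "d = c * (?J1 ^ 3 / ?J2 ^ 0)"
  have prod: "f x * Theta x q = d * Theta (x ^ 2) q" if x: "x \<noteq> 0" for x
  proof -
    have 1: "Theta x q * Theta (- x) q * ?J2 = Theta (x ^ 2) (q ^ 2) * ?J1 ^ 2" by (rule Theta_mult_neg[OF q x])
    have 2: "Theta (s * x) q * Theta (- (s * x)) q * ?J2 = Theta (q * x ^ 2) (q ^ 2) * ?J1 ^ 2"
      using Theta_mult_neg[OF q, of "s * x"] x s0 s2 by (simp add: power_mult_distrib)
    have 3: "Theta (x ^ 2) q * ?J2 ^ 2 = Theta (x ^ 2) (q ^ 2) * Theta (q * x ^ 2) (q ^ 2) * ?J1"
      using Theta_split2[OF q, of "x ^ 2"] x by simp
    have "f x = c * (Theta (- x) q * (Theta (s * x) q * Theta (- (s * x)) q))"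
      using c[OF x] by (simp add: as_def mult.commute)
    hence "f x * Theta x q * ?J2 ^ 2 = c * (Theta x q * Theta (- x) q * ?J2) * (Theta (s * x) q * Theta (- (s * x)) q * ?J2)"
      by (simp add: power2_eq_square)
    also have "\<dots> = c * ?J1 ^ 3 * (Theta (x ^ 2) q * ?J2 ^ 2)" unfolding 1 2 3 by (simp add: power2_eq_square power3_eq_cube)
    finally show ?thesis using J by (simp add: d_def)
  qed
  have "d = ?J1"
  proof -
    have w2: "omega ^ 2 = 1 / omega" using omega_cube by (simp add: field_simps power2_eq_square power3_eq_cube)
    have T2: "Theta (omega ^ 2) q = - (omega ^ 2) * Theta omega q"
      unfolding w2 using Theta_inverse[OF q, of omega] by simp
    have "q ^ 3 / q = q ^ 2" using q by (simp add: power2_eq_square power3_eq_cube)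
    hence "f omega = ?J1 * (1 + omega)"
      unfolding f_def using Theta_base3[OF q] Theta_flip[OF q3(1), of q] q by (simp add: omega_cube algebra_simps)
    also have "1 + omega = - (omega ^ 2)" using omega_sum by (simp add: eq_neg_iff_add_eq_0)
    finally have "?J1 * Theta (omega ^ 2) q = d * Theta (omega ^ 2) q" using prod[of omega] T2 by simp
    moreover have "Theta (omega ^ 2) q \<noteq> 0"
      unfolding T2 using Theta_omega[OF q] omega_neq_1 qpoch_inf_base_nonzero[OF q3(2)] by simp
    ultimately show ?thesis by simp
  qed
  with prod[OF x] show ?thesis by (simp add: f_def)
qed

text \<open>Although its terms have base \<open>q ^ 6\<close>, the sum has degree one with respect to \<open>q ^ 3\<close>, since
multiplication by \<open>q ^ 3\<close> exchanges the two terms. Its zero is at \<open>- q\<close>, and \<open>x = 1\<close> gives the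
constant.\<close>

theorem theta_two_term_degree2:
  assumes q: "q \<noteq> 0" "norm q < 1" and x: "x \<noteq> 0"
  shows "x * Theta (q ^ 4 * x) (q ^ 6) * Theta (q ^ 3 * x) (q ^ 6) + q * Theta x (q ^ 6) * Theta (q * x) (q ^ 6)
       = q * qpoch_inf q q * Theta (- x / q) (q ^ 3)"
proof -
  have q3: "q ^ 3 \<noteq> 0" "norm (q ^ 3) < 1" and q6: "q ^ 6 \<noteq> 0" "norm (q ^ 6) < 1" and q2: "q ^ 2 \<noteq> 0" "norm (q ^ 2) < 1"
    using q norm_power_lt_1 by auto
  define f where "f x = x * Theta (q ^ 4 * x) (q ^ 6) * Theta (q ^ 3 * x) (q ^ 6) + q * Theta x (q ^ 6) * Theta (q * x) (q ^ 6)" for x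
  have p: "q ^ 4 * q ^ 3 = q ^ 6 * q" "q ^ 3 * q ^ 3 = q ^ 6" "q * q ^ 3 = q ^ 4" by (simp_all flip: power_add power_Suc power_Suc2)
  have tl: "theta_like (int 1) q (q ^ 3) f"
  proof (rule theta_like_I)
    show "f holomorphic_on -{0}" unfolding f_def[abs_def]
      by (intro holomorphic_intros holomorphic_Theta_compose) (use q q6 in auto)
    show "q \<noteq> 0" by fact
    fix x :: complex assume x: "x \<noteq> 0"
    have e: "q ^ 4 * (q ^ 3 * x) = q ^ 6 * (q * x)" "q ^ 3 * (q ^ 3 * x) = q ^ 6 * x" "q * (q ^ 3 * x) = q ^ 4 * x"
      using p by (simp_all add: mult.assoc[symmetric])
    have s: "Theta (q ^ 6 * (q * x)) (q ^ 6) = - Theta (q * x) (q ^ 6) / (q * x)"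
      "Theta (q ^ 6 * x) (q ^ 6) = - Theta x (q ^ 6) / x" by (rule Theta_step[OF q6]; use q x in simp)+
    show "f (q ^ 3 * x) = q / x ^ 1 * f x" unfolding f_def e s using q x by (simp add: field_simps power2_eq_square power3_eq_cube)
  qed
  have zero: "f (- q) = 0"
  proof -
    have "q ^ 6 / (- q) = q ^ 4 * (- q)" "q ^ 6 / (q * (- q)) = q ^ 3 * (- q)"
      using q by (simp_all add: field_simps flip: power_Suc)
    thus ?thesis unfolding f_def using Theta_flip[OF q6(1), of "- q"] Theta_flip[OF q6(1), of "q * (- q)"] q by simp
  qed
  obtain c where c: "\<And>x. x \<noteq> 0 \<Longrightarrow> f x = c * (\<Prod>a\<leftarrow>[- q]. Theta (x / a) (q ^ 3))"
  proof (rule theta_like_factorization[OF q3, where as = "[- q]" and f = f])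
    show "theta_like (int (length [- q])) q (q ^ 3) f" using tl by simp
  qed (use q zero in auto)
  hence c: "f x = c * Theta (- x / q) (q ^ 3)" if "x \<noteq> 0" for x using that by simp
  let ?J1 = "qpoch_inf q q" and ?J2 = "qpoch_inf (q ^ 2) (q ^ 2)" and ?J3 = "qpoch_inf (q ^ 3) (q ^ 3)" and ?J6 = "qpoch_inf (q ^ 6) (q ^ 6)"
  have J: "?J1 \<noteq> 0" "?J2 \<noteq> 0" "?J3 \<noteq> 0" "?J6 \<noteq> 0" using qpoch_inf_base_nonzero q q2 q3 q6 by auto
  have "c = q * ?J1"
  proof -
    have p': "(q ^ 2) ^ 3 = q ^ 6" "(q ^ 3) ^ 2 = q ^ 6" by (simp_all flip: power_mult)
    have "q ^ 6 / q ^ 2 = q ^ 4" using q by (simp add: field_simps flip: power_add)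
    hence T4: "Theta (q ^ 4) (q ^ 6) = ?J2"
      using Theta_flip[OF q6(1), of "q ^ 2"] Theta_base3[OF q2] q by (simp add: p')
    have T3: "Theta (q ^ 3) (q ^ 6) * ?J6 = ?J3 ^ 2" using Theta_base2[OF q3] by (simp only: p')
    have "q ^ 3 * (- 1 / q) = - (q ^ 2)" "q ^ 3 / (- q) = - (q ^ 2)" using q by (simp_all add: power2_eq_square power3_eq_cube)
    hence Tm: "Theta (- 1 / q) (q ^ 3) = Theta (- q) (q ^ 3) / q"
      using Theta_step[OF q3, of "- 1 / q"] Theta_flip[OF q3(1), of "- q"] q by (simp add: field_simps)
    have "Theta 1 (q ^ 6) = 0" using Theta_eq_0_iff[OF q6, of 1] by (auto intro: exI[of _ 0])
    hence f1: "f 1 = ?J2 * Theta (q ^ 3) (q ^ 6)" unfolding f_def by (simp add: T4)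
    hence "c * Theta (- q) (q ^ 3) = q * ?J2 * Theta (q ^ 3) (q ^ 6)" 
    proof -
      have "c * Theta (- q) (q ^ 3) = q * (c * Theta (- 1 / q) (q ^ 3))" unfolding Tm using q by simp
      also have "c * Theta (- 1 / q) (q ^ 3) = f 1" using c[of 1] by simp
      finally show ?thesis using f1 by simp
    qed
    hence "c * (Theta (- q) (q ^ 3) * ?J6 * ?J1) = q * ?J1 * ?J2 * (Theta (q ^ 3) (q ^ 6) * ?J6)"
      by (simp add: mult_ac)
    thus ?thesis unfolding Theta_neg_base3[OF q] T3 using J by simp
  qed
  with c[OF x] show ?thesis by (simp add: f_def)
qed

text \<open>The sum is a theta function of degree \<open>5\<close> with base \<open>q ^ 6\<close>. Its zeros
are \<open>1 / q\<close>, \<open>1 / q ^ 3\<close>, \<open>1 / q ^ 5\<close>, \<open>-1\<close> and \<open>- 1 / q ^ 3\<close>; the first three belong to \<open>Theta (q z) (q ^ 2)\<close>, the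
others to \<open>Theta (- z) (q ^ 3)\<close>. The constant is found at \<open>z = 1\<close>.\<close>

theorem theta_two_term_degree5:
  assumes q: "q \<noteq> 0" "norm q < 1" and z: "z \<noteq> 0"
  shows "(Theta (q * z ^ 2) (q ^ 6) * Theta (q ^ 4 * z) (q ^ 6) + z * Theta (q ^ 5 * z ^ 2) (q ^ 6) * Theta (q ^ 2 * z) (q ^ 6)) * qpoch_inf q q
       = qpoch_inf (q ^ 2) (q ^ 2) * Theta (q * z) (q ^ 2) * Theta (- z) (q ^ 3)"
proof -
  have q3: "q ^ 3 \<noteq> 0" "norm (q ^ 3) < 1" and q6: "q ^ 6 \<noteq> 0" "norm (q ^ 6) < 1" and q2: "q ^ 2 \<noteq> 0" "norm (q ^ 2) < 1"
    using q norm_power_lt_1 by auto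
  define f where "f z = Theta (q * z ^ 2) (q ^ 6) * Theta (q ^ 4 * z) (q ^ 6) + z * Theta (q ^ 5 * z ^ 2) (q ^ 6) * Theta (q ^ 2 * z) (q ^ 6)" for z
  have step: "Theta (q ^ 6 * x) (q ^ 6) = - Theta x (q ^ 6) / x" if "x \<noteq> 0" for x by (rule Theta_step[OF q6 that])
  have step2: "Theta (q ^ 12 * x) (q ^ 6) = Theta x (q ^ 6) / (q ^ 6 * x ^ 2)" if "x \<noteq> 0" for x
  proof -
    have "q ^ 12 * x = q ^ 6 * (q ^ 6 * x)" by (simp flip: power_add mult.assoc)
    thus ?thesis using step[of "q ^ 6 * x"] step[of x] that q by (simp add: power2_eq_square)
  qed
  have tl: "theta_like (int 5) (- 1 / q ^ 12) (q ^ 6) f"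
  proof (rule theta_like_I)
    show "f holomorphic_on -{0}" unfolding f_def[abs_def]
      by (intro holomorphic_intros holomorphic_Theta_compose) (use q q6 in auto)
    show "- 1 / q ^ 12 \<noteq> 0" using q by simp
    fix x :: complex assume x: "x \<noteq> 0"
    have e: "q * (q ^ 6 * x) ^ 2 = q ^ 12 * (q * x ^ 2)" "q ^ 5 * (q ^ 6 * x) ^ 2 = q ^ 12 * (q ^ 5 * x ^ 2)"
       "q ^ 4 * (q ^ 6 * x) = q ^ 6 * (q ^ 4 * x)" "q ^ 2 * (q ^ 6 * x) = q ^ 6 * (q ^ 2 * x)"
      by (simp_all add: power_mult_distrib flip: power_mult)
    show "f (q ^ 6 * x) = - 1 / q ^ 12 / x ^ 5 * f x"
    proof -
      have m: "q ^ 6 * (q * x ^ 2) ^ 2 * (q ^ 4 * x) = q ^ 12 * x ^ 5" "q ^ 6 * (q ^ 5 * x ^ 2) ^ 2 * (q ^ 2 * x) = q ^ 6 * (q ^ 12 * x ^ 5)"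
        by algebra+
      have s: "Theta (q ^ 12 * (q * x ^ 2)) (q ^ 6) = Theta (q * x ^ 2) (q ^ 6) / (q ^ 6 * (q * x ^ 2) ^ 2)"
        "Theta (q ^ 12 * (q ^ 5 * x ^ 2)) (q ^ 6) = Theta (q ^ 5 * x ^ 2) (q ^ 6) / (q ^ 6 * (q ^ 5 * x ^ 2) ^ 2)"
        "Theta (q ^ 6 * (q ^ 4 * x)) (q ^ 6) = - Theta (q ^ 4 * x) (q ^ 6) / (q ^ 4 * x)"
        "Theta (q ^ 6 * (q ^ 2 * x)) (q ^ 6) = - Theta (q ^ 2 * x) (q ^ 6) / (q ^ 2 * x)"
        by (rule step2 step; use q x in simp)+
      show ?thesis unfolding f_def e s times_divide_times_eq times_divide_eq_right times_divide_eq_left divide_divide_eq_left m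
        using q x by (simp add: field_simps)
    qed
  qed
  define a1 a3 a5 b0 b3 where "a1 = q powi (-1)" and "a3 = q powi (-3)" and "a5 = q powi (-5)" and "b0 = (-1 :: complex)"
    and "b3 = - (q powi (-3))"
  have inv: "Theta (1 / x) (q ^ 6) = - Theta x (q ^ 6) / x" if "x \<noteq> 0" for x by (rule Theta_inverse[OF q6 that])
  have flip: "Theta y (q ^ 6) = Theta x (q ^ 6)" if "x * y = q ^ 6" for x y
  proof -
    have x: "x \<noteq> 0" using that q by auto
    hence "y = q ^ 6 / x" using that by (simp add: field_simps)
    with x show ?thesis using Theta_flip[OF q6(1), of x] by simp
  qed
  have T5: "Theta (q ^ 5) (q ^ 6) = Theta q (q ^ 6)" "Theta (- (q ^ 5)) (q ^ 6) = Theta (- q) (q ^ 6)" 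
     "Theta (- (q ^ 4)) (q ^ 6) = Theta (- (q ^ 2)) (q ^ 6)"
    by (rule flip; simp flip: power_Suc power_add)+
  have m1: "Theta (1 / q) (q ^ 6) = - Theta q (q ^ 6) / q" using inv q by simp
  have m5: "Theta (1 / q ^ 5) (q ^ 6) = - Theta q (q ^ 6) / q ^ 5" using inv[of "q ^ 5"] q T5 by simp
  have m9: "Theta (1 / q ^ 9) (q ^ 6) = - Theta (1 / q ^ 3) (q ^ 6) / q ^ 9"
  proof -
    have e: "q ^ 6 * (1 / q ^ 9) = 1 / q ^ 3" using q by (simp add: field_simps flip: power_add)
    show ?thesis using step[of "1 / q ^ 9"] q unfolding e by simp
  qed
  have mm: "Theta (- (1 / q)) (q ^ 6) = Theta (- q) (q ^ 6) / q" using inv[of "- q"] q by simp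
  have z1: "f a1 = 0"
  proof -
    have e: "q * a1 ^ 2 = 1 / q" "q ^ 4 * a1 = q ^ 3" "q ^ 5 * a1 ^ 2 = q ^ 3" "q ^ 2 * a1 = q" "a1 = 1 / q"
      using q by (simp_all add: a1_def power_int_minus field_simps flip: power_Suc power_add) (simp_all add: power2_eq_square)
    show ?thesis unfolding f_def e(1-4) m1 unfolding e(5) by simp
  qed
  have z3: "f a3 = 0"
  proof -
    have e: "q * a3 ^ 2 = 1 / q ^ 5" "q ^ 4 * a3 = q" "q ^ 5 * a3 ^ 2 = 1 / q" "q ^ 2 * a3 = 1 / q" "a3 = 1 / q ^ 3"
      using q by (simp_all add: a3_def power_int_minus field_simps flip: power_Suc power_add power_mult)
    show ?thesis unfolding f_def e(1-4) m1 m5 unfolding e(5) using q by (simp add: field_simps flip: power_Suc power_add)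
  qed
  have z5: "f a5 = 0"
  proof -
    have e: "q * a5 ^ 2 = 1 / q ^ 9" "q ^ 4 * a5 = 1 / q" "q ^ 5 * a5 ^ 2 = 1 / q ^ 5" "q ^ 2 * a5 = 1 / q ^ 3" "a5 = 1 / q ^ 5"
      using q by (simp_all add: a5_def power_int_minus field_simps flip: power_Suc power_add power_mult)
    show ?thesis unfolding f_def e(1-4) m1 m5 m9 unfolding e(5) using q by (simp add: field_simps flip: power_Suc power_add)
  qed
  have y0: "f b0 = 0" unfolding f_def b0_def by (simp add: T5)
  have y3: "f b3 = 0"
  proof -
    have e: "q * b3 ^ 2 = 1 / q ^ 5" "q ^ 4 * b3 = - q" "q ^ 5 * b3 ^ 2 = 1 / q" "q ^ 2 * b3 = - (1 / q)" "b3 = - (1 / q ^ 3)"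
      using q by (simp_all add: b3_def power_int_minus field_simps flip: power_Suc power_add power_mult)
    show ?thesis unfolding f_def e(1-4) m1 m5 mm unfolding e(5) using q by (simp add: field_simps flip: power_Suc power_add)
  qed
  obtain c where c: "\<And>x. x \<noteq> 0 \<Longrightarrow> f x = c * (\<Prod>a\<leftarrow>[a1,a3,a5,b0,b3]. Theta (x / a) (q ^ 6))"
  proof (rule theta_like_factorization[OF q6, where as = "[a1,a3,a5,b0,b3]" and f = f])
    show "theta_like (int (length [a1,a3,a5,b0,b3])) (- 1 / q ^ 12) (q ^ 6) f" using tl by simp
    show "a \<noteq> 0 \<and> f a = 0" if "a \<in> set [a1,a3,a5,b0,b3]" for a
      using that z1 z3 z5 y0 y3 q by (auto simp: a1_def a3_def a5_def b0_def b3_def)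
    have r: "a3 / a1 = q powi (-2)" "a5 / a1 = q powi (-4)" "a5 / a3 = q powi (-2)"
      "b0 / a1 = - (q powi 1)" "b3 / a1 = - (q powi (-2))" "b0 / a3 = - (q powi 3)" "b3 / a3 = - (q powi 0)"
      "b0 / a5 = - (q powi 5)" "b3 / a5 = - (q powi 2)" "b3 / b0 = q powi (-3)"
      using q by (simp_all add: a1_def a3_def a5_def b0_def b3_def power_int_minus field_simps flip: power_Suc power_add)
    have "Theta (q powi (-2)) (q ^ 6) \<noteq> 0" "Theta (q powi (-4)) (q ^ 6) \<noteq> 0" "Theta (q powi (-3)) (q ^ 6) \<noteq> 0"
      by (rule Theta_powi_nonzero[OF q]; simp)+
    moreover have "Theta (- (q powi m)) (q ^ 6) \<noteq> 0" for m by (rule Theta_neg_powi_nonzero[OF q]) simp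
    ultimately show "sorted_wrt (\<lambda>a b. Theta (b / a) (q ^ 6) \<noteq> 0) [a1,a3,a5,b0,b3]"
      unfolding sorted_wrt.simps list.set ball_simps r by blast
    show "- 1 / q ^ 12 * (\<Prod>a\<leftarrow>[a1,a3,a5,b0,b3]. - (1 / a)) = 1"
      using q by (simp add: a1_def a3_def a5_def b0_def b3_def power_int_minus field_simps flip: power_Suc power_add)
  qed auto
  let ?J1 = "qpoch_inf q q" and ?J2 = "qpoch_inf (q ^ 2) (q ^ 2)" and ?J3 = "qpoch_inf (q ^ 3) (q ^ 3)" and ?J6 = "qpoch_inf (q ^ 6) (q ^ 6)"
  have J: "?J1 \<noteq> 0" "?J2 \<noteq> 0" "?J3 \<noteq> 0" "?J6 \<noteq> 0" using qpoch_inf_base_nonzero q q2 q3 q6 by auto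
  define d where "d = c * (?J6 ^ 3 / ?J2) * (?J6 ^ 2 / ?J3)"
  have d: "f x = d * Theta (q * x) (q ^ 2) * Theta (- x) (q ^ 3)" if x: "x \<noteq> 0" for x
  proof -
    have r: "x / a1 = q * x" "x / a3 = q ^ 3 * x" "x / a5 = q ^ 5 * x" "x / b0 = - x" "x / b3 = - (q ^ 3 * x)"
      using q by (simp_all add: a1_def a3_def a5_def b0_def b3_def power_int_minus field_simps)
    have p: "(q ^ 2) ^ 3 = q ^ 6" "(q ^ 3) ^ 2 = q ^ 6" "q ^ 2 * (q * x) = q ^ 3 * x" "(q ^ 2) ^ 2 * (q * x) = q ^ 5 * x"
      by (simp_all flip: power_mult power_Suc2 mult.assoc)
    have 1: "Theta (q * x) (q ^ 2) * ?J6 ^ 3 = Theta (q * x) (q ^ 6) * Theta (q ^ 3 * x) (q ^ 6) * Theta (q ^ 5 * x) (q ^ 6) * ?J2"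
      using Theta_split3[OF q2, of "q * x"] q x unfolding p by simp
    have 2: "Theta (- x) (q ^ 3) * ?J6 ^ 2 = Theta (- x) (q ^ 6) * Theta (- (q ^ 3 * x)) (q ^ 6) * ?J3"
      using Theta_split2[OF q3, of "- x"] x unfolding p by simp
    have "f x = c * (Theta (q * x) (q ^ 6) * Theta (q ^ 3 * x) (q ^ 6) * Theta (q ^ 5 * x) (q ^ 6)) * (Theta (- x) (q ^ 6) * Theta (- (q ^ 3 * x)) (q ^ 6))"
      using c[OF x] by (simp add: r)
    also have "Theta (q * x) (q ^ 6) * Theta (q ^ 3 * x) (q ^ 6) * Theta (q ^ 5 * x) (q ^ 6) = Theta (q * x) (q ^ 2) * (?J6 ^ 3 / ?J2)"
      using 1 J by (simp add: field_simps)
    also have "Theta (- x) (q ^ 6) * Theta (- (q ^ 3 * x)) (q ^ 6) = Theta (- x) (q ^ 3) * (?J6 ^ 2 / ?J3)"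
      using 2 J by (simp add: field_simps)
    finally show ?thesis by (simp add: d_def mult_ac)
  qed
  have "d * ?J1 = ?J2"
  proof -
    have p: "(q ^ 2) ^ 3 = q ^ 6" "(q ^ 3) ^ 2 = q ^ 6" by (simp_all flip: power_mult)
    have "Theta (q ^ 2) (q ^ 6) = ?J2" using Theta_base3[OF q2] by (simp add: p)
    moreover have "Theta (q ^ 4) (q ^ 6) = Theta (q ^ 2) (q ^ 6)" by (rule flip) (simp flip: power_add)
    ultimately have "f 1 = 2 * Theta q (q ^ 6) * ?J2" unfolding f_def by (simp add: T5)
    hence E: "2 * Theta q (q ^ 6) * ?J2 = d * Theta q (q ^ 2) * Theta (-1) (q ^ 3)" using d[of 1] by simp
    have e1: "Theta q (q ^ 2) * ?J2 = ?J1 ^ 2" by (rule Theta_base2[OF q])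
    have e2: "Theta (-1) (q ^ 3) * ?J3 = 2 * ?J6 ^ 2" using Theta_neg_1[OF q3] by (simp add: p)
    have e3: "Theta q (q ^ 6) * ?J2 * ?J3 = ?J1 * ?J6 ^ 2" by (rule Theta_base6[OF q])
    have "2 * (Theta q (q ^ 6) * ?J2 * ?J3) * ?J2 = d * (Theta q (q ^ 2) * ?J2) * (Theta (-1) (q ^ 3) * ?J3)"
      using E by (simp add: mult_ac)
    hence "?J1 * ?J6 ^ 2 * ?J2 = d * ?J1 ^ 2 * ?J6 ^ 2" unfolding e1 e2 e3 by simp
    thus ?thesis using J by (simp add: power2_eq_square)
  qed
  thus ?thesis using d[OF z] by (simp add: f_def mult_ac)
qed

section \<open>The expansion at special arguments\<close>

lemma not_powi_Theta_nonzero: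
  assumes "q \<noteq> 0" "norm q < 1" "x \<noteq> 0" "\<forall>n::int. x \<noteq> q powi n"
  shows "Theta x q \<noteq> 0"
  using Theta_eq_0_iff[OF assms(1-3)] assms(4) by blast

text \<open>The three Appell functions with base \<open>q ^ 9\<close> exclude the powers of \<open>q ^ 3\<close> whose exponents lie in
the three residue classes modulo \<open>3\<close>, so together all powers of \<open>q ^ 3\<close>.\<close>

lemma D3_defined_imp_Theta_nonzero:
  assumes q: "q \<noteq> 0" "norm q < 1" and nz: "x \<noteq> 0" "z \<noteq> 0" "z' \<noteq> 0" and D: "D3_defined x z z' q"
  shows "Theta z q \<noteq> 0" "Theta (x * z) q \<noteq> 0" "Theta z' (q ^ 9) \<noteq> 0" "Theta (x ^ 3 * z') (q ^ 3) \<noteq> 0"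
proof -
  have q9: "q ^ 9 \<noteq> 0" "norm (q ^ 9) < 1" and q3: "q ^ 3 \<noteq> 0" "norm (q ^ 3) < 1" using q norm_power_lt_1 by auto
  show "Theta z q \<noteq> 0" "Theta (x * z) q \<noteq> 0"
    by (rule not_powi_Theta_nonzero[OF q]; use D nz in \<open>auto simp: D3_defined_def appell_defined_def\<close>)+
  show "Theta z' (q ^ 9) \<noteq> 0"
    by (rule not_powi_Theta_nonzero[OF q9]; use D nz in \<open>auto simp: D3_defined_def appell_defined_def\<close>)
  have D1: "q ^ 3 * x ^ 3 * z' \<noteq> (q ^ 9) powi n" and D2: "x ^ 3 * z' \<noteq> (q ^ 9) powi n"
    and D3: "q powi (-3) * x ^ 3 * z' \<noteq> (q ^ 9) powi n" for n
    using D unfolding D3_defined_def appell_defined_def by blast+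
  show "Theta (x ^ 3 * z') (q ^ 3) \<noteq> 0"
  proof (rule not_powi_Theta_nonzero[OF q3], use nz in simp, intro allI notI)
    fix n :: int assume n: "x ^ 3 * z' = (q ^ 3) powi n"
    have e: "(q ^ 9) powi k = q powi (9 * k)" "(q ^ 3) powi k = q powi (3 * k)" for k
      by (simp_all add: power_int_power)
    define k where "k = n div 3"
    have "n = 3 * k \<or> n = 3 * k + 1 \<or> n = 3 * k + 2" unfolding k_def by presburger
    thus False
    proof (elim disjE)
      assume "n = 3 * k"
      thus False using n D2[of k] unfolding e by simp
    next
      assume "n = 3 * k + 1"
      hence "q powi (-3) * x ^ 3 * z' = q powi (-3) * q powi (9 * k + 3)" using n unfolding e by (simp add: mult.assoc)
      also have "\<dots> = q powi (9 * k)" using q by (simp flip: power_int_add)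
      finally show False using D3[of k] unfolding e by blast
    next
      assume "n = 3 * k + 2"
      hence "q ^ 3 * x ^ 3 * z' = q powi 3 * q powi (9 * k + 6)" using n unfolding e by (simp add: mult.assoc)
      also have "\<dots> = q powi (3 + (9 * k + 6))" using q by (intro power_int_add[symmetric]) auto
      also have "3 + (9 * k + 6) = 9 * (k + 1)" by simp
      finally show False using D1[of "k + 1"] unfolding e by blast
    qed
  qed
qed

text \<open>The argument \<open>z\<close> enters \<open>D3\<close> through the leading Appell function only.\<close>

lemma D3_reflect:
  assumes q: "q \<noteq> 0" "norm q < 1" and nz: "x \<noteq> 0" "z \<noteq> 0" "z' \<noteq> 0" and D: "D3_defined x z z' q"
    and w: "w * (x * z) = 1 \<or> w * (x * z) = q"
  shows "D3 x z z' q = D3 x w z' q"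
proof -
  have R: "appell_m x (1 / (x * z)) q = appell_m x z q"
    using D3_defined_imp_Theta_nonzero[OF q nz D] nz by (intro appell_m_reflect[OF q]) auto
  from w have "w = 1 / (x * z) \<or> w = q * (1 / (x * z))" using nz by (auto simp: field_simps)
  hence "appell_m x w q = appell_m x z q"
    using R appell_m_shift[OF q, of "1 / (x * z)" x] nz by auto
  thus ?thesis by (simp add: D3_def)
qed

lemma Theta_flipI: "x * y = p \<Longrightarrow> p \<noteq> 0 \<Longrightarrow> Theta y p = Theta x p"
proof -
  assume a: "x * y = p" "p \<noteq> 0"
  hence "x \<noteq> 0" by auto
  moreover from this a have "y = p / x" by (simp add: field_simps)
  ultimately show ?thesis using Theta_flip[of p x] a by simp
qed

lemma Theta_upI: "y = p * x \<Longrightarrow> p \<noteq> 0 \<Longrightarrow> norm p < 1 \<Longrightarrow> x \<noteq> 0 \<Longrightarrow> Theta y p = - Theta x p / x"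
  using Theta_step by simp

lemma Theta_up2I: "y = p ^ 2 * x \<Longrightarrow> p \<noteq> 0 \<Longrightarrow> norm p < 1 \<Longrightarrow> x \<noteq> 0 \<Longrightarrow> Theta y p = Theta x p / (p * x ^ 2)"
  using Theta_step[of p "p * x"] Theta_step[of p x] by (simp add: power2_eq_square mult.assoc)

lemma Theta_downI: "x = p * y \<Longrightarrow> p \<noteq> 0 \<Longrightarrow> norm p < 1 \<Longrightarrow> y \<noteq> 0 \<Longrightarrow> Theta y p = - y * Theta x p"
  using Theta_step[of p y] by simp

lemma Theta_one: "p \<noteq> 0 \<Longrightarrow> norm p < 1 \<Longrightarrow> Theta 1 p = 0"
  using Theta_eq_0_iff[of p 1] by (auto intro: exI[of _ 0])

text \<open>The expansion in terms of \<open>a = x z\<close>, \<open>b = x ^ 3 z'\<close>, \<open>c = x ^ 3 z z'\<close> and \<open>d = z ^ 3 / z'\<close>. The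
arguments are passed as equations so that they can be given in simplified form.\<close>

lemma D3_eval:
  assumes q: "q \<noteq> 0" "norm q < 1" and nz: "x \<noteq> 0" "z \<noteq> 0" "z' \<noteq> 0" and D: "D3_defined x z z' q"
    and e: "x * z = a" "x ^ 3 * z' = b" "b * z = c" "z ^ 3 / z' = d" "q ^ 3 = q3" "q ^ 9 = q9"
  shows "D3 x z z' q = z' * qpoch_inf q3 q3 ^ 3 / (z * Theta a q * Theta z' q9 * Theta b q3) *
      (Theta c q3 * Theta d q9 / Theta z q3
       - a / q * Theta (q * c) q3 * Theta (q3 * d) q9 / Theta (q * z) q3
       + a ^ 2 / q * Theta (q ^ 2 * c) q3 * Theta (q3 ^ 2 * d) q9 / Theta (q ^ 2 * z) q3)"
proof -
  have q6: "q3 ^ 2 = q ^ 6" unfolding e(5)[symmetric] by (simp flip: power_mult)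
  have c: "c = x ^ 3 * z * z'" using e(2,3) by (simp add: mult_ac)
  show ?thesis
    using D3_formula[OF q nz D3_defined_imp_Theta_nonzero[OF q nz D]] q
    unfolding q6 c e(1,2,4-6)[symmetric]
    by (simp add: power_mult_distrib mult_ac)
qed

text \<open>For \<open>d = 1\<close> the first term vanishes.\<close>

lemma D3_eval_0:
  assumes q: "q \<noteq> 0" "norm q < 1" and nz: "x \<noteq> 0" "z \<noteq> 0" and D: "D3_defined x z z' q"
    and e: "x * z = a" "x ^ 3 * z' = b" "b * z = c" "z' = z ^ 3" "q ^ 3 = q3" "q ^ 9 = q9"
  shows "D3 x z z' q = z' * qpoch_inf q3 q3 ^ 4 * a / (q * z * Theta a q * Theta z' q9 * Theta b q3) *
      (a * Theta (q ^ 2 * c) q3 / Theta (q ^ 2 * z) q3 - Theta (q * c) q3 / Theta (q * z) q3)"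
proof -
  have q3: "q3 \<noteq> 0" "norm q3 < 1" "q3 ^ 3 = q9" and q9: "q9 \<noteq> 0" "norm q9 < 1"
    using q norm_power_lt_1 e(5,6) by (auto simp flip: power_mult)
  have z': "z' \<noteq> 0" using nz e by simp
  have d: "z ^ 3 / z' = 1" using nz e(4) by simp
  have T: "Theta 1 q9 = 0" "Theta (q3 * 1) q9 = qpoch_inf q3 q3" "Theta (q3 ^ 2 * 1) q9 = qpoch_inf q3 q3"
    using Theta_one[OF q9] Theta_base3[OF q3(1,2)] Theta_flipI[of q3 "q3 ^ 2" q9] q3 q9
    by (simp_all add: power2_eq_square power3_eq_cube mult.assoc)
  show ?thesis
    unfolding D3_eval[OF q nz z' D e(1-3) d e(5,6)] T
    by (simp add: algebra_simps power2_eq_square power3_eq_cube power4_eq_xxxx divide_inverse)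
qed

text \<open>For \<open>d = 1 / q ^ 3\<close> the middle term vanishes.\<close>

lemma D3_eval_3:
  assumes q: "q \<noteq> 0" "norm q < 1" and nz: "x \<noteq> 0" "z \<noteq> 0" and D: "D3_defined x z z' q"
    and e: "x * z = a" "x ^ 3 * z' = b" "b * z = c" "z' = q3 * z ^ 3" "q ^ 3 = q3" "q ^ 9 = q9"
  shows "D3 x z z' q = z' * qpoch_inf q3 q3 ^ 4 / (z * Theta a q * Theta z' q9 * Theta b q3) *
      (a ^ 2 / q * Theta (q ^ 2 * c) q3 / Theta (q ^ 2 * z) q3 - Theta c q3 / (q3 * Theta z q3))"
proof -
  have q3: "q3 \<noteq> 0" "norm q3 < 1" "q3 ^ 3 = q9" and q9: "q9 \<noteq> 0" "norm q9 < 1"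
    using q norm_power_lt_1 e(5,6) by (auto simp flip: power_mult)
  have z': "z' \<noteq> 0" using nz e q3 by simp
  have d: "z ^ 3 / z' = 1 / q3" using nz q3 e(4) by simp
  have "Theta (q3 ^ 2) q9 = qpoch_inf q3 q3"
    using Theta_base3[OF q3(1,2)] Theta_flipI[of q3 "q3 ^ 2" q9] q3 q9
    by (simp add: power2_eq_square power3_eq_cube mult.assoc)
  moreover have "q3 ^ 2 = q9 * (1 / q3)" using q3 by (simp add: power2_eq_square power3_eq_cube field_simps)
  ultimately have T1: "Theta (1 / q3) q9 = - (1 / q3) * qpoch_inf q3 q3"
    using Theta_downI[of "q3 ^ 2" q9 "1 / q3"] q3 q9 by simp
  have T2: "Theta (q3 * (1 / q3)) q9 = 0" "Theta (q3 ^ 2 * (1 / q3)) q9 = qpoch_inf q3 q3"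
    using Theta_one[OF q9] Theta_base3[OF q3(1,2)] q3 by (simp_all add: power2_eq_square)
  show ?thesis
    unfolding D3_eval[OF q nz z' D e(1-3) d e(5,6)] T1 T2
    by (simp add: algebra_simps power2_eq_square power3_eq_cube power4_eq_xxxx divide_inverse)
qed

text \<open>For \<open>d = 1 / q ^ 6\<close> the last term vanishes.\<close>

lemma D3_eval_6:
  assumes q: "q \<noteq> 0" "norm q < 1" and nz: "x \<noteq> 0" "z \<noteq> 0" and D: "D3_defined x z z' q"
    and e: "x * z = a" "x ^ 3 * z' = b" "b * z = c" "z' = q3 ^ 2 * z ^ 3" "q ^ 3 = q3" "q ^ 9 = q9"
  shows "D3 x z z' q = z' * qpoch_inf q3 q3 ^ 4 / (z * Theta a q * Theta z' q9 * Theta b q3) *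
      (a / (q * q3) * Theta (q * c) q3 / Theta (q * z) q3 - Theta c q3 / (q3 ^ 2 * Theta z q3))"
proof -
  have q3: "q3 \<noteq> 0" "norm q3 < 1" "q3 ^ 3 = q9" and q9: "q9 \<noteq> 0" "norm q9 < 1"
    using q norm_power_lt_1 e(5,6) by (auto simp flip: power_mult)
  have z': "z' \<noteq> 0" using nz e q3 by simp
  have d: "z ^ 3 / z' = 1 / q3 ^ 2" using nz q3 e(4) by simp
  have B: "Theta (q3 ^ 2) q9 = qpoch_inf q3 q3" "Theta q3 q9 = qpoch_inf q3 q3"
    using Theta_base3[OF q3(1,2)] Theta_flipI[of q3 "q3 ^ 2" q9] q3 q9
    by (simp_all add: power2_eq_square power3_eq_cube mult.assoc)
  have m: "q3 ^ 2 = q9 * (1 / q3)" "q3 = q9 * (1 / q3 ^ 2)" "q3 * (1 / q3 ^ 2) = 1 / q3" "q3 ^ 2 * (1 / q3 ^ 2) = 1"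
    using q3 by (simp_all add: power2_eq_square power3_eq_cube field_simps)
  have T1: "Theta (1 / q3) q9 = - (1 / q3) * qpoch_inf q3 q3"
    using Theta_downI[OF m(1) q9] B q3 by simp
  have T2: "Theta (1 / q3 ^ 2) q9 = - (1 / q3 ^ 2) * qpoch_inf q3 q3"
    using Theta_downI[OF m(2) q9] B q3 by simp
  show ?thesis
    unfolding D3_eval[OF q nz z' D e(1-3) d e(5,6)] m(3,4) T1 T2 Theta_one[OF q9]
    by (simp add: algebra_simps power2_eq_square power3_eq_cube power4_eq_xxxx divide_inverse)
qed

section \<open>Evaluations with base q\<close>

text \<open>The changes of base, solved for one theta value so that they can be used for rewriting.\<close>

lemma Theta_eq_split2:
  assumes q: "q \<noteq> 0" "norm q < 1" and x: "x \<noteq> 0" and e: "q ^ 2 = q2" "q * x = y"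
  shows "Theta x q = Theta x q2 * Theta y q2 * qpoch_inf q q / qpoch_inf q2 q2 ^ 2"
  using Theta_split2[OF q x] qpoch_inf_base_nonzero[of q2] norm_power_lt_1[OF q(2), of 2] e
  by (auto simp: field_simps)

lemma Theta_eq_split3:
  assumes q: "q \<noteq> 0" "norm q < 1" and x: "x \<noteq> 0" and e: "q ^ 3 = q3" "q * x = y" "q ^ 2 * x = w"
  shows "Theta x q = Theta x q3 * Theta y q3 * Theta w q3 * qpoch_inf q q / qpoch_inf q3 q3 ^ 3"
  using Theta_split3[OF q x] qpoch_inf_base_nonzero[of q3] norm_power_lt_1[OF q(2), of 3] e
  by (auto simp: field_simps)

lemma Theta_eq_square:
  assumes q: "q \<noteq> 0" "norm q < 1" and x: "x \<noteq> 0" and e: "q ^ 2 = q2" "x ^ 2 = y"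
  shows "Theta y q2 = Theta x q * Theta (- x) q * qpoch_inf q2 q2 / qpoch_inf q q ^ 2"
  using Theta_mult_neg[OF q x] qpoch_inf_base_nonzero[OF q(2)] e
  by (auto simp: field_simps)

text \<open>At \<open>z ^ 3\<close> the middle term of the expansion vanishes, and the first one too because
\<open>x ^ 3 z ^ 3 z' = q ^ 3\<close>. The last term is the claimed quotient.\<close>

lemma D3_quotient_z4_q3z9:
  fixes q z :: complex
  assumes q: "q \<noteq> 0" "norm q < 1" and z: "z \<noteq> 0"
    and D: "D3_defined (z powi (-4)) z (q ^ 3 * z ^ 9) q" "D3_defined (z powi (-4)) (z ^ 3) (q ^ 3 * z ^ 9) q"
    and nz: "Theta z q * Theta (z ^ 3) (q ^ 3) * Theta (q ^ 2 * z ^ 3) (q ^ 3) * Theta (q ^ 3 * z ^ 9) (q ^ 9) \<noteq> 0"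
  shows "D3 (z powi (-4)) z (q ^ 3 * z ^ 9) q = D3 (z powi (-4)) (z ^ 3) (q ^ 3 * z ^ 9) q \<and>
         D3 (z powi (-4)) (z ^ 3) (q ^ 3 * z ^ 9) q = (z ^ 5 * qpoch_inf q q * qpoch_inf (q ^ 3) (q ^ 3) ^ 4) / (Theta z q * Theta (z ^ 3) (q ^ 3) * Theta (q ^ 2 * z ^ 3) (q ^ 3) * Theta (q ^ 3 * z ^ 9) (q ^ 9))" (is "?L = ?R \<and> _")
proof -
  have q3: "q ^ 3 \<noteq> 0" "norm (q ^ 3) < 1" using q norm_power_lt_1 by auto
  have J: "qpoch_inf q q \<noteq> 0" using qpoch_inf_base_nonzero[OF q(2)] .
  have R: "?L = ?R"
    by (rule D3_reflect[OF q _ _ _ D(1) disjI1])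
       (use q z in \<open>(simp add: power_int_minus divide_simps power_mult_distrib; ((simp add: power2_eq_square; fail) | algebra))+\<close>)
  have nzs: "z powi (-4) \<noteq> 0" "z ^ 3 \<noteq> 0" "q ^ 3 * z ^ 9 \<noteq> 0" using q z by auto
  have e: "z powi (-4) * z ^ 3 = 1 / z" "(z powi (-4)) ^ 3 * (q ^ 3 * z ^ 9) = q ^ 3 / z ^ 3" "q ^ 3 / z ^ 3 * z ^ 3 = q ^ 3" "q ^ 3 * z ^ 9 = q ^ 3 * (z ^ 3) ^ 3"
    using q z by (simp add: power_int_minus divide_simps power_mult_distrib; ((simp add: power2_eq_square; fail) | algebra))+
  note F = D3_eval_3[OF q nzs(1,2) D(2) e refl refl]
  note N = D3_defined_imp_Theta_nonzero[OF q nzs D(2), unfolded e(1,2)]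
  note T1 = Theta_inverse[OF q z]
  have T2: "Theta (q ^ 3 / z ^ 3) (q ^ 3) = Theta (z ^ 3) (q ^ 3)"
    by (rule Theta_flipI) (use q z in \<open>(simp add: field_simps flip: power_Suc power_add; simp add: power2_eq_square)+\<close>)
  have T3: "Theta (q ^ 2) (q ^ 3) = Theta q (q ^ 3)"
    by (rule Theta_flipI) (use q z in \<open>(simp add: field_simps flip: power_Suc power_add; simp add: power2_eq_square)+\<close>)
  have T4: "Theta (q ^ 2 * q ^ 3) (q ^ 3) = - Theta (q ^ 2) (q ^ 3) / (q ^ 2)"
    by (rule Theta_upI[OF _ q3]) (use q z in \<open>simp_all add: field_simps flip: power_Suc power_add\<close>)
  have T5: "Theta (q ^ 3) (q ^ 3) = - Theta 1 (q ^ 3) / 1"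
    by (rule Theta_upI[OF _ q3]) (use q z in \<open>simp_all add: field_simps flip: power_Suc power_add\<close>)
  show ?thesis unfolding R F T1 T2 T4 T3 T5 Theta_one[OF q3] Theta_base3[OF q] using nz q z by (simp add: divide_simps) algebra
qed

text \<open>At \<open>z ^ 3\<close> the first and the last term vanish.\<close>

lemma D3_quotient_z4_q6z9:
  fixes q z :: complex
  assumes q: "q \<noteq> 0" "norm q < 1" and z: "z \<noteq> 0"
    and D: "D3_defined (z powi (-4)) z (q ^ 6 * z ^ 9) q" "D3_defined (z powi (-4)) (z ^ 3) (q ^ 6 * z ^ 9) q"
    and nz: "Theta z q * Theta (z ^ 3) (q ^ 3) * Theta (q * z ^ 3) (q ^ 3) * Theta (q ^ 6 * z ^ 9) (q ^ 9) \<noteq> 0"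
  shows "D3 (z powi (-4)) z (q ^ 6 * z ^ 9) q = D3 (z powi (-4)) (z ^ 3) (q ^ 6 * z ^ 9) q \<and>
         D3 (z powi (-4)) (z ^ 3) (q ^ 6 * z ^ 9) q = (z ^ 3 * qpoch_inf q q * qpoch_inf (q ^ 3) (q ^ 3) ^ 4) / (Theta z q * Theta (z ^ 3) (q ^ 3) * Theta (q * z ^ 3) (q ^ 3) * Theta (q ^ 6 * z ^ 9) (q ^ 9))" (is "?L = ?R \<and> _")
proof -
  have q3: "q ^ 3 \<noteq> 0" "norm (q ^ 3) < 1" using q norm_power_lt_1 by auto
  have J: "qpoch_inf q q \<noteq> 0" using qpoch_inf_base_nonzero[OF q(2)] .
  have R: "?L = ?R"
    by (rule D3_reflect[OF q _ _ _ D(1) disjI1])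
       (use q z in \<open>(simp add: power_int_minus divide_simps power_mult_distrib; ((simp add: power2_eq_square; fail) | algebra))+\<close>)
  have nzs: "z powi (-4) \<noteq> 0" "z ^ 3 \<noteq> 0" "q ^ 6 * z ^ 9 \<noteq> 0" using q z by auto
  have e: "z powi (-4) * z ^ 3 = 1 / z" "(z powi (-4)) ^ 3 * (q ^ 6 * z ^ 9) = q ^ 6 / z ^ 3" "q ^ 6 / z ^ 3 * z ^ 3 = q ^ 6" "q ^ 6 * z ^ 9 = (q ^ 3) ^ 2 * (z ^ 3) ^ 3"
    using q z by (simp add: power_int_minus divide_simps power_mult_distrib; ((simp add: power2_eq_square; fail) | algebra))+
  note F = D3_eval_6[OF q nzs(1,2) D(2) e refl refl]
  note N = D3_defined_imp_Theta_nonzero[OF q nzs D(2), unfolded e(1,2)]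
  note T1 = Theta_inverse[OF q z]
  have T2: "Theta (q ^ 6 / z ^ 3) (q ^ 3) = - Theta (q ^ 3 / z ^ 3) (q ^ 3) / (q ^ 3 / z ^ 3)"
    by (rule Theta_upI[OF _ q3]) (use q z in \<open>simp_all add: field_simps flip: power_Suc power_add\<close>)
  have T3: "Theta (q ^ 3 / z ^ 3) (q ^ 3) = Theta (z ^ 3) (q ^ 3)"
    by (rule Theta_flipI) (use q z in \<open>(simp add: field_simps flip: power_Suc power_add; simp add: power2_eq_square)+\<close>)
  have T4: "Theta (q * q ^ 6) (q ^ 3) = Theta q (q ^ 3) / (q ^ 3 * q ^ 2)"
    by (rule Theta_up2I[OF _ q3]) (use q z in \<open>simp_all add: field_simps flip: power_Suc power_add power_mult\<close>)
  have T5: "Theta (q ^ 6) (q ^ 3) = Theta 1 (q ^ 3) / (q ^ 3 * 1 ^ 2)"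
    by (rule Theta_up2I[OF _ q3]) (use q z in \<open>simp_all add: field_simps flip: power_Suc power_add power_mult\<close>)
  show ?thesis unfolding R F T1 T2 T3 T4 T5 Theta_one[OF q3] Theta_base3[OF q] using nz q z by (simp add: divide_simps) algebra
qed

text \<open>At \<open>u ^ 3\<close> the first and the last term remain. Over their common denominator
\<open>Theta (q ^ 2 u ^ 3) (q ^ 3)\<close> they form the sum in the quintuple product identity.\<close>

lemma D3_quotient_u5_q3u9:
  fixes q u :: complex
  assumes q: "q \<noteq> 0" "norm q < 1" and u: "u \<noteq> 0"
    and D: "D3_defined (u powi (-5)) (u ^ 2) (q ^ 3 * u ^ 9) q" "D3_defined (u powi (-5)) (u ^ 3) (q ^ 3 * u ^ 9) q"
    and nz: "Theta u q * Theta (u ^ 6) (q ^ 3) * Theta (q ^ 2 * u ^ 3) (q ^ 3) * Theta (q ^ 3 * u ^ 9) (q ^ 9) \<noteq> 0"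
  shows "D3 (u powi (-5)) (u ^ 2) (q ^ 3 * u ^ 9) q = D3 (u powi (-5)) (u ^ 3) (q ^ 3 * u ^ 9) q \<and>
         D3 (u powi (-5)) (u ^ 3) (q ^ 3 * u ^ 9) q = (u ^ 7 * qpoch_inf q q * qpoch_inf (q ^ 3) (q ^ 3) ^ 4) / (Theta u q * Theta (u ^ 6) (q ^ 3) * Theta (q ^ 2 * u ^ 3) (q ^ 3) * Theta (q ^ 3 * u ^ 9) (q ^ 9))" (is "?L = ?R \<and> _")
proof -
  have q3: "q ^ 3 \<noteq> 0" "norm (q ^ 3) < 1" using q norm_power_lt_1 by auto
  have J: "qpoch_inf q q \<noteq> 0" using qpoch_inf_base_nonzero[OF q(2)] .
  have R: "?L = ?R"
    by (rule D3_reflect[OF q _ _ _ D(1) disjI1])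
       (use q u in \<open>(simp add: power_int_minus divide_simps power_mult_distrib; ((simp add: power2_eq_square; fail) | algebra))+\<close>)
  have nzs: "u powi (-5) \<noteq> 0" "u ^ 3 \<noteq> 0" "q ^ 3 * u ^ 9 \<noteq> 0" using q u by auto
  have e: "u powi (-5) * u ^ 3 = 1 / u ^ 2" "(u powi (-5)) ^ 3 * (q ^ 3 * u ^ 9) = q ^ 3 / u ^ 6" "q ^ 3 / u ^ 6 * u ^ 3 = q ^ 3 / u ^ 3" "q ^ 3 * u ^ 9 = q ^ 3 * (u ^ 3) ^ 3"
    using q u by (simp add: power_int_minus divide_simps power_mult_distrib; ((simp add: power2_eq_square; fail) | algebra))+
  note F = D3_eval_3[OF q nzs(1,2) D(2) e refl refl]
  note N = D3_defined_imp_Theta_nonzero[OF q nzs D(2), unfolded e(1,2)]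
  have T1: "Theta (1 / u ^ 2) q = - Theta (u ^ 2) q / u ^ 2"
    by (rule Theta_inverse[OF q]) (use u in simp)
  have T2: "Theta (q ^ 3 / u ^ 6) (q ^ 3) = Theta (u ^ 6) (q ^ 3)"
    by (rule Theta_flipI) (use q u in \<open>(simp add: field_simps flip: power_Suc power_add; simp add: power2_eq_square)+\<close>)
  have T3: "Theta (q ^ 3 / u ^ 3) (q ^ 3) = Theta (u ^ 3) (q ^ 3)"
    by (rule Theta_flipI) (use q u in \<open>(simp add: field_simps flip: power_Suc power_add; simp add: power2_eq_square)+\<close>)
  have T4: "Theta (q ^ 2 * (q ^ 3 / u ^ 3)) (q ^ 3) = - Theta (q ^ 2 / u ^ 3) (q ^ 3) / (q ^ 2 / u ^ 3)"
    by (rule Theta_upI[OF _ q3]) (use q u in \<open>simp_all add: field_simps flip: power_Suc power_add\<close>)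
  have T5: "Theta (q ^ 2 / u ^ 3) (q ^ 3) = Theta (q * u ^ 3) (q ^ 3)"
    by (rule Theta_flipI) (use q u in \<open>(simp add: field_simps flip: power_Suc power_add; simp add: power2_eq_square)+\<close>)
  have n3: "Theta (u ^ 3) (q ^ 3) \<noteq> 0" using Theta_nonzero_base3[OF q nzs(2) N(1), of 0] by simp
  have Q: "Theta (u ^ 2) q = (Theta (q * u ^ 3) (q ^ 3) + u * Theta (q ^ 2 * u ^ 3) (q ^ 3)) * Theta u q / qpoch_inf q q"
    using quintuple_product[OF q u] J by (simp add: field_simps)
  have S: "Theta (q * u ^ 3) (q ^ 3) + u * Theta (q ^ 2 * u ^ 3) (q ^ 3) \<noteq> 0"
    using N(2) unfolding T1 Q by auto
  show ?thesis unfolding R F T1 T2 T3 T4 T5 Q using nz n3 J q u S by (simp add: divide_simps) algebra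
qed

text \<open>At \<open>u ^ 3\<close> the first two terms remain. Over their common denominator
\<open>Theta (q u ^ 3) (q ^ 3)\<close> they form the sum in the quintuple product identity.\<close>

lemma D3_quotient_u5_q6u9:
  fixes q u :: complex
  assumes q: "q \<noteq> 0" "norm q < 1" and u: "u \<noteq> 0"
    and D: "D3_defined (u powi (-5)) (u ^ 2) (q ^ 6 * u ^ 9) q" "D3_defined (u powi (-5)) (u ^ 3) (q ^ 6 * u ^ 9) q"
    and nz: "Theta u q * Theta (u ^ 6) (q ^ 3) * Theta (q * u ^ 3) (q ^ 3) * Theta (q ^ 6 * u ^ 9) (q ^ 9) \<noteq> 0"
  shows "D3 (u powi (-5)) (u ^ 2) (q ^ 6 * u ^ 9) q = D3 (u powi (-5)) (u ^ 3) (q ^ 6 * u ^ 9) q \<and>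
         D3 (u powi (-5)) (u ^ 3) (q ^ 6 * u ^ 9) q = (u ^ 5 * qpoch_inf q q * qpoch_inf (q ^ 3) (q ^ 3) ^ 4) / (Theta u q * Theta (u ^ 6) (q ^ 3) * Theta (q * u ^ 3) (q ^ 3) * Theta (q ^ 6 * u ^ 9) (q ^ 9))" (is "?L = ?R \<and> _")
proof -
  have q3: "q ^ 3 \<noteq> 0" "norm (q ^ 3) < 1" using q norm_power_lt_1 by auto
  have J: "qpoch_inf q q \<noteq> 0" using qpoch_inf_base_nonzero[OF q(2)] .
  have R: "?L = ?R"
    by (rule D3_reflect[OF q _ _ _ D(1) disjI1])
       (use q u in \<open>(simp add: power_int_minus divide_simps power_mult_distrib; ((simp add: power2_eq_square; fail) | algebra))+\<close>)
  have nzs: "u powi (-5) \<noteq> 0" "u ^ 3 \<noteq> 0" "q ^ 6 * u ^ 9 \<noteq> 0" using q u by auto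
  have e: "u powi (-5) * u ^ 3 = 1 / u ^ 2" "(u powi (-5)) ^ 3 * (q ^ 6 * u ^ 9) = q ^ 6 / u ^ 6" "q ^ 6 / u ^ 6 * u ^ 3 = q ^ 6 / u ^ 3" "q ^ 6 * u ^ 9 = (q ^ 3) ^ 2 * (u ^ 3) ^ 3"
    using q u by (simp add: power_int_minus divide_simps power_mult_distrib; ((simp add: power2_eq_square; fail) | algebra))+
  note F = D3_eval_6[OF q nzs(1,2) D(2) e refl refl]
  note N = D3_defined_imp_Theta_nonzero[OF q nzs D(2), unfolded e(1,2)]
  have T1: "Theta (1 / u ^ 2) q = - Theta (u ^ 2) q / u ^ 2"
    by (rule Theta_inverse[OF q]) (use u in simp)
  have T2: "Theta (q ^ 6 / u ^ 6) (q ^ 3) = - Theta (q ^ 3 / u ^ 6) (q ^ 3) / (q ^ 3 / u ^ 6)"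
    by (rule Theta_upI[OF _ q3]) (use q u in \<open>simp_all add: field_simps flip: power_Suc power_add\<close>)
  have T2': "Theta (q ^ 3 / u ^ 6) (q ^ 3) = Theta (u ^ 6) (q ^ 3)"
    by (rule Theta_flipI) (use q u in \<open>(simp add: field_simps flip: power_Suc power_add; simp add: power2_eq_square)+\<close>)
  have T3: "Theta (q ^ 6 / u ^ 3) (q ^ 3) = - Theta (q ^ 3 / u ^ 3) (q ^ 3) / (q ^ 3 / u ^ 3)"
    by (rule Theta_upI[OF _ q3]) (use q u in \<open>simp_all add: field_simps flip: power_Suc power_add\<close>)
  have T3': "Theta (q ^ 3 / u ^ 3) (q ^ 3) = Theta (u ^ 3) (q ^ 3)"
    by (rule Theta_flipI) (use q u in \<open>(simp add: field_simps flip: power_Suc power_add; simp add: power2_eq_square)+\<close>)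
  have T4: "Theta (q * (q ^ 6 / u ^ 3)) (q ^ 3) = Theta (q / u ^ 3) (q ^ 3) / (q ^ 3 * (q / u ^ 3) ^ 2)"
    by (rule Theta_up2I[OF _ q3]) (use q u in \<open>simp_all add: field_simps flip: power_Suc power_add power_mult\<close>)
  have T5: "Theta (q / u ^ 3) (q ^ 3) = Theta (q ^ 2 * u ^ 3) (q ^ 3)"
    by (rule Theta_flipI) (use q u in \<open>(simp add: field_simps flip: power_Suc power_add; simp add: power2_eq_square)+\<close>)
  have n3: "Theta (u ^ 3) (q ^ 3) \<noteq> 0" using Theta_nonzero_base3[OF q nzs(2) N(1), of 0] by simp
  have Q: "Theta (u ^ 2) q = (Theta (q * u ^ 3) (q ^ 3) + u * Theta (q ^ 2 * u ^ 3) (q ^ 3)) * Theta u q / qpoch_inf q q"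
    using quintuple_product[OF q u] J by (simp add: field_simps)
  have S: "Theta (q * u ^ 3) (q ^ 3) + u * Theta (q ^ 2 * u ^ 3) (q ^ 3) \<noteq> 0"
    using N(2) unfolding T1 Q by auto
  show ?thesis unfolding R F T1 T2 T2' T3 T3' T4 T5 Q using nz n3 J q u S by (simp add: divide_simps) algebra
qed

section \<open>Evaluations with base the square of q\<close>

lemma nome_powers:
  assumes "q \<noteq> 0" "norm q < 1"
  shows "q ^ 2 \<noteq> 0" "norm (q ^ 2) < 1" "q ^ 3 \<noteq> 0" "norm (q ^ 3) < 1" "q ^ 6 \<noteq> 0" "norm (q ^ 6) < 1"
    "qpoch_inf q q \<noteq> 0" "qpoch_inf (q ^ 2) (q ^ 2) \<noteq> 0" "qpoch_inf (q ^ 3) (q ^ 3) \<noteq> 0" "qpoch_inf (q ^ 6) (q ^ 6) \<noteq> 0"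
  using assms norm_power_lt_1 qpoch_inf_base_nonzero by auto

lemma power_of_power:
  fixes q :: complex
  shows "(q ^ 2) ^ 3 = q ^ 6" "(q ^ 2) ^ 9 = q ^ 18" "(q ^ 3) ^ 2 = q ^ 6" "(q ^ 2) ^ 2 = q ^ 4"
  by (simp_all flip: power_mult)

lemma Theta_nonzero_thirds:
  assumes "q \<noteq> 0" "norm q < 1" "z \<noteq> 0" "Theta z q \<noteq> 0"
  shows "Theta z (q ^ 3) \<noteq> 0" "Theta (q * z) (q ^ 3) \<noteq> 0" "Theta (q ^ 2 * z) (q ^ 3) \<noteq> 0"
  using Theta_nonzero_base3[OF assms, of 0] Theta_nonzero_base3[OF assms, of 1] Theta_nonzero_base3[OF assms, of 2]
  by simp_all

text \<open>The quintuple product identity with base \<open>q ^ 2\<close> at \<open>q z\<close>. Up to a constant,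
\<open>Theta (z ^ 2) (q ^ 2)\<close> is the product of \<open>Theta z (q ^ 2)\<close>, \<open>Theta (q z) (q ^ 2)\<close> and \<open>Theta (- z) q\<close>;
the middle factor cancels.\<close>

lemma quintuple_half:
  assumes q: "q \<noteq> 0" "norm q < 1" and z: "z \<noteq> 0" and nz: "Theta z (q ^ 2) \<noteq> 0" "Theta (q * z ^ 3) (q ^ 2) \<noteq> 0"
  shows "Theta (- z) q = (Theta (q * z ^ 3) (q ^ 6) - z ^ 2 * Theta (q ^ 5 * z ^ 3) (q ^ 6)) * qpoch_inf q q / Theta z (q ^ 2)"
proof -
  have q2: "q ^ 2 \<noteq> 0" "norm (q ^ 2) < 1" and q6: "q ^ 6 \<noteq> 0" "norm (q ^ 6) < 1"
    using q norm_power_lt_1 by auto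
  have J: "qpoch_inf q q \<noteq> 0" "qpoch_inf (q ^ 2) (q ^ 2) \<noteq> 0" using qpoch_inf_base_nonzero q q2 by auto
  have b: "Theta (q * z) (q ^ 2) \<noteq> 0"
  proof
    assume "Theta (q * z) (q ^ 2) = 0"
    then obtain n where n: "q * z = (q ^ 2) powi n" using Theta_eq_0_iff[OF q2, of "q * z"] q z by auto
    have n3: "(q ^ 2) powi n * (q ^ 2) powi n * (q ^ 2) powi n = (q ^ 2) powi (n + n + n)" by (metis power_int_add q2(1))
    have "q * z ^ 3 = (q * z) ^ 3 / q ^ 2" using q by (simp add: power2_eq_square power3_eq_cube)
    also have "(q * z) ^ 3 = (q ^ 2) powi n * (q ^ 2) powi n * (q ^ 2) powi n" unfolding n by (rule power3_eq_cube)
    also have "\<dots> / q ^ 2 = (q ^ 2) powi (n + n + n - 1)" unfolding n3 using q2 by (simp add: power_int_diff)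
    finally show False using nz(2) Theta_eq_0_iff[OF q2, of "q * z ^ 3"] q z by auto
  qed
  have c: "Theta z q = Theta z (q ^ 2) * Theta (q * z) (q ^ 2) * qpoch_inf q q / qpoch_inf (q ^ 2) (q ^ 2) ^ 2"
    by (rule Theta_eq_split2[OF q z refl refl])
  have s: "Theta (z ^ 2) (q ^ 2) = Theta z q * Theta (- z) q * qpoch_inf (q ^ 2) (q ^ 2) / qpoch_inf q q ^ 2"
    by (rule Theta_eq_square[OF q z refl refl])
  have m: "q ^ 2 * (q * z) ^ 3 = q ^ 5 * z ^ 3" "(q ^ 2) ^ 2 * (q * z) ^ 3 = q ^ 6 * (q * z ^ 3)" "(q ^ 2) ^ 3 = q ^ 6" "(q * z) ^ 2 = q ^ 2 * z ^ 2"
    by (simp_all add: power_mult_distrib flip: power_mult power_add mult.assoc power_Suc power_Suc2)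
  have "(Theta (q ^ 5 * z ^ 3) (q ^ 6) + q * z * Theta (q ^ 6 * (q * z ^ 3)) (q ^ 6)) * Theta (q * z) (q ^ 2) =
      qpoch_inf (q ^ 2) (q ^ 2) * Theta (q ^ 2 * z ^ 2) (q ^ 2)"
    using quintuple_product[OF q2, of "q * z"] q z unfolding m by simp
  moreover have "Theta (q ^ 6 * (q * z ^ 3)) (q ^ 6) = - Theta (q * z ^ 3) (q ^ 6) / (q * z ^ 3)"
    "Theta (q ^ 2 * z ^ 2) (q ^ 2) = - Theta (z ^ 2) (q ^ 2) / z ^ 2"
    by (rule Theta_step[OF q6] Theta_step[OF q2]; use q z in simp)+
  ultimately show ?thesis unfolding s c using b J nz q z by (simp add: divide_simps) algebra
qed

text \<open>The previous identity of degree \<open>5\<close> at \<open>q ^ 3 z\<close>.\<close>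

lemma theta_two_term_degree5_shifted:
  assumes q: "q \<noteq> 0" "norm q < 1" and z: "z \<noteq> 0"
  shows "(Theta (q * z) (q ^ 6) * Theta (q * z ^ 2) (q ^ 6) - z ^ 2 * Theta (q ^ 5 * z) (q ^ 6) * Theta (q ^ 5 * z ^ 2) (q ^ 6)) * qpoch_inf q q
       = qpoch_inf (q ^ 2) (q ^ 2) * Theta z (q ^ 2) * Theta (- z) (q ^ 3)"
proof -
  have q2: "q ^ 2 \<noteq> 0" "norm (q ^ 2) < 1" and q3: "q ^ 3 \<noteq> 0" "norm (q ^ 3) < 1" and q6: "q ^ 6 \<noteq> 0" "norm (q ^ 6) < 1"
    using q norm_power_lt_1 by auto
  have m: "q * (q ^ 3 * z) ^ 2 = q ^ 6 * (q * z ^ 2)" "q ^ 4 * (q ^ 3 * z) = q ^ 6 * (q * z)"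
     "q ^ 5 * (q ^ 3 * z) ^ 2 = q ^ 6 * (q ^ 5 * z ^ 2)" "q ^ 2 * (q ^ 3 * z) = q ^ 5 * z" "q * (q ^ 3 * z) = (q ^ 2) ^ 2 * z"
     "- (q ^ 3 * z) = q ^ 3 * (- z)"
    by (simp_all add: power_mult_distrib flip: power_mult power_add mult.assoc power_Suc power_Suc2)
  have T: "Theta (q ^ 6 * (q * z ^ 2)) (q ^ 6) = - Theta (q * z ^ 2) (q ^ 6) / (q * z ^ 2)"
    "Theta (q ^ 6 * (q * z)) (q ^ 6) = - Theta (q * z) (q ^ 6) / (q * z)"
    "Theta (q ^ 6 * (q ^ 5 * z ^ 2)) (q ^ 6) = - Theta (q ^ 5 * z ^ 2) (q ^ 6) / (q ^ 5 * z ^ 2)"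
    "Theta ((q ^ 2) ^ 2 * z) (q ^ 2) = Theta z (q ^ 2) / (q ^ 2 * z ^ 2)"
    "Theta (q ^ 3 * (- z)) (q ^ 3) = - Theta (- z) (q ^ 3) / (- z)"
    by (rule Theta_step[OF q6] Theta_step[OF q3] Theta_up2I[OF refl q2]; use q z in simp)+
  show ?thesis
    using theta_two_term_degree5[OF q, of "q ^ 3 * z"] q z unfolding m T
    by (simp add: divide_simps) algebra
qed

text \<open>At \<open>q z ^ 3\<close> one has \<open>x ^ 3 z z' = q ^ 4\<close>, so the middle term contains
\<open>Theta (q ^ 6) (q ^ 6) = 0\<close>. The numerators of the other two are constants in \<open>z\<close>; over a
common denominator they give the difference in \<open>quintuple_half\<close>.\<close>

lemma D3_quotient_qz4_z9:
  fixes q z :: complex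
  assumes q: "q \<noteq> 0" "norm q < 1" and z: "z \<noteq> 0"
    and D: "D3_defined (q * z powi (-4)) z (z ^ 9) (q ^ 2)" "D3_defined (q * z powi (-4)) (q * z ^ 3) (z ^ 9) (q ^ 2)"
    and nz: "qpoch_inf q q * Theta (q * z ^ 3) (q ^ 2) * Theta (z ^ 9) (q ^ 18) \<noteq> 0"
  shows "D3 (q * z powi (-4)) z (z ^ 9) (q ^ 2) = D3 (q * z powi (-4)) (q * z ^ 3) (z ^ 9) (q ^ 2) \<and>
         D3 (q * z powi (-4)) (q * z ^ 3) (z ^ 9) (q ^ 2) = - ((q powi (-1) * z ^ 4 * qpoch_inf (q ^ 2) (q ^ 2) ^ 2 * Theta (q ^ 3) (q ^ 18) * Theta (- z) q) / (qpoch_inf q q * Theta (q * z ^ 3) (q ^ 2) * Theta (z ^ 9) (q ^ 18)))" (is "?L = ?R \<and> _")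
proof -
  note q2 = nome_powers(1,2)[OF q] and q3 = nome_powers(3,4)[OF q] and q6 = nome_powers(5,6)[OF q]
  note p = power_of_power[of q] and J = nome_powers(7-10)[OF q]
  have R: "?L = ?R"
    by (rule D3_reflect[OF q2 _ _ _ D(1) disjI2])
       (use q z in \<open>(simp add: power_int_minus divide_simps power_mult_distrib; ((simp add: power2_eq_square; fail) | algebra))+\<close>)
  have nzs: "q * z powi (-4) \<noteq> 0" "q * z ^ 3 \<noteq> 0" "z ^ 9 \<noteq> 0" using q z by auto
  have e: "q * z powi (-4) * (q * z ^ 3) = q ^ 2 / z" "(q * z powi (-4)) ^ 3 * z ^ 9 = q ^ 3 / z ^ 3" "q ^ 3 / z ^ 3 * (q * z ^ 3) = q ^ 4" "(q * z ^ 3) ^ 3 / z ^ 9 = q ^ 3"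
    using q z by (simp add: power_int_minus divide_simps power_mult_distrib; ((simp add: power2_eq_square; fail) | algebra))+
  note F = D3_eval[OF q2 nzs D(2) e p(1,2), unfolded p]
  note N = D3_defined_imp_Theta_nonzero[OF q2 nzs D(2), unfolded e(1,2) p]
  note N3 = Theta_nonzero_thirds[OF q2 nzs(2) N(1), unfolded p]
  have T0: "Theta (q ^ 2) (q ^ 6) = qpoch_inf (q ^ 2) (q ^ 2)"
    using Theta_base3[OF q2] by (simp only: p)
  have T1: "Theta (q ^ 2 / z) (q ^ 2) = Theta z (q ^ 2)"
    by (rule Theta_flipI) (use q z in \<open>(simp add: field_simps flip: power_Suc power_add; simp add: power2_eq_square)+\<close>)
  have T2: "Theta (q ^ 3 / z ^ 3) (q ^ 6) = Theta (q ^ 3 * z ^ 3) (q ^ 6)"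
    by (rule Theta_flipI) (use q z in \<open>(simp add: field_simps flip: power_Suc power_add; simp add: power2_eq_square)+\<close>)
  have T3: "Theta (q ^ 4) (q ^ 6) = Theta (q ^ 2) (q ^ 6)"
    by (rule Theta_flipI) (use q z in \<open>(simp add: field_simps flip: power_Suc power_add; simp add: power2_eq_square)+\<close>)
  have T4: "Theta (q ^ 2 * q ^ 4) (q ^ 6) = - Theta 1 (q ^ 6) / 1"
    by (rule Theta_upI[OF _ q6]) (use q z in \<open>simp_all add: field_simps flip: power_Suc power_add\<close>)
  have T5: "Theta (q ^ 4 * q ^ 4) (q ^ 6) = - Theta (q ^ 2) (q ^ 6) / (q ^ 2)"
    by (rule Theta_upI[OF _ q6]) (use q z in \<open>simp_all add: field_simps flip: power_Suc power_add\<close>)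
  have T6: "Theta ((q ^ 6) ^ 2 * q ^ 3) (q ^ 18) = Theta (q ^ 3) (q ^ 18)"
    by (rule Theta_flipI) (use q z in \<open>(simp add: field_simps flip: power_Suc power_add; simp add: power2_eq_square)+\<close>)
  have m: "q ^ 4 * (q * z ^ 3) = q ^ 5 * z ^ 3" "q ^ 2 * (q * z ^ 3) = q ^ 3 * z ^ 3"
    by (simp_all flip: power_Suc2 mult.assoc)
  have a: "Theta z (q ^ 2) \<noteq> 0" using N(2) unfolding T1 .
  note W = N3[unfolded m]
  have S: "Theta (q * z ^ 3) (q ^ 2) = Theta (q * z ^ 3) (q ^ 6) * Theta (q ^ 3 * z ^ 3) (q ^ 6) * Theta (q ^ 5 * z ^ 3) (q ^ 6)
      * qpoch_inf (q ^ 2) (q ^ 2) / qpoch_inf (q ^ 6) (q ^ 6) ^ 3"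
    by (rule Theta_eq_split3[OF q2 nzs(2) p(1) m(2)]) (simp only: p m)
  have i: "q powi (-1) = 1 / q" by (simp add: power_int_minus field_simps)
  show ?thesis unfolding R F T1 T2 T4 T5 T3 T6 T0 Theta_one[OF q6] m S quintuple_half[OF q z a N(1)] i
    using nz a W J q z by (simp add: divide_simps) algebra
qed

text \<open>At \<open>1 / (q x)\<close> the middle term vanishes. Over a common denominator the other two form the
sum of degree two.\<close>

lemma D3_quotient_x_q3x3:
  fixes q x :: complex
  assumes q: "q \<noteq> 0" "norm q < 1" and x: "x \<noteq> 0"
    and D: "D3_defined x q (q ^ 3 * x powi (-3)) (q ^ 2)" "D3_defined x (q powi (-1) * x powi (-1)) (q ^ 3 * x powi (-3)) (q ^ 2)"
    and nz: "qpoch_inf (q ^ 3) (q ^ 3) * Theta x q * Theta (q ^ 2 * x) (q ^ 6) * Theta (q ^ 3 * x powi (-3)) (q ^ 18) \<noteq> 0"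
  shows "D3 x q (q ^ 3 * x powi (-3)) (q ^ 2) = D3 x (q powi (-1) * x powi (-1)) (q ^ 3 * x powi (-3)) (q ^ 2) \<and>
         D3 x (q powi (-1) * x powi (-1)) (q ^ 3 * x powi (-3)) (q ^ 2) = - ((x powi (-1) * qpoch_inf (q ^ 6) (q ^ 6) ^ 3 * Theta x (q ^ 2) * Theta (q ^ 4 * x ^ 2) (q ^ 6)) / (qpoch_inf (q ^ 3) (q ^ 3) * Theta x q * Theta (q ^ 2 * x) (q ^ 6) * Theta (q ^ 3 * x powi (-3)) (q ^ 18)))" (is "?L = ?R \<and> _")
proof -
  note q2 = nome_powers(1,2)[OF q] and q3 = nome_powers(3,4)[OF q] and q6 = nome_powers(5,6)[OF q]
  note p = power_of_power[of q] and J = nome_powers(7-10)[OF q]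
  have R: "?L = ?R"
    by (rule D3_reflect[OF q2 _ _ _ D(1) disjI1])
       (use q x in \<open>(simp add: power_int_minus divide_simps power_mult_distrib; ((simp add: power2_eq_square; fail) | algebra))+\<close>)
  have i: "x powi (-3) = 1 / x ^ 3" "q powi (-1) * x powi (-1) = 1 / (q * x)" "x powi (-1) = 1 / x" by (simp_all add: power_int_minus field_simps)
  have nzs: "x \<noteq> 0" "1 / (q * x) \<noteq> 0" "q ^ 3 * (1 / x ^ 3) \<noteq> 0" using q x by auto
  have e: "x * (1 / (q * x)) = 1 / q" "x ^ 3 * (q ^ 3 * (1 / x ^ 3)) = q ^ 3" "q ^ 3 * (1 / (q * x)) = q ^ 2 / x" "q ^ 3 * (1 / x ^ 3) = q ^ 6 * (1 / (q * x)) ^ 3"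
    using q x by (simp add: power_int_minus divide_simps power_mult_distrib; ((simp add: power2_eq_square; fail) | algebra))+
  note F = D3_eval_3[OF q2 nzs(1,2) D(2)[unfolded i(2), unfolded i] e p(1,2), unfolded p]
  note N = D3_defined_imp_Theta_nonzero[OF q2 nzs D(2)[unfolded i(2), unfolded i], unfolded e(1,2) p]
  note N3 = Theta_nonzero_thirds[OF q2 nzs(2) N(1), unfolded p]
  note T1 = Theta_inverse[OF q2 q(1)]
  have T2: "Theta (q ^ 4 * (q ^ 2 / x)) (q ^ 6) = Theta x (q ^ 6)"
    by (rule Theta_flipI) (use q x in \<open>(simp add: field_simps flip: power_Suc power_add; simp add: power2_eq_square)+\<close>)
  have T3: "Theta (q ^ 4 * (1 / (q * x))) (q ^ 6) = Theta (q ^ 3 * x) (q ^ 6)"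
    by (rule Theta_flipI) (use q x in \<open>(simp add: field_simps flip: power_Suc power_add; simp add: power2_eq_square)+\<close>)
  have T4: "Theta (q ^ 2 / x) (q ^ 6) = Theta (q ^ 4 * x) (q ^ 6)"
    by (rule Theta_flipI) (use q x in \<open>(simp add: field_simps flip: power_Suc power_add; simp add: power2_eq_square)+\<close>)
  have T5: "Theta (1 / (q * x)) (q ^ 6) = - Theta (q * x) (q ^ 6) / (q * x)"
    by (rule Theta_inverse[OF q6]) (use q x in simp)
  have B1: "Theta q (q ^ 2) = qpoch_inf q q ^ 2 / qpoch_inf (q ^ 2) (q ^ 2)"
    using Theta_base2[OF q] J by (simp add: field_simps)
  have B2: "Theta (q ^ 3) (q ^ 6) = qpoch_inf (q ^ 3) (q ^ 3) ^ 2 / qpoch_inf (q ^ 6) (q ^ 6)"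
    using Theta_base2[OF q3] J unfolding p by (simp add: field_simps)
  have L: "Theta (- x / q) (q ^ 3) = (x * Theta (q ^ 4 * x) (q ^ 6) * Theta (q ^ 3 * x) (q ^ 6) + q * Theta x (q ^ 6) * Theta (q * x) (q ^ 6)) / (q * qpoch_inf q q)"
    using theta_two_term_degree2[OF q x] q J by (simp add: field_simps)
  have L2: "Theta (- (q ^ 2 * x)) (q ^ 3) = - Theta (- x / q) (q ^ 3) / (- x / q)"
    by (rule Theta_upI[OF _ q3]) (use q x in \<open>simp_all add: field_simps flip: power_Suc power_add\<close>)
  note S1 = Theta_eq_split2[OF q x refl refl]
  have S2: "Theta (q * x) (q ^ 2) = Theta (q * x) (q ^ 6) * Theta (q ^ 3 * x) (q ^ 6) * Theta (q ^ 5 * x) (q ^ 6) * qpoch_inf (q ^ 2) (q ^ 2) / qpoch_inf (q ^ 6) (q ^ 6) ^ 3"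
    by (rule Theta_eq_split3[OF q2 _ p(1)]) (use q x in \<open>simp_all flip: power_mult power_Suc power_Suc2 power_add mult.assoc\<close>)
  have S3: "Theta (q ^ 2 * x) (q ^ 3) = Theta (q ^ 2 * x) (q ^ 6) * Theta (q ^ 5 * x) (q ^ 6) * qpoch_inf (q ^ 3) (q ^ 3) / qpoch_inf (q ^ 6) (q ^ 6) ^ 2"
    by (rule Theta_eq_split2[OF q3 _ p(3)]) (use q x in \<open>simp_all flip: power_mult power_Suc power_Suc2 power_add mult.assoc\<close>)
  have S4: "Theta (q ^ 4 * x ^ 2) (q ^ 6) = Theta (q ^ 2 * x) (q ^ 3) * Theta (- (q ^ 2 * x)) (q ^ 3) * qpoch_inf (q ^ 6) (q ^ 6) / qpoch_inf (q ^ 3) (q ^ 3) ^ 2"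
    by (rule Theta_eq_square[OF q3 _ p(3)]) (use q x in \<open>simp_all add: power_mult_distrib flip: power_mult\<close>)
  have nz': "Theta x (q ^ 2) \<noteq> 0" "Theta (q * x) (q ^ 6) \<noteq> 0" "Theta (q ^ 3 * x) (q ^ 6) \<noteq> 0" "Theta (q ^ 5 * x) (q ^ 6) \<noteq> 0"
    "Theta (q ^ 2 * x) (q ^ 6) \<noteq> 0" "Theta (q ^ 3 * (1 / x ^ 3)) (q ^ 18) \<noteq> 0"
    using nz unfolding S1 S2 i by auto
  show ?thesis unfolding i(2) unfolding i R[unfolded i(2), unfolded i] F T1 T2 T3 T4 T5 B1 B2 S1 S2 S4 S3 L2 L
    using nz' J q x by (simp add: divide_simps) algebra
qed

text \<open>At \<open>z\<close> itself the first term vanishes. Over a common denominator the other two form the sum of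
degree five.\<close>

lemma D3_quotient_qz2_z3:
  fixes q z :: complex
  assumes q: "q \<noteq> 0" "norm q < 1" and z: "z \<noteq> 0"
    and D: "D3_defined (q * z powi (-2)) z (z ^ 3) (q ^ 2)" "D3_defined (q * z powi (-2)) (q * z) (z ^ 3) (q ^ 2)"
    and nz: "Theta z q * Theta (q ^ 3 * z) (q ^ 6) * Theta (q ^ 3 * z ^ 3) (q ^ 6) * Theta (z ^ 3) (q ^ 18) \<noteq> 0"
  shows "D3 (q * z powi (-2)) z (z ^ 3) (q ^ 2) = D3 (q * z powi (-2)) (q * z) (z ^ 3) (q ^ 2) \<and>
         D3 (q * z powi (-2)) (q * z) (z ^ 3) (q ^ 2) = - ((q powi (-1) * z * qpoch_inf (q ^ 3) (q ^ 3) * qpoch_inf (q ^ 6) (q ^ 6) ^ 2 * Theta (q * z) (q ^ 2) * Theta (z ^ 2) (q ^ 6)) / (Theta z q * Theta (q ^ 3 * z) (q ^ 6) * Theta (q ^ 3 * z ^ 3) (q ^ 6) * Theta (z ^ 3) (q ^ 18)))" (is "?L = ?R \<and> _")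
proof -
  note q2 = nome_powers(1,2)[OF q] and q3 = nome_powers(3,4)[OF q] and q6 = nome_powers(5,6)[OF q]
  note p = power_of_power[of q] and J = nome_powers(7-10)[OF q]
  have R: "?L = ?R"
    by (rule D3_reflect[OF q2 _ _ _ D(1) disjI2])
       (use q z in \<open>(simp add: power_int_minus divide_simps power_mult_distrib; ((simp add: power2_eq_square; fail) | algebra))+\<close>)
  have nzs: "q * z powi (-2) \<noteq> 0" "z \<noteq> 0" "z ^ 3 \<noteq> 0" using q z by auto
  have e: "q * z powi (-2) * z = q / z" "(q * z powi (-2)) ^ 3 * z ^ 3 = q ^ 3 / z ^ 3" "q ^ 3 / z ^ 3 * z = q ^ 3 / z ^ 2" "z ^ 3 = z ^ 3"
    using q z by (simp add: power_int_minus divide_simps power_mult_distrib; ((simp add: power2_eq_square; fail) | algebra))+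
  note F = D3_eval_0[OF q2 nzs(1,2) D(1) e p(1,2), unfolded p]
  note N = D3_defined_imp_Theta_nonzero[OF q2 nzs D(1), unfolded e(1,2) p]
  note N3 = Theta_nonzero_thirds[OF q2 nzs(2) N(1), unfolded p]
  have T1: "Theta (q / z) (q ^ 2) = Theta (q * z) (q ^ 2)"
    by (rule Theta_flipI) (use q z in \<open>(simp add: field_simps flip: power_Suc power_add; simp add: power2_eq_square)+\<close>)
  have T2: "Theta (q ^ 3 / z ^ 3) (q ^ 6) = Theta (q ^ 3 * z ^ 3) (q ^ 6)"
    by (rule Theta_flipI) (use q z in \<open>(simp add: field_simps flip: power_Suc power_add; simp add: power2_eq_square)+\<close>)
  have T3: "Theta (q ^ 4 * (q ^ 3 / z ^ 2)) (q ^ 6) = - Theta (q / z ^ 2) (q ^ 6) / (q / z ^ 2)"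
    by (rule Theta_upI[OF _ q6]) (use q z in \<open>simp_all add: field_simps flip: power_Suc power_add\<close>)
  have T4: "Theta (q / z ^ 2) (q ^ 6) = Theta (q ^ 5 * z ^ 2) (q ^ 6)"
    by (rule Theta_flipI) (use q z in \<open>(simp add: field_simps flip: power_Suc power_add; simp add: power2_eq_square)+\<close>)
  have T5: "Theta (q ^ 2 * (q ^ 3 / z ^ 2)) (q ^ 6) = Theta (q * z ^ 2) (q ^ 6)"
    by (rule Theta_flipI) (use q z in \<open>(simp add: field_simps flip: power_Suc power_add; simp add: power2_eq_square)+\<close>)
  have c: "Theta (q * z) (q ^ 2) \<noteq> 0"
    using N(2) unfolding T1 .
  have L: "Theta (- z) (q ^ 3) = (Theta (q * z ^ 2) (q ^ 6) * Theta (q ^ 4 * z) (q ^ 6) + z * Theta (q ^ 5 * z ^ 2) (q ^ 6) * Theta (q ^ 2 * z) (q ^ 6)) * qpoch_inf q q / (qpoch_inf (q ^ 2) (q ^ 2) * Theta (q * z) (q ^ 2))"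
    using theta_two_term_degree5[OF q z] c J by (simp add: field_simps)
  note S1 = Theta_eq_split2[OF q z refl refl]
  have S2: "Theta z (q ^ 2) = Theta z (q ^ 6) * Theta (q ^ 2 * z) (q ^ 6) * Theta (q ^ 4 * z) (q ^ 6) * qpoch_inf (q ^ 2) (q ^ 2) / qpoch_inf (q ^ 6) (q ^ 6) ^ 3"
    by (rule Theta_eq_split3[OF q2 z p(1) refl]) (simp only: p)
  note S3 = Theta_eq_split2[OF q3 z p(3) refl]
  note S4 = Theta_eq_square[OF q3 z p(3) refl]
  have i: "q powi (-1) = 1 / q"
    by (simp add: power_int_minus field_simps)
  obtain K where K: "Theta (q * z ^ 2) (q ^ 6) * Theta (q ^ 4 * z) (q ^ 6) + z * Theta (q ^ 5 * z ^ 2) (q ^ 6) * Theta (q ^ 2 * z) (q ^ 6) = K" by blast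
  have F': "D3 (q * z powi (-2)) z (z ^ 3) (q ^ 2) = - (z * qpoch_inf (q ^ 6) (q ^ 6) ^ 4 * K /
      (q * Theta (q * z) (q ^ 2) * Theta (z ^ 3) (q ^ 18) * Theta (q ^ 3 * z ^ 3) (q ^ 6) * Theta (q ^ 2 * z) (q ^ 6) * Theta (q ^ 4 * z) (q ^ 6)))"
    unfolding F T1 T2 T3 T4 T5 K[symmetric] using N3 q z by (simp add: divide_simps) algebra
  show ?thesis unfolding R[symmetric] unfolding F' S1 S2 S4 S3 L K i
    using nz c N3 J q z by (simp add: divide_simps) (simp add: eval_nat_numeral mult_ac)
qed

text \<open>At \<open>q\<close> the middle term vanishes. The denominators of the other two agree, and the numerators
form the sum in the quintuple product identity with base \<open>q ^ 2\<close>.\<close>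

lemma D3_quotient_x_q9:
  fixes q x :: complex
  assumes q: "q \<noteq> 0" "norm q < 1" and x: "x \<noteq> 0"
    and D: "D3_defined x q (q ^ 9) (q ^ 2)" "D3_defined x (q * x powi (-1)) (q ^ 9) (q ^ 2)"
    and nz: "Theta (q ^ 9) (q ^ 18) * Theta x q * Theta (q * x ^ 2) (q ^ 2) * Theta (q ^ 3 * x ^ 3) (q ^ 6) \<noteq> 0"
  shows "D3 x q (q ^ 9) (q ^ 2) = D3 x (q * x powi (-1)) (q ^ 9) (q ^ 2) \<and>
         D3 x (q * x powi (-1)) (q ^ 9) (q ^ 2) = - ((q * x powi (-1) * Theta (- q) (q ^ 4) * qpoch_inf (q ^ 3) (q ^ 3) * qpoch_inf (q ^ 6) (q ^ 6) ^ 2 * Theta (x ^ 2) q) / (Theta (q ^ 9) (q ^ 18) * Theta x q * Theta (q * x ^ 2) (q ^ 2) * Theta (q ^ 3 * x ^ 3) (q ^ 6)))" (is "?L = ?R \<and> _")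
proof -
  note q2 = nome_powers(1,2)[OF q] and q3 = nome_powers(3,4)[OF q] and q6 = nome_powers(5,6)[OF q]
  note p = power_of_power[of q] and J = nome_powers(7-10)[OF q]
  have R: "?L = ?R"
    by (rule D3_reflect[OF q2 _ _ _ D(1) disjI2])
       (use q x in \<open>(simp add: power_int_minus divide_simps power_mult_distrib; ((simp add: power2_eq_square; fail) | algebra))+\<close>)
  have nzs: "x \<noteq> 0" "q \<noteq> 0" "q ^ 9 \<noteq> 0" using q x by auto
  have e: "x * q = q * x" "x ^ 3 * q ^ 9 = q ^ 9 * x ^ 3" "q ^ 9 * x ^ 3 * q = q ^ 10 * x ^ 3" "q ^ 9 = q ^ 6 * q ^ 3"
    using q x by (simp add: power_int_minus divide_simps power_mult_distrib; ((simp add: power2_eq_square; fail) | algebra))+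
  note F = D3_eval_3[OF q2 nzs(1,2) D(1) e p(1,2), unfolded p]
  note N = D3_defined_imp_Theta_nonzero[OF q2 nzs D(1), unfolded e(1,2) p]
  note N3 = Theta_nonzero_thirds[OF q2 nzs(2) N(1), unfolded p]
  have T1: "Theta (q ^ 9 * x ^ 3) (q ^ 6) = - Theta (q ^ 3 * x ^ 3) (q ^ 6) / (q ^ 3 * x ^ 3)"
    by (rule Theta_upI[OF _ q6]) (use q x in \<open>simp_all add: field_simps flip: power_Suc power_add\<close>)
  have T2: "Theta (q ^ 4 * (q ^ 10 * x ^ 3)) (q ^ 6) = Theta (q ^ 2 * x ^ 3) (q ^ 6) / (q ^ 6 * (q ^ 2 * x ^ 3) ^ 2)"
    by (rule Theta_up2I[OF _ q6]) (use q x in \<open>simp_all add: field_simps flip: power_Suc power_add power_mult\<close>)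
  have T3: "Theta (q ^ 4 * q) (q ^ 6) = Theta q (q ^ 6)"
    by (rule Theta_flipI) (use q x in \<open>(simp add: field_simps flip: power_Suc power_add; simp add: power2_eq_square)+\<close>)
  have T4: "Theta (q ^ 10 * x ^ 3) (q ^ 6) = - Theta (q ^ 4 * x ^ 3) (q ^ 6) / (q ^ 4 * x ^ 3)"
    by (rule Theta_upI[OF _ q6]) (use q x in \<open>simp_all add: field_simps flip: power_Suc power_add\<close>)
  have B1: "Theta q (q ^ 6) = qpoch_inf q q * qpoch_inf (q ^ 6) (q ^ 6) ^ 2 / (qpoch_inf (q ^ 2) (q ^ 2) * qpoch_inf (q ^ 3) (q ^ 3))"
    using Theta_base6[OF q] J by (simp add: field_simps)
  have B2: "Theta (- q) (q ^ 4) = qpoch_inf (q ^ 2) (q ^ 2) ^ 2 / qpoch_inf q q"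
    using Theta_neg_base4[OF q] J by (simp add: field_simps)
  note S1 = Theta_eq_split2[OF q x refl refl]
  have S2: "Theta (x ^ 2) q = Theta (x ^ 2) (q ^ 2) * Theta (q * x ^ 2) (q ^ 2) * qpoch_inf q q / qpoch_inf (q ^ 2) (q ^ 2) ^ 2"
    by (rule Theta_eq_split2[OF q _ refl refl]) (use x in simp)
  have Q: "Theta (x ^ 2) (q ^ 2) = (Theta (q ^ 2 * x ^ 3) (q ^ 6) + x * Theta (q ^ 4 * x ^ 3) (q ^ 6)) * Theta x (q ^ 2) / qpoch_inf (q ^ 2) (q ^ 2)"
    using quintuple_product[OF q2 x, unfolded p] J by (simp add: field_simps)
  have i: "x powi (-1) = 1 / x"
    by (simp add: power_int_minus field_simps)
  have nz': "Theta x (q ^ 2) \<noteq> 0" "Theta (q * x) (q ^ 2) \<noteq> 0" using nz unfolding S1 by auto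
  show ?thesis unfolding R[symmetric] unfolding F T1 T2 T3 T4 B1 B2 S1 S2 Q i
    using nz nz' J q x by (simp add: divide_simps) algebra
qed

text \<open>At \<open>q z ^ 2\<close> the middle term vanishes. Over a common denominator the other two form the
shifted sum of degree five.\<close>

lemma D3_quotient_qz3_q9z6:
  fixes q z :: complex
  assumes q: "q \<noteq> 0" "norm q < 1" and z: "z \<noteq> 0"
    and D: "D3_defined (q * z powi (-3)) z (q ^ 9 * z ^ 6) (q ^ 2)" "D3_defined (q * z powi (-3)) (q * z ^ 2) (q ^ 9 * z ^ 6) (q ^ 2)"
    and nz: "Theta (q * z ^ 2) (q ^ 2) * Theta z (q ^ 3) * Theta (z ^ 3) (q ^ 6) * Theta (q ^ 9 * z ^ 6) (q ^ 18) \<noteq> 0"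
  shows "D3 (q * z powi (-3)) z (q ^ 9 * z ^ 6) (q ^ 2) = D3 (q * z powi (-3)) (q * z ^ 2) (q ^ 9 * z ^ 6) (q ^ 2) \<and>
         D3 (q * z powi (-3)) (q * z ^ 2) (q ^ 9 * z ^ 6) (q ^ 2) = - ((z * Theta (- q) (q ^ 4) * qpoch_inf (q ^ 3) (q ^ 3) * qpoch_inf (q ^ 6) (q ^ 6) ^ 2 * Theta (z ^ 2) (q ^ 3)) / (Theta (q * z ^ 2) (q ^ 2) * Theta z (q ^ 3) * Theta (z ^ 3) (q ^ 6) * Theta (q ^ 9 * z ^ 6) (q ^ 18)))" (is "?L = ?R \<and> _")
proof -
  note q2 = nome_powers(1,2)[OF q] and q3 = nome_powers(3,4)[OF q] and q6 = nome_powers(5,6)[OF q]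
  note p = power_of_power[of q] and J = nome_powers(7-10)[OF q]
  have R: "?L = ?R"
    by (rule D3_reflect[OF q2 _ _ _ D(1) disjI2])
       (use q z in \<open>(simp add: power_int_minus divide_simps power_mult_distrib; ((simp add: power2_eq_square; fail) | algebra))+\<close>)
  have nzs: "q * z powi (-3) \<noteq> 0" "q * z ^ 2 \<noteq> 0" "q ^ 9 * z ^ 6 \<noteq> 0" using q z by auto
  have e: "q * z powi (-3) * (q * z ^ 2) = q ^ 2 / z" "(q * z powi (-3)) ^ 3 * (q ^ 9 * z ^ 6) = q ^ 12 / z ^ 3" "q ^ 12 / z ^ 3 * (q * z ^ 2) = q ^ 13 / z" "q ^ 9 * z ^ 6 = q ^ 6 * (q * z ^ 2) ^ 3"
    using q z by (simp add: power_int_minus divide_simps power_mult_distrib; ((simp add: power2_eq_square; fail) | algebra))+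
  note F = D3_eval_3[OF q2 nzs(1,2) D(2) e p(1,2), unfolded p]
  note N = D3_defined_imp_Theta_nonzero[OF q2 nzs D(2), unfolded e(1,2) p]
  note N3 = Theta_nonzero_thirds[OF q2 nzs(2) N(1), unfolded p]
  have T1: "Theta (q ^ 2 / z) (q ^ 2) = Theta z (q ^ 2)"
    by (rule Theta_flipI) (use q z in \<open>(simp add: field_simps flip: power_Suc power_add; simp add: power2_eq_square)+\<close>)
  have T2: "Theta (q ^ 12 / z ^ 3) (q ^ 6) = - Theta (q ^ 6 / z ^ 3) (q ^ 6) / (q ^ 6 / z ^ 3)"
    by (rule Theta_upI[OF _ q6]) (use q z in \<open>simp_all add: field_simps flip: power_Suc power_add\<close>)
  have T2': "Theta (q ^ 6 / z ^ 3) (q ^ 6) = Theta (z ^ 3) (q ^ 6)"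
    by (rule Theta_flipI) (use q z in \<open>(simp add: field_simps flip: power_Suc power_add; simp add: power2_eq_square)+\<close>)
  have T3: "Theta (q ^ 4 * (q ^ 13 / z)) (q ^ 6) = Theta (q ^ 5 / z) (q ^ 6) / (q ^ 6 * (q ^ 5 / z) ^ 2)"
    by (rule Theta_up2I[OF _ q6]) (use q z in \<open>simp_all add: field_simps flip: power_Suc power_add power_mult\<close>)
  have T3': "Theta (q ^ 5 / z) (q ^ 6) = Theta (q * z) (q ^ 6)"
    by (rule Theta_flipI) (use q z in \<open>(simp add: field_simps flip: power_Suc power_add; simp add: power2_eq_square)+\<close>)
  have T4: "Theta (q ^ 13 / z) (q ^ 6) = Theta (q / z) (q ^ 6) / (q ^ 6 * (q / z) ^ 2)"
    by (rule Theta_up2I[OF _ q6]) (use q z in \<open>simp_all add: field_simps flip: power_Suc power_add power_mult\<close>)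
  have T4': "Theta (q / z) (q ^ 6) = Theta (q ^ 5 * z) (q ^ 6)"
    by (rule Theta_flipI) (use q z in \<open>(simp add: field_simps flip: power_Suc power_add; simp add: power2_eq_square)+\<close>)
  have m: "q ^ 4 * (q * z ^ 2) = q ^ 5 * z ^ 2" "q ^ 2 * (q * z ^ 2) = q ^ 3 * z ^ 2"
    by (simp_all flip: power_Suc2 mult.assoc)
  have a: "Theta z (q ^ 2) \<noteq> 0"
    using N(2) unfolding T1 .
  have L: "Theta (- z) (q ^ 3) = (Theta (q * z) (q ^ 6) * Theta (q * z ^ 2) (q ^ 6) - z ^ 2 * Theta (q ^ 5 * z) (q ^ 6) * Theta (q ^ 5 * z ^ 2) (q ^ 6)) * qpoch_inf q q / (qpoch_inf (q ^ 2) (q ^ 2) * Theta z (q ^ 2))"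
    using theta_two_term_degree5_shifted[OF q z] a J by (simp add: field_simps)
  have B2: "Theta (- q) (q ^ 4) = qpoch_inf (q ^ 2) (q ^ 2) ^ 2 / qpoch_inf q q"
    using Theta_neg_base4[OF q] J by (simp add: field_simps)
  have S1: "Theta (q * z ^ 2) (q ^ 2) = Theta (q * z ^ 2) (q ^ 6) * Theta (q ^ 3 * z ^ 2) (q ^ 6) * Theta (q ^ 5 * z ^ 2) (q ^ 6) * qpoch_inf (q ^ 2) (q ^ 2) / qpoch_inf (q ^ 6) (q ^ 6) ^ 3"
    by (rule Theta_eq_split3[OF q2 nzs(2) p(1) m(2)]) (simp only: p m)
  have S2: "Theta (z ^ 2) (q ^ 3) = Theta (z ^ 2) (q ^ 6) * Theta (q ^ 3 * z ^ 2) (q ^ 6) * qpoch_inf (q ^ 3) (q ^ 3) / qpoch_inf (q ^ 6) (q ^ 6) ^ 2"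
    by (rule Theta_eq_split2[OF q3 _ p(3) refl]) (use z in simp)
  note S3 = Theta_eq_square[OF q3 z p(3) refl]
  obtain K where K: "Theta (q * z) (q ^ 6) * Theta (q * z ^ 2) (q ^ 6) - z ^ 2 * Theta (q ^ 5 * z) (q ^ 6) * Theta (q ^ 5 * z ^ 2) (q ^ 6) = K" by blast
  note W = N3[unfolded m]
  have G: "(q ^ 2 / z) ^ 2 / q ^ 2 * (Theta (q * z) (q ^ 6) / (q ^ 6 * (q ^ 5 / z) ^ 2)) / Theta (q ^ 5 * z ^ 2) (q ^ 6) -
      Theta (q ^ 5 * z) (q ^ 6) / (q ^ 6 * (q / z) ^ 2) / (q ^ 6 * Theta (q * z ^ 2) (q ^ 6))
    = K / (q ^ 14 * Theta (q * z ^ 2) (q ^ 6) * Theta (q ^ 5 * z ^ 2) (q ^ 6))"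
    unfolding K[symmetric] using W q z by (simp add: divide_simps) algebra
  have F': "D3 (q * z powi (-3)) (q * z ^ 2) (q ^ 9 * z ^ 6) (q ^ 2) = - (z * qpoch_inf (q ^ 6) (q ^ 6) ^ 4 * K /
      (Theta z (q ^ 2) * Theta (q ^ 9 * z ^ 6) (q ^ 18) * Theta (z ^ 3) (q ^ 6) * Theta (q * z ^ 2) (q ^ 6) * Theta (q ^ 5 * z ^ 2) (q ^ 6)))"
    unfolding F T1 T2 T2' T3 T3' T4 T4' m G using q z by (simp add: divide_simps) (simp add: eval_nat_numeral mult_ac)
  show ?thesis unfolding R F' B2 S1 S2 S3 L K
    using nz a W J q z by (simp add: divide_simps) (simp add: eval_nat_numeral mult_ac)
qed

text \<open>At \<open>u ^ 3\<close> the first term vanishes. Over a common denominator the other two contain pairs of theta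
functions with base \<open>q ^ 6\<close> that merge into theta functions with base \<open>q ^ 3\<close>, and the result is the sum in the
quintuple product identity with base \<open>q\<close>.\<close>

lemma D3_quotient_qu5_u9:
  fixes q u :: complex
  assumes q: "q \<noteq> 0" "norm q < 1" and u: "u \<noteq> 0"
    and D: "D3_defined (q * u powi (-5)) (u ^ 3) (u ^ 9) (q ^ 2)" "D3_defined (q * u powi (-5)) (q * u ^ 2) (u ^ 9) (q ^ 2)"
    and nz: "qpoch_inf (q ^ 3) (q ^ 3) * Theta u q * Theta (q * u ^ 2) (q ^ 2) * Theta (q ^ 3 * u ^ 6) (q ^ 6) * Theta (u ^ 3) (q ^ 2) * Theta (u ^ 9) (q ^ 18) \<noteq> 0"
  shows "D3 (q * u powi (-5)) (u ^ 3) (u ^ 9) (q ^ 2) = D3 (q * u powi (-5)) (q * u ^ 2) (u ^ 9) (q ^ 2) \<and>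
         D3 (q * u powi (-5)) (q * u ^ 2) (u ^ 9) (q ^ 2) = - ((q powi (-1) * u ^ 4 * qpoch_inf q q * qpoch_inf (q ^ 2) (q ^ 2) * qpoch_inf (q ^ 6) (q ^ 6) ^ 3 * Theta (u ^ 2) q * Theta (u ^ 3) (q ^ 6)) / (qpoch_inf (q ^ 3) (q ^ 3) * Theta u q * Theta (q * u ^ 2) (q ^ 2) * Theta (q ^ 3 * u ^ 6) (q ^ 6) * Theta (u ^ 3) (q ^ 2) * Theta (u ^ 9) (q ^ 18)))" (is "?L = ?R \<and> _")
proof -
  note q2 = nome_powers(1,2)[OF q] and q3 = nome_powers(3,4)[OF q] and q6 = nome_powers(5,6)[OF q]
  note p = power_of_power[of q] and J = nome_powers(7-10)[OF q]
  have R: "?L = ?R"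
    by (rule D3_reflect[OF q2 _ _ _ D(1) disjI2])
       (use q u in \<open>(simp add: power_int_minus divide_simps power_mult_distrib; ((simp add: power2_eq_square; fail) | algebra))+\<close>)
  have nzs: "q * u powi (-5) \<noteq> 0" "u ^ 3 \<noteq> 0" "u ^ 9 \<noteq> 0" using q u by auto
  have e: "q * u powi (-5) * u ^ 3 = q / u ^ 2" "(q * u powi (-5)) ^ 3 * u ^ 9 = q ^ 3 / u ^ 6" "q ^ 3 / u ^ 6 * u ^ 3 = q ^ 3 / u ^ 3" "u ^ 9 = (u ^ 3) ^ 3"
    using q u by (simp add: power_int_minus divide_simps power_mult_distrib; ((simp add: power2_eq_square; fail) | algebra))+
  note F = D3_eval_0[OF q2 nzs(1,2) D(1) e p(1,2), unfolded p]
  note N = D3_defined_imp_Theta_nonzero[OF q2 nzs D(1), unfolded e(1,2) p]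
  note N3 = Theta_nonzero_thirds[OF q2 nzs(2) N(1), unfolded p]
  have T1: "Theta (q / u ^ 2) (q ^ 2) = Theta (q * u ^ 2) (q ^ 2)"
    by (rule Theta_flipI) (use q u in \<open>(simp add: field_simps flip: power_Suc power_add; simp add: power2_eq_square)+\<close>)
  have T2: "Theta (q ^ 3 / u ^ 6) (q ^ 6) = Theta (q ^ 3 * u ^ 6) (q ^ 6)"
    by (rule Theta_flipI) (use q u in \<open>(simp add: field_simps flip: power_Suc power_add; simp add: power2_eq_square)+\<close>)
  have T3: "Theta (q ^ 4 * (q ^ 3 / u ^ 3)) (q ^ 6) = - Theta (q / u ^ 3) (q ^ 6) / (q / u ^ 3)"
    by (rule Theta_upI[OF _ q6]) (use q u in \<open>simp_all add: field_simps flip: power_Suc power_add\<close>)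
  have T3': "Theta (q / u ^ 3) (q ^ 6) = Theta (q ^ 5 * u ^ 3) (q ^ 6)"
    by (rule Theta_flipI) (use q u in \<open>(simp add: field_simps flip: power_Suc power_add; simp add: power2_eq_square)+\<close>)
  have T4: "Theta (q ^ 2 * (q ^ 3 / u ^ 3)) (q ^ 6) = Theta (q * u ^ 3) (q ^ 6)"
    by (rule Theta_flipI) (use q u in \<open>(simp add: field_simps flip: power_Suc power_add; simp add: power2_eq_square)+\<close>)
  have S0: "Theta (u ^ 3) (q ^ 2) = Theta (u ^ 3) (q ^ 6) * Theta (q ^ 2 * u ^ 3) (q ^ 6) * Theta (q ^ 4 * u ^ 3) (q ^ 6) * qpoch_inf (q ^ 2) (q ^ 2) / qpoch_inf (q ^ 6) (q ^ 6) ^ 3"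
    by (rule Theta_eq_split3[OF q2 nzs(2) p(1) refl]) (simp only: p)
  have S1: "Theta (q * u ^ 3) (q ^ 3) = Theta (q * u ^ 3) (q ^ 6) * Theta (q ^ 4 * u ^ 3) (q ^ 6) * qpoch_inf (q ^ 3) (q ^ 3) / qpoch_inf (q ^ 6) (q ^ 6) ^ 2"
    by (rule Theta_eq_split2[OF q3 _ p(3)]) (use q u in \<open>simp_all flip: power_Suc power_Suc2 mult.assoc\<close>)
  have S2: "Theta (q ^ 2 * u ^ 3) (q ^ 3) = Theta (q ^ 2 * u ^ 3) (q ^ 6) * Theta (q ^ 5 * u ^ 3) (q ^ 6) * qpoch_inf (q ^ 3) (q ^ 3) / qpoch_inf (q ^ 6) (q ^ 6) ^ 2"
    by (rule Theta_eq_split2[OF q3 _ p(3)]) (use q u in \<open>simp_all flip: power_add mult.assoc\<close>)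
  have Q: "Theta (u ^ 2) q = (Theta (q * u ^ 3) (q ^ 3) + u * Theta (q ^ 2 * u ^ 3) (q ^ 3)) * Theta u q / qpoch_inf q q"
    using quintuple_product[OF q u] J by (simp add: field_simps)
  have i: "q powi (-1) = 1 / q"
    by (simp add: power_int_minus field_simps)
  obtain K where K: "Theta (q * u ^ 3) (q ^ 6) * Theta (q ^ 4 * u ^ 3) (q ^ 6) + u * Theta (q ^ 2 * u ^ 3) (q ^ 6) * Theta (q ^ 5 * u ^ 3) (q ^ 6) = K" by blast
  have F': "D3 (q * u powi (-5)) (u ^ 3) (u ^ 9) (q ^ 2) = - (u ^ 4 * qpoch_inf (q ^ 6) (q ^ 6) ^ 4 * K /
      (q * Theta (q * u ^ 2) (q ^ 2) * Theta (u ^ 9) (q ^ 18) * Theta (q ^ 3 * u ^ 6) (q ^ 6) * Theta (q ^ 2 * u ^ 3) (q ^ 6) * Theta (q ^ 4 * u ^ 3) (q ^ 6)))"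
    unfolding F T1 T2 T3 T3' T4 K[symmetric] using N3 q u by (simp add: divide_simps) algebra
  have Q': "Theta (u ^ 2) q = K * qpoch_inf (q ^ 3) (q ^ 3) / qpoch_inf (q ^ 6) (q ^ 6) ^ 2 * Theta u q / qpoch_inf q q"
    unfolding Q S1 S2 K[symmetric] by (simp add: add_divide_distrib distrib_left distrib_right mult_ac)
  show ?thesis unfolding R[symmetric] F' Q' S0 i
    using nz N3 J q u by (simp add: divide_simps)
qed

text \<open>At \<open>q z ^ 3\<close> the middle term vanishes. The numerators of the other two are multiples of
\<open>Theta q (q ^ 6)\<close>; over a common denominator the difference in \<open>quintuple_half\<close> appears.\<close>

lemma D3_quotient_qz4_q9z9:
  fixes q z :: complex
  assumes q: "q \<noteq> 0" "norm q < 1" and z: "z \<noteq> 0"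
    and D: "D3_defined (q * z powi (-4)) z (q ^ 9 * z ^ 9) (q ^ 2)" "D3_defined (q * z powi (-4)) (q * z ^ 3) (q ^ 9 * z ^ 9) (q ^ 2)"
    and nz: "qpoch_inf (q ^ 3) (q ^ 3) * Theta z q * Theta (q * z ^ 2) (q ^ 2) * Theta (z ^ 3) (q ^ 6) * Theta (q * z ^ 3) (q ^ 2) * Theta (q ^ 9 * z ^ 9) (q ^ 18) \<noteq> 0"
  shows "D3 (q * z powi (-4)) z (q ^ 9 * z ^ 9) (q ^ 2) = D3 (q * z powi (-4)) (q * z ^ 3) (q ^ 9 * z ^ 9) (q ^ 2) \<and>
         D3 (q * z powi (-4)) (q * z ^ 3) (q ^ 9 * z ^ 9) (q ^ 2) = - ((z * qpoch_inf q q * qpoch_inf (q ^ 2) (q ^ 2) * qpoch_inf (q ^ 6) (q ^ 6) ^ 3 * Theta (z ^ 2) q * Theta (q ^ 3 * z ^ 3) (q ^ 6)) / (qpoch_inf (q ^ 3) (q ^ 3) * Theta z q * Theta (q * z ^ 2) (q ^ 2) * Theta (z ^ 3) (q ^ 6) * Theta (q * z ^ 3) (q ^ 2) * Theta (q ^ 9 * z ^ 9) (q ^ 18)))" (is "?L = ?R \<and> _")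
proof -
  note q2 = nome_powers(1,2)[OF q] and q3 = nome_powers(3,4)[OF q] and q6 = nome_powers(5,6)[OF q]
  note p = power_of_power[of q] and J = nome_powers(7-10)[OF q]
  have R: "?L = ?R"
    by (rule D3_reflect[OF q2 _ _ _ D(1) disjI2])
       (use q z in \<open>(simp add: power_int_minus divide_simps power_mult_distrib; ((simp add: power2_eq_square; fail) | algebra))+\<close>)
  have nzs: "q * z powi (-4) \<noteq> 0" "q * z ^ 3 \<noteq> 0" "q ^ 9 * z ^ 9 \<noteq> 0" using q z by auto
  have e: "q * z powi (-4) * (q * z ^ 3) = q ^ 2 / z" "(q * z powi (-4)) ^ 3 * (q ^ 9 * z ^ 9) = q ^ 12 / z ^ 3" "q ^ 12 / z ^ 3 * (q * z ^ 3) = q ^ 13" "q ^ 9 * z ^ 9 = q ^ 6 * (q * z ^ 3) ^ 3"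
    using q z by (simp add: power_int_minus divide_simps power_mult_distrib; ((simp add: power2_eq_square; fail) | algebra))+
  note F = D3_eval_3[OF q2 nzs(1,2) D(2) e p(1,2), unfolded p]
  note N = D3_defined_imp_Theta_nonzero[OF q2 nzs D(2), unfolded e(1,2) p]
  note N3 = Theta_nonzero_thirds[OF q2 nzs(2) N(1), unfolded p]
  have T1: "Theta (q ^ 2 / z) (q ^ 2) = Theta z (q ^ 2)"
    by (rule Theta_flipI) (use q z in \<open>(simp add: field_simps flip: power_Suc power_add; simp add: power2_eq_square)+\<close>)
  have T2: "Theta (q ^ 12 / z ^ 3) (q ^ 6) = - Theta (q ^ 6 / z ^ 3) (q ^ 6) / (q ^ 6 / z ^ 3)"
    by (rule Theta_upI[OF _ q6]) (use q z in \<open>simp_all add: field_simps flip: power_Suc power_add\<close>)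
  have T2': "Theta (q ^ 6 / z ^ 3) (q ^ 6) = Theta (z ^ 3) (q ^ 6)"
    by (rule Theta_flipI) (use q z in \<open>(simp add: field_simps flip: power_Suc power_add; simp add: power2_eq_square)+\<close>)
  have T3: "Theta (q ^ 4 * q ^ 13) (q ^ 6) = Theta (q ^ 5) (q ^ 6) / (q ^ 6 * (q ^ 5) ^ 2)"
    by (rule Theta_up2I[OF _ q6]) (use q z in \<open>simp_all add: field_simps flip: power_Suc power_add power_mult\<close>)
  have T3': "Theta (q ^ 5) (q ^ 6) = Theta q (q ^ 6)"
    by (rule Theta_flipI) (use q z in \<open>(simp add: field_simps flip: power_Suc power_add; simp add: power2_eq_square)+\<close>)
  have T4: "Theta (q ^ 13) (q ^ 6) = Theta q (q ^ 6) / (q ^ 6 * q ^ 2)"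
    by (rule Theta_up2I[OF _ q6]) (use q z in \<open>simp_all add: field_simps flip: power_Suc power_add power_mult\<close>)
  have m: "q ^ 4 * (q * z ^ 3) = q ^ 5 * z ^ 3" "q ^ 2 * (q * z ^ 3) = q ^ 3 * z ^ 3"
    by (simp_all flip: power_Suc2 mult.assoc)
  have a: "Theta z (q ^ 2) \<noteq> 0"
    using N(2) unfolding T1 .
  have B1: "Theta q (q ^ 6) = qpoch_inf q q * qpoch_inf (q ^ 6) (q ^ 6) ^ 2 / (qpoch_inf (q ^ 2) (q ^ 2) * qpoch_inf (q ^ 3) (q ^ 3))"
    using Theta_base6[OF q] J by (simp add: field_simps)
  have S1: "Theta (q * z ^ 3) (q ^ 2) = Theta (q * z ^ 3) (q ^ 6) * Theta (q ^ 3 * z ^ 3) (q ^ 6) * Theta (q ^ 5 * z ^ 3) (q ^ 6) * qpoch_inf (q ^ 2) (q ^ 2) / qpoch_inf (q ^ 6) (q ^ 6) ^ 3"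
    by (rule Theta_eq_split3[OF q2 nzs(2) p(1) m(2)]) (simp only: p m)
  have S2: "Theta (z ^ 2) q = Theta (z ^ 2) (q ^ 2) * Theta (q * z ^ 2) (q ^ 2) * qpoch_inf q q / qpoch_inf (q ^ 2) (q ^ 2) ^ 2"
    by (rule Theta_eq_split2[OF q _ refl refl]) (use z in simp)
  note S3 = Theta_eq_square[OF q z refl refl]
  obtain K where K: "Theta (q * z ^ 3) (q ^ 6) - z ^ 2 * Theta (q ^ 5 * z ^ 3) (q ^ 6) = K" by blast
  note W = N3[unfolded m]
  have G: "(q ^ 2 / z) ^ 2 / q ^ 2 * (Theta q (q ^ 6) / (q ^ 6 * (q ^ 5) ^ 2)) / Theta (q ^ 5 * z ^ 3) (q ^ 6) -
      Theta q (q ^ 6) / (q ^ 6 * q ^ 2) / (q ^ 6 * Theta (q * z ^ 3) (q ^ 6))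
    = Theta q (q ^ 6) * K / (q ^ 14 * z ^ 2 * Theta (q * z ^ 3) (q ^ 6) * Theta (q ^ 5 * z ^ 3) (q ^ 6))"
    unfolding K[symmetric] using W q z by (simp add: divide_simps) algebra
  have F': "D3 (q * z powi (-4)) (q * z ^ 3) (q ^ 9 * z ^ 9) (q ^ 2) = - (z * qpoch_inf (q ^ 6) (q ^ 6) ^ 4 * Theta q (q ^ 6) * K /
      (Theta z (q ^ 2) * Theta (q ^ 9 * z ^ 9) (q ^ 18) * Theta (z ^ 3) (q ^ 6) * Theta (q * z ^ 3) (q ^ 6) * Theta (q ^ 5 * z ^ 3) (q ^ 6)))"
    unfolding F T1 T2 T2' T3 T3' T4 m G using q z by (simp add: divide_simps) (simp add: eval_nat_numeral mult_ac)
  show ?thesis unfolding R F' B1 S1 S2 S3 quintuple_half[OF q z a N(1)] K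
    using nz a W J q z by (simp add: divide_simps) (simp add: eval_nat_numeral mult_ac)
qed

section \<open>The eleven evaluations\<close>

theorem theorem3p2:
  fixes q x z u :: complex
  assumes "0 < norm q" and "norm q < 1"
    and "x \<noteq> 0" and "z \<noteq> 0" and "u \<noteq> 0"
  shows "(D3_defined (z powi (-4)) z (q ^ 3 * z ^ 9) q \<and> D3_defined (z powi (-4)) (z ^ 3) (q ^ 3 * z ^ 9) q \<and>
          Theta z q * Theta (z ^ 3) (q ^ 3) * Theta (q ^ 2 * z ^ 3) (q ^ 3) * Theta (q ^ 3 * z ^ 9) (q ^ 9) \<noteq> 0 \<longrightarrow>
          D3 (z powi (-4)) z (q ^ 3 * z ^ 9) q = D3 (z powi (-4)) (z ^ 3) (q ^ 3 * z ^ 9) q \<and>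
          D3 (z powi (-4)) (z ^ 3) (q ^ 3 * z ^ 9) q =
            (z ^ 5 * qpoch_inf q q * qpoch_inf (q ^ 3) (q ^ 3) ^ 4)
               / (Theta z q * Theta (z ^ 3) (q ^ 3) * Theta (q ^ 2 * z ^ 3) (q ^ 3) * Theta (q ^ 3 * z ^ 9) (q ^ 9))) \<and>
         (D3_defined (z powi (-4)) z (q ^ 6 * z ^ 9) q \<and> D3_defined (z powi (-4)) (z ^ 3) (q ^ 6 * z ^ 9) q \<and>
          Theta z q * Theta (z ^ 3) (q ^ 3) * Theta (q * z ^ 3) (q ^ 3) * Theta (q ^ 6 * z ^ 9) (q ^ 9) \<noteq> 0 \<longrightarrow>
          D3 (z powi (-4)) z (q ^ 6 * z ^ 9) q = D3 (z powi (-4)) (z ^ 3) (q ^ 6 * z ^ 9) q \<and>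
          D3 (z powi (-4)) (z ^ 3) (q ^ 6 * z ^ 9) q =
            (z ^ 3 * qpoch_inf q q * qpoch_inf (q ^ 3) (q ^ 3) ^ 4)
               / (Theta z q * Theta (z ^ 3) (q ^ 3) * Theta (q * z ^ 3) (q ^ 3) * Theta (q ^ 6 * z ^ 9) (q ^ 9))) \<and>
         (D3_defined (u powi (-5)) (u ^ 2) (q ^ 3 * u ^ 9) q \<and> D3_defined (u powi (-5)) (u ^ 3) (q ^ 3 * u ^ 9) q \<and>
          Theta u q * Theta (u ^ 6) (q ^ 3) * Theta (q ^ 2 * u ^ 3) (q ^ 3) * Theta (q ^ 3 * u ^ 9) (q ^ 9) \<noteq> 0 \<longrightarrow>
          D3 (u powi (-5)) (u ^ 2) (q ^ 3 * u ^ 9) q = D3 (u powi (-5)) (u ^ 3) (q ^ 3 * u ^ 9) q \<and>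
          D3 (u powi (-5)) (u ^ 3) (q ^ 3 * u ^ 9) q =
            (u ^ 7 * qpoch_inf q q * qpoch_inf (q ^ 3) (q ^ 3) ^ 4)
               / (Theta u q * Theta (u ^ 6) (q ^ 3) * Theta (q ^ 2 * u ^ 3) (q ^ 3) * Theta (q ^ 3 * u ^ 9) (q ^ 9))) \<and>
         (D3_defined (u powi (-5)) (u ^ 2) (q ^ 6 * u ^ 9) q \<and> D3_defined (u powi (-5)) (u ^ 3) (q ^ 6 * u ^ 9) q \<and>
          Theta u q * Theta (u ^ 6) (q ^ 3) * Theta (q * u ^ 3) (q ^ 3) * Theta (q ^ 6 * u ^ 9) (q ^ 9) \<noteq> 0 \<longrightarrow>
          D3 (u powi (-5)) (u ^ 2) (q ^ 6 * u ^ 9) q = D3 (u powi (-5)) (u ^ 3) (q ^ 6 * u ^ 9) q \<and>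
          D3 (u powi (-5)) (u ^ 3) (q ^ 6 * u ^ 9) q =
            (u ^ 5 * qpoch_inf q q * qpoch_inf (q ^ 3) (q ^ 3) ^ 4)
               / (Theta u q * Theta (u ^ 6) (q ^ 3) * Theta (q * u ^ 3) (q ^ 3) * Theta (q ^ 6 * u ^ 9) (q ^ 9))) \<and>
         (D3_defined (q * z powi (-4)) z (z ^ 9) (q ^ 2) \<and> D3_defined (q * z powi (-4)) (q * z ^ 3) (z ^ 9) (q ^ 2) \<and>
          qpoch_inf q q * Theta (q * z ^ 3) (q ^ 2) * Theta (z ^ 9) (q ^ 18) \<noteq> 0 \<longrightarrow>
          D3 (q * z powi (-4)) z (z ^ 9) (q ^ 2) = D3 (q * z powi (-4)) (q * z ^ 3) (z ^ 9) (q ^ 2) \<and>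
          D3 (q * z powi (-4)) (q * z ^ 3) (z ^ 9) (q ^ 2) =
            - ((q powi (-1) * z ^ 4 * qpoch_inf (q ^ 2) (q ^ 2) ^ 2 * Theta (q ^ 3) (q ^ 18) * Theta (- z) q)
               / (qpoch_inf q q * Theta (q * z ^ 3) (q ^ 2) * Theta (z ^ 9) (q ^ 18)))) \<and>
         (D3_defined x q (q ^ 3 * x powi (-3)) (q ^ 2) \<and> D3_defined x (q powi (-1) * x powi (-1)) (q ^ 3 * x powi (-3)) (q ^ 2) \<and>
          qpoch_inf (q ^ 3) (q ^ 3) * Theta x q * Theta (q ^ 2 * x) (q ^ 6) * Theta (q ^ 3 * x powi (-3)) (q ^ 18) \<noteq> 0 \<longrightarrow>
          D3 x q (q ^ 3 * x powi (-3)) (q ^ 2) = D3 x (q powi (-1) * x powi (-1)) (q ^ 3 * x powi (-3)) (q ^ 2) \<and>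
          D3 x (q powi (-1) * x powi (-1)) (q ^ 3 * x powi (-3)) (q ^ 2) =
            - ((x powi (-1) * qpoch_inf (q ^ 6) (q ^ 6) ^ 3 * Theta x (q ^ 2) * Theta (q ^ 4 * x ^ 2) (q ^ 6))
               / (qpoch_inf (q ^ 3) (q ^ 3) * Theta x q * Theta (q ^ 2 * x) (q ^ 6) * Theta (q ^ 3 * x powi (-3)) (q ^ 18)))) \<and>
         (D3_defined (q * z powi (-2)) z (z ^ 3) (q ^ 2) \<and> D3_defined (q * z powi (-2)) (q * z) (z ^ 3) (q ^ 2) \<and>
          Theta z q * Theta (q ^ 3 * z) (q ^ 6) * Theta (q ^ 3 * z ^ 3) (q ^ 6) * Theta (z ^ 3) (q ^ 18) \<noteq> 0 \<longrightarrow>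
          D3 (q * z powi (-2)) z (z ^ 3) (q ^ 2) = D3 (q * z powi (-2)) (q * z) (z ^ 3) (q ^ 2) \<and>
          D3 (q * z powi (-2)) (q * z) (z ^ 3) (q ^ 2) =
            - ((q powi (-1) * z * qpoch_inf (q ^ 3) (q ^ 3) * qpoch_inf (q ^ 6) (q ^ 6) ^ 2 * Theta (q * z) (q ^ 2) * Theta (z ^ 2) (q ^ 6))
               / (Theta z q * Theta (q ^ 3 * z) (q ^ 6) * Theta (q ^ 3 * z ^ 3) (q ^ 6) * Theta (z ^ 3) (q ^ 18)))) \<and>
         (D3_defined x q (q ^ 9) (q ^ 2) \<and> D3_defined x (q * x powi (-1)) (q ^ 9) (q ^ 2) \<and>
          Theta (q ^ 9) (q ^ 18) * Theta x q * Theta (q * x ^ 2) (q ^ 2) * Theta (q ^ 3 * x ^ 3) (q ^ 6) \<noteq> 0 \<longrightarrow>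
          D3 x q (q ^ 9) (q ^ 2) = D3 x (q * x powi (-1)) (q ^ 9) (q ^ 2) \<and>
          D3 x (q * x powi (-1)) (q ^ 9) (q ^ 2) =
            - ((q * x powi (-1) * Theta (- q) (q ^ 4) * qpoch_inf (q ^ 3) (q ^ 3) * qpoch_inf (q ^ 6) (q ^ 6) ^ 2 * Theta (x ^ 2) q)
               / (Theta (q ^ 9) (q ^ 18) * Theta x q * Theta (q * x ^ 2) (q ^ 2) * Theta (q ^ 3 * x ^ 3) (q ^ 6)))) \<and>
         (D3_defined (q * z powi (-3)) z (q ^ 9 * z ^ 6) (q ^ 2) \<and> D3_defined (q * z powi (-3)) (q * z ^ 2) (q ^ 9 * z ^ 6) (q ^ 2) \<and>
          Theta (q * z ^ 2) (q ^ 2) * Theta z (q ^ 3) * Theta (z ^ 3) (q ^ 6) * Theta (q ^ 9 * z ^ 6) (q ^ 18) \<noteq> 0 \<longrightarrow>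
          D3 (q * z powi (-3)) z (q ^ 9 * z ^ 6) (q ^ 2) = D3 (q * z powi (-3)) (q * z ^ 2) (q ^ 9 * z ^ 6) (q ^ 2) \<and>
          D3 (q * z powi (-3)) (q * z ^ 2) (q ^ 9 * z ^ 6) (q ^ 2) =
            - ((z * Theta (- q) (q ^ 4) * qpoch_inf (q ^ 3) (q ^ 3) * qpoch_inf (q ^ 6) (q ^ 6) ^ 2 * Theta (z ^ 2) (q ^ 3))
               / (Theta (q * z ^ 2) (q ^ 2) * Theta z (q ^ 3) * Theta (z ^ 3) (q ^ 6) * Theta (q ^ 9 * z ^ 6) (q ^ 18)))) \<and>
         (D3_defined (q * u powi (-5)) (u ^ 3) (u ^ 9) (q ^ 2) \<and> D3_defined (q * u powi (-5)) (q * u ^ 2) (u ^ 9) (q ^ 2) \<and>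
          qpoch_inf (q ^ 3) (q ^ 3) * Theta u q * Theta (q * u ^ 2) (q ^ 2) * Theta (q ^ 3 * u ^ 6) (q ^ 6) * Theta (u ^ 3) (q ^ 2) * Theta (u ^ 9) (q ^ 18) \<noteq> 0 \<longrightarrow>
          D3 (q * u powi (-5)) (u ^ 3) (u ^ 9) (q ^ 2) = D3 (q * u powi (-5)) (q * u ^ 2) (u ^ 9) (q ^ 2) \<and>
          D3 (q * u powi (-5)) (q * u ^ 2) (u ^ 9) (q ^ 2) =
            - ((q powi (-1) * u ^ 4 * qpoch_inf q q * qpoch_inf (q ^ 2) (q ^ 2) * qpoch_inf (q ^ 6) (q ^ 6) ^ 3 * Theta (u ^ 2) q * Theta (u ^ 3) (q ^ 6))
               / (qpoch_inf (q ^ 3) (q ^ 3) * Theta u q * Theta (q * u ^ 2) (q ^ 2) * Theta (q ^ 3 * u ^ 6) (q ^ 6) * Theta (u ^ 3) (q ^ 2) * Theta (u ^ 9) (q ^ 18)))) \<and>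
         (D3_defined (q * z powi (-4)) z (q ^ 9 * z ^ 9) (q ^ 2) \<and> D3_defined (q * z powi (-4)) (q * z ^ 3) (q ^ 9 * z ^ 9) (q ^ 2) \<and>
          qpoch_inf (q ^ 3) (q ^ 3) * Theta z q * Theta (q * z ^ 2) (q ^ 2) * Theta (z ^ 3) (q ^ 6) * Theta (q * z ^ 3) (q ^ 2) * Theta (q ^ 9 * z ^ 9) (q ^ 18) \<noteq> 0 \<longrightarrow>
          D3 (q * z powi (-4)) z (q ^ 9 * z ^ 9) (q ^ 2) = D3 (q * z powi (-4)) (q * z ^ 3) (q ^ 9 * z ^ 9) (q ^ 2) \<and>
          D3 (q * z powi (-4)) (q * z ^ 3) (q ^ 9 * z ^ 9) (q ^ 2) =
            - ((z * qpoch_inf q q * qpoch_inf (q ^ 2) (q ^ 2) * qpoch_inf (q ^ 6) (q ^ 6) ^ 3 * Theta (z ^ 2) q * Theta (q ^ 3 * z ^ 3) (q ^ 6))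
               / (qpoch_inf (q ^ 3) (q ^ 3) * Theta z q * Theta (q * z ^ 2) (q ^ 2) * Theta (z ^ 3) (q ^ 6) * Theta (q * z ^ 3) (q ^ 2) * Theta (q ^ 9 * z ^ 9) (q ^ 18))))"
proof -
  have q: "q \<noteq> 0" "norm q < 1" using assms(1,2) by auto
  show ?thesis
  proof (intro conjI, goal_cases)
    case 1
    show ?case using D3_quotient_z4_q3z9[OF q assms(4)] by blast
  next
    case 2
    show ?case using D3_quotient_z4_q6z9[OF q assms(4)] by blast
  next
    case 3
    show ?case using D3_quotient_u5_q3u9[OF q assms(5)] by blast
  next
    case 4
    show ?case using D3_quotient_u5_q6u9[OF q assms(5)] by blast
  next
    case 5
    show ?case using D3_quotient_qz4_z9[OF q assms(4)] by blast
  next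
    case 6
    show ?case using D3_quotient_x_q3x3[OF q assms(3)] by blast
  next
    case 7
    show ?case using D3_quotient_qz2_z3[OF q assms(4)] by blast
  next
    case 8
    show ?case using D3_quotient_x_q9[OF q assms(3)] by blast
  next
    case 9
    show ?case using D3_quotient_qz3_q9z6[OF q assms(4)] by blast
  next
    case 10
    show ?case using D3_quotient_qu5_u9[OF q assms(5)] by blast
  next
    case 11
    show ?case using D3_quotient_qz4_q9z9[OF q assms(4)] by blast
  qed
qed

end
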